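(* Let $Y$ be the unit cotangent bundle of the $n$-torus $\mathbb{T}^n=(\mathbb{R}/\mathbb{Z})^n$, let $\Omega\subset\mathbb{R}/\mathbb{Z}\times SY$ be any starshaped domain, and let $M$ be any contact manifold of dimension $2n+1$. Then there is a contact embedding $\varphi:\Omega\to M$.
   Context: The symplectization $SY$ of the unit cotangent bundle $Y$ of $\mathbb{T}^n$ is identified with the complement of the zero section in $T^*\mathbb{T}^n$, i.e. with $\mathbb{T}^n\times(\mathbb{R}^n\setminus\{0\})$ with coordinates $(q_1,\dots,q_n,p_1,\dots,p_n)$, with one-form $\lambda=\sum_i p_i\,\mathrm{d}q_i$ and with time $s$ Liouville flow $z=(q,p)\mapsto e^sz=(q,e^sp)$. The manifold $Q=\mathbb{R}/\mathbb{Z}\times SY$ carries the contact form $\mathrm{d}t-\lambda$, where $t$ is the coordinate on $\mathbb{R}/\mathbb{Z}$. A starshaped domain is a set $\Omega=\{E\le 1\}\subset Q$, where $E:Q\to(0,\infty)$ is a smooth function with $E(t,e^sz)=e^sE(t,z)$ for all $s\in\mathbb{R}$. Manifolds are nonempty. A contact embedding is a smooth embedding between contact manifolds of the same dimension (possibly with boundary) whose differential maps contact hyperplanes onto contact hyperplanes. *)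

theory Defs
  imports "HOL-Analysis.Analysis"
begin

section \<open>Smooth maps between subsets of Euclidean spaces\<close>

primrec Ck_on :: "nat \<Rightarrow> 'a::real_normed_vector set \<Rightarrow> ('a \<Rightarrow> 'b::real_normed_vector) \<Rightarrow> bool" where
  "Ck_on 0 U f \<longleftrightarrow> continuous_on U f"
| "Ck_on (Suc k) U f \<longleftrightarrow>
     f differentiable_on U \<and> (\<forall>v. Ck_on k U (\<lambda>x. frechet_derivative f (at x) v))"

text \<open>\<^const>\<open>Ck_on\<close> is meant for open sets only. On an arbitrary set, smooth means locally the
  restriction of a smooth map on an open set, as usual for manifolds with boundary.\<close>

definition smooth_on :: "'a::real_normed_vector set \<Rightarrow> ('a \<Rightarrow> 'b::real_normed_vector) \<Rightarrow> bool" where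
  "smooth_on S f \<longleftrightarrow>
     (\<forall>x\<in>S. \<exists>U g. open U \<and> x \<in> U \<and> (\<forall>k. Ck_on k U g) \<and> (\<forall>y\<in>S \<inter> U. g y = f y))"

section \<open>Smooth manifolds, possibly with boundary\<close>

text \<open>A chart \<open>(U, f)\<close> is given by its domain \<open>U\<close> and a map \<open>f\<close>, whose values
  outside \<open>U\<close> are irrelevant.\<close>

type_synonym ('m, 'e) chart = "'m set \<times> ('m \<Rightarrow> 'e)"

record ('m, 'e) manifold_data =
  mtop :: "'m topology"
  charts :: "('m, 'e) chart set"

definition charts_at :: "('m, 'e, 'z) manifold_data_scheme \<Rightarrow> 'm \<Rightarrow> ('m, 'e) chart set" where
  "charts_at M x = {c \<in> charts M. x \<in> fst c}"

definition chart_inv :: "('m, 'e) chart \<Rightarrow> 'e \<Rightarrow> 'm" where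
  "chart_inv c = inv_into (fst c) (snd c)"

text \<open>The image of a chart is relatively open in \<open>{y. 0 \<le> b \<bullet> y}\<close>, which is a closed half-space
  if \<open>b \<noteq> 0\<close> (boundary charts) and the whole space if \<open>b = 0\<close> (interior charts). The atlas need
  not be maximal. The dimension of the manifold is \<open>DIM('e)\<close>.\<close>

definition smooth_manifold :: "('m, 'e::euclidean_space, 'z) manifold_data_scheme \<Rightarrow> bool" where
  "smooth_manifold M \<longleftrightarrow>
     topspace (mtop M) \<noteq> {} \<and> Hausdorff_space (mtop M) \<and> second_countable (mtop M) \<and>
     (\<Union>(U, f)\<in>charts M. U) = topspace (mtop M) \<and>
     (\<forall>(U, f)\<in>charts M. openin (mtop M) U \<and>
        homeomorphic_map (subtopology (mtop M) U) (top_of_set (f ` U)) f \<and>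
        (\<exists>b. openin (top_of_set {y. 0 \<le> b \<bullet> y}) (f ` U))) \<and>
     (\<forall>c\<in>charts M. \<forall>d\<in>charts M.
        smooth_on (snd c ` (fst c \<inter> fst d)) (snd d \<circ> chart_inv c))"

text \<open>A tangent vector at \<open>x\<close> is the family of its coordinate vectors in the charts around \<open>x\<close>,
  which are related by the derivatives of the coordinate changes.\<close>

definition tangent_space ::
    "('m, 'e::euclidean_space, 'z) manifold_data_scheme \<Rightarrow> 'm \<Rightarrow> (('m, 'e) chart \<Rightarrow> 'e) set" where
  "tangent_space M x =
     {v. (\<forall>c\<in>charts_at M x. \<forall>d\<in>charts_at M x.
            v d = frechet_derivative (snd d \<circ> chart_inv c)
                    (at (snd c x) within snd c ` (fst c \<inter> fst d)) (v c)) \<and>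
         (\<forall>c. c \<notin> charts_at M x \<longrightarrow> v c = 0)}"

text \<open>Maps defined on a subset \<open>A\<close> of a manifold \<open>N\<close>: either all of \<open>N\<close>, or a subdomain of full
  dimension with smooth boundary. The tangent spaces of such an \<open>A\<close>, also at its boundary points,
  are those of \<open>N\<close>, and the derivative within the image of \<open>A\<close> in a chart is unique.\<close>

definition coord_dom ::
    "'n set \<Rightarrow> ('n \<Rightarrow> 'm) \<Rightarrow> ('n, 'd) chart \<Rightarrow> ('m, 'e) chart \<Rightarrow> 'd set" where
  "coord_dom A \<phi> c d = snd c ` {x \<in> A. x \<in> fst c \<and> \<phi> x \<in> fst d}"

definition smooth_map_on ::
    "('n, 'd::euclidean_space, 'y) manifold_data_scheme \<Rightarrow> 'n set \<Rightarrow>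
     ('m, 'e::euclidean_space, 'z) manifold_data_scheme \<Rightarrow> ('n \<Rightarrow> 'm) \<Rightarrow> bool" where
  "smooth_map_on N A M \<phi> \<longleftrightarrow>
     continuous_map (subtopology (mtop N) A) (mtop M) \<phi> \<and>
     (\<forall>c\<in>charts N. \<forall>d\<in>charts M. smooth_on (coord_dom A \<phi> c d) (snd d \<circ> \<phi> \<circ> chart_inv c))"

definition smooth_real_on ::
    "('n, 'd::euclidean_space, 'y) manifold_data_scheme \<Rightarrow> 'n set \<Rightarrow> ('n \<Rightarrow> real) \<Rightarrow> bool" where
  "smooth_real_on N A h \<longleftrightarrow>
     (\<forall>c\<in>charts N. smooth_on (snd c ` (A \<inter> fst c)) (h \<circ> chart_inv c))"

text \<open>The differential at \<open>x\<close>; it does not depend on the chosen chart \<open>c\<close> around \<open>x\<close>.\<close>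

definition differential_on ::
    "('n, 'd::euclidean_space, 'y) manifold_data_scheme \<Rightarrow> 'n set \<Rightarrow>
     ('m, 'e::euclidean_space, 'z) manifold_data_scheme \<Rightarrow> ('n \<Rightarrow> 'm) \<Rightarrow> 'n \<Rightarrow>
     (('n, 'd) chart \<Rightarrow> 'd) \<Rightarrow> (('m, 'e) chart \<Rightarrow> 'e)" where
  "differential_on N A M \<phi> x v = (\<lambda>d.
     if d \<in> charts_at M (\<phi> x)
     then let c = (SOME c. c \<in> charts_at N x)
          in frechet_derivative (snd d \<circ> \<phi> \<circ> chart_inv c)
               (at (snd c x) within coord_dom A \<phi> c d) (v c)
     else 0)"

definition smooth_embedding_on ::
    "('n, 'd::euclidean_space, 'y) manifold_data_scheme \<Rightarrow> 'n set \<Rightarrow>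
     ('m, 'e::euclidean_space, 'z) manifold_data_scheme \<Rightarrow> ('n \<Rightarrow> 'm) \<Rightarrow> bool" where
  "smooth_embedding_on N A M \<phi> \<longleftrightarrow>
     smooth_map_on N A M \<phi> \<and>
     embedding_map (subtopology (mtop N) A) (mtop M) \<phi> \<and>
     (\<forall>x\<in>A. inj_on (differential_on N A M \<phi> x) (tangent_space N x))"

section \<open>Contact manifolds\<close>

text \<open>A one-form on an open set \<open>W\<close> of a vector space, written as \<open>\<alpha> y v\<close> for \<open>y\<close> in \<open>W\<close> and a
  vector \<open>v\<close>.\<close>

definition smooth_form_on :: "'e::euclidean_space set \<Rightarrow> ('e \<Rightarrow> 'e \<Rightarrow> real) \<Rightarrow> bool" where
  "smooth_form_on W \<alpha> \<longleftrightarrow> (\<forall>y\<in>W. linear (\<alpha> y)) \<and> (\<forall>v. smooth_on W (\<lambda>y. \<alpha> y v))"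

definition ext_deriv :: "('e::euclidean_space \<Rightarrow> 'e \<Rightarrow> real) \<Rightarrow> 'e \<Rightarrow> 'e \<Rightarrow> 'e \<Rightarrow> real" where
  "ext_deriv \<alpha> y u v = frechet_derivative (\<lambda>z. \<alpha> z v) (at y) u
                       - frechet_derivative (\<lambda>z. \<alpha> z u) (at y) v"

text \<open>Nonzero, with exterior derivative nondegenerate on the kernel; in dimension \<open>2 n + 1\<close> this is
  the nonvanishing of \<open>\<alpha> \<and> (d \<alpha>)\<^sup>n\<close>.\<close>

definition contact_form_on :: "'e::euclidean_space set \<Rightarrow> ('e \<Rightarrow> 'e \<Rightarrow> real) \<Rightarrow> bool" where
  "contact_form_on W \<alpha> \<longleftrightarrow> smooth_form_on W \<alpha> \<and>
     (\<forall>y\<in>W. (\<exists>v. \<alpha> y v \<noteq> 0) \<and>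
        (\<forall>u. \<alpha> y u = 0 \<and> (\<forall>v. \<alpha> y v = 0 \<longrightarrow> ext_deriv \<alpha> y u v = 0) \<longrightarrow> u = 0))"

record ('m, 'e) contact_data = "('m, 'e) manifold_data" +
  hyperplane :: "'m \<Rightarrow> (('m, 'e) chart \<Rightarrow> 'e) set"

text \<open>The hyperplane field is locally, but not necessarily globally, the kernel of a contact form
  (no coorientability). Near a boundary point the form is required on a full neighbourhood in
  \<open>'e\<close>, which is no restriction, as being a contact form is an open condition.\<close>

definition contact_manifold :: "('m, 'e::euclidean_space) contact_data \<Rightarrow> bool" where
  "contact_manifold M \<longleftrightarrow>
     smooth_manifold M \<and>
     (\<forall>x\<in>topspace (mtop M). hyperplane M x \<subseteq> tangent_space M x) \<and>
     (\<forall>x\<in>topspace (mtop M). \<forall>c\<in>charts_at M x. \<exists>W \<alpha>. open W \<and> snd c x \<in> W \<and>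
        contact_form_on W \<alpha> \<and>
        (\<forall>y\<in>fst c. snd c y \<in> W \<longrightarrow>
           (\<lambda>v. v c) ` hyperplane M y = {e. \<alpha> (snd c y) e = 0}))"

text \<open>Contact embeddings of \<open>A\<close>, with the contact structure induced from \<open>N\<close>. The equality of
  dimensions is expressed by \<open>DIM('d) = DIM('e)\<close>.\<close>

definition contact_embedding_on ::
    "('n, 'd::euclidean_space) contact_data \<Rightarrow> 'n set \<Rightarrow>
     ('m, 'e::euclidean_space) contact_data \<Rightarrow> ('n \<Rightarrow> 'm) \<Rightarrow> bool" where
  "contact_embedding_on N A M \<phi> \<longleftrightarrow>
     DIM('d) = DIM('e) \<and> smooth_embedding_on N A M \<phi> \<and>
     (\<forall>x\<in>A. differential_on N A M \<phi> x ` hyperplane N x = hyperplane M (\<phi> x))"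

section \<open>The contact manifold \<open>\<real>/\<int> \<times> SY\<close> and its starshaped domains\<close>

quotient_type circle = real / "\<lambda>x y. x - y \<in> \<int>"
proof (rule equivpI)
  show "reflp (\<lambda>x y::real. x - y \<in> \<int>)"
    by (simp add: reflp_def)
  show "symp (\<lambda>x y::real. x - y \<in> \<int>)"
    by (metis (no_types, lifting) Ints_minus minus_diff_eq sympI)
  show "transp (\<lambda>x y::real. x - y \<in> \<int>)"
  proof (rule transpI)
    fix x y z :: real
    assume "x - y \<in> \<int>" "y - z \<in> \<int>"
    then have "(x - y) + (y - z) \<in> \<int>" by (rule Ints_add)
    then show "x - z \<in> \<int>" by simp
  qed
qed

instantiation circle :: topological_space
begin

definition open_circle :: "circle set \<Rightarrow> bool" where
  "open_circle U \<longleftrightarrow> open (abs_circle -` U)"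

instance
  by standard (auto simp: open_circle_def vimage_Union)

end

text \<open>Points \<open>(t, q, p)\<close>, with \<open>t\<close> in \<open>\<real>/\<int>\<close>, \<open>q\<close> in the torus and \<open>p\<close> in \<open>\<real>\<^sup>n\<close>, and the
  covering map to this space.\<close>

type_synonym 'n qpoint = "circle \<times> (circle ^ 'n) \<times> (real ^ 'n)"
type_synonym 'n qcoord = "real \<times> (real ^ 'n) \<times> (real ^ 'n)"

definition Qcover :: "'n qcoord \<Rightarrow> 'n::finite qpoint" where
  "Qcover = (\<lambda>(t, q, p). (abs_circle t, (\<chi> i. abs_circle (q $ i)), p))"

definition Qset :: "'n::finite qpoint set" where
  "Qset = {(t, q, p). p \<noteq> 0}"

text \<open>The charts of this manifold are the local inverses of the covering map.\<close>

definition Qcharts :: "('n::finite qpoint, 'n qcoord) chart set" where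
  "Qcharts = {(Qcover ` V, inv_into V Qcover) | V.
                open V \<and> inj_on Qcover V \<and> Qcover ` V \<subseteq> Qset}"

text \<open>\<open>dt - \<lambda>\<close> at a point with momentum \<open>p\<close>, on the coordinate vector \<open>(\<tau>, \<eta>, \<zeta>)\<close>.\<close>

definition Qform :: "real ^ 'n \<Rightarrow> 'n::finite qcoord \<Rightarrow> real" where
  "Qform p = (\<lambda>(\<tau>, \<eta>, \<zeta>). \<tau> - (\<Sum>i\<in>UNIV. p $ i * \<eta> $ i))"

definition Qmanifold :: "('n::finite qpoint, 'n qcoord) manifold_data" where
  "Qmanifold = \<lparr>mtop = top_of_set Qset, charts = Qcharts\<rparr>"

definition Qcontact :: "('n::finite qpoint, 'n qcoord) contact_data" where
  "Qcontact = \<lparr>mtop = top_of_set Qset, charts = Qcharts,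
        hyperplane = (\<lambda>z. {v \<in> tangent_space Qmanifold z.
          \<forall>c\<in>charts_at Qmanifold z. Qform (snd (snd z)) (v c) = 0})\<rparr>"

definition starshaped_domain :: "'n::finite qpoint set \<Rightarrow> bool" where
  "starshaped_domain \<Omega> \<longleftrightarrow>
     (\<exists>E. smooth_real_on Qcontact Qset E \<and> (\<forall>z\<in>Qset. 0 < E z) \<and>
          (\<forall>s t q p. p \<noteq> 0 \<longrightarrow> E (t, q, exp s *\<^sub>R p) = exp s * E (t, q, p)) \<and>
          \<Omega> = {z \<in> Qset. E z \<le> 1})"

end

(*
  On the domain the momenta are bounded. In the angles t - C (q_1 + ... + q_n), q_1, ..., q_n, with a large
  integer C, the form dt - lambda has the positive coefficients 1, C - p_1, ..., C - p_n, so the domain lies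
  in the cone over the sphere S^(2n+1), and the Cayley transform followed by a dilation moves it into
  an arbitrarily small ball of the Heisenberg group. The Darboux theorem, proved by the Moser method, maps this
  ball into any contact manifold. The flow it needs is built from Picard iteration over short times, and its
  smoothness in the initial point follows because its derivatives solve linear equations of the same kind.
*)
theory Submission
  imports Defs
begin

section \<open>Calculus of \<open>C\<^sup>k\<close> maps\<close>

text \<open>Darboux's theorem yields only a small ball, while the domain has a fixed size. What
  removes the obstacle is that only hyperplanes have to match: the Heisenberg dilation (s, w) ->
  (a^2 s, a w) multiplies the standard form by a^2, so every bounded set fits into the Darboux ball.
  The origin of the angles: with \<theta> = t - C (q_1 + ... + q_n) one has dt - \<lambda> = d
  \<theta> + sum (C - p_i) dq_i, and the map to the point z with squared moduli 1, C - p_i and these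
  angles pulls Im sum conj(z_j) dz_j back to 2 pi times this form; C is an integer so that \<theta>
  is an angle. Since |z_0| = 1 < |z|, the pole of the Cayley transform is avoided. The map extends
  over p = 0, where the domain fails to be closed, and this makes compactness available. Times are
  short because a L <= 1/4 makes Picard's operator contract by 1/4 and lets Gronwall's estimate
  absorb a quarter; time one is a composition of finitely many steps. At boundary points of the
  domain, derivatives are unique because of Euler's identity for E. Charts of M may have boundary,
  so an interior point is chosen.\<close>

lemma has_derivative_frechet_open:
  assumes "f differentiable_on U" "open U" "x \<in> U"
  shows "(f has_derivative frechet_derivative f (at x)) (at x)"
  using assms by (metis at_within_open differentiable_on_def frechet_derivative_works)

lemma has_derivative_cong_open:
  assumes "open U" "x \<in> U" "\<And>y. y \<in> U \<Longrightarrow> f y = g y"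
  shows "(f has_derivative D) (at x) \<longleftrightarrow> (g has_derivative D) (at x)"
  using assms by (metis has_derivative_transform_within_open)

lemma frechet_derivative_cong_open:
  assumes "open U" "x \<in> U" "\<And>y. y \<in> U \<Longrightarrow> f y = g y"
  shows "frechet_derivative f (at x) = frechet_derivative g (at x)"
  unfolding frechet_derivative_def using has_derivative_cong_open[OF assms] by simp

lemma Ck_on_cong:
  assumes "open U" "\<And>x. x \<in> U \<Longrightarrow> f x = g x" "Ck_on k U f"
  shows "Ck_on k U g"
  using assms(2,3)
proof (induction k arbitrary: f g)
  case 0
  then show ?case by (metis Ck_on.simps(1) continuous_on_eq)
next
  case (Suc k)
  have "g differentiable_on U"
    unfolding differentiable_on_def
  proof
    fix x assume x: "x \<in> U"
    have "(f has_derivative frechet_derivative f (at x)) (at x)"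
      using Suc.prems(2) x assms(1) has_derivative_frechet_open by auto
    then have "(g has_derivative frechet_derivative f (at x)) (at x)"
      using has_derivative_cong_open[OF assms(1) x, of f g] Suc.prems(1) by blast
    then show "g differentiable at x within U"
      by (meson differentiable_def differentiable_at_withinI)
  qed
  moreover have "Ck_on k U (\<lambda>x. frechet_derivative g (at x) v)" for v
  proof (rule Suc.IH)
    show "Ck_on k U (\<lambda>x. frechet_derivative f (at x) v)" using Suc.prems(2) by simp
    show "frechet_derivative f (at x) v = frechet_derivative g (at x) v" if "x \<in> U" for x
      using frechet_derivative_cong_open[OF assms(1) that, of f g] Suc.prems(1) by simp
  qed
  ultimately show ?case by simp
qed

text \<open>\<open>Ck_on\<close> refers to \<open>frechet_derivative\<close>, a chosen value;
  uniqueness of derivatives allows any explicit family \<open>f'\<close> in its place.\<close>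

lemma Ck_on_SucI:
  assumes "open U" "\<And>x. x \<in> U \<Longrightarrow> (f has_derivative f' x) (at x)" "\<And>v. Ck_on k U (\<lambda>x. f' x v)"
  shows "Ck_on (Suc k) U f"
proof -
  have "f differentiable_on U"
    using assms(2) by (auto simp: differentiable_on_def differentiable_def intro: has_derivative_at_withinI)
  moreover have "Ck_on k U (\<lambda>x. frechet_derivative f (at x) v)" for v
    by (rule Ck_on_cong[OF assms(1) _ assms(3)[of v]]) (use assms(2) frechet_derivative_at in metis)
  ultimately show ?thesis by simp
qed

lemma Ck_on_SucD:
  assumes "open U" "Ck_on (Suc k) U f"
  shows "\<And>x. x \<in> U \<Longrightarrow> (f has_derivative frechet_derivative f (at x)) (at x)"
    "\<And>v. Ck_on k U (\<lambda>x. frechet_derivative f (at x) v)"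
  using assms has_derivative_frechet_open by auto

lemma Ck_on_Suc_imp: "Ck_on (Suc k) U f \<Longrightarrow> Ck_on k U f"
proof (induction k arbitrary: f)
  case 0
  then show ?case using differentiable_imp_continuous_on by auto
next
  case (Suc k)
  then show ?case by (metis Ck_on.simps(2))
qed

lemma Ck_on_imp_continuous_on: "Ck_on k U f \<Longrightarrow> continuous_on U f"
  by (induction k) (auto dest: differentiable_imp_continuous_on)

lemma Ck_on_subset: "Ck_on k U f \<Longrightarrow> V \<subseteq> U \<Longrightarrow> Ck_on k V f"
  by (induction k arbitrary: f) (auto intro: continuous_on_subset differentiable_on_subset)

lemma Ck_on_local:
  assumes "\<And>x. x \<in> U \<Longrightarrow> \<exists>V. open V \<and> x \<in> V \<and> Ck_on k V f"
  shows "Ck_on k U f"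
  using assms
proof (induction k arbitrary: f)
  case 0
  then show ?case
    by (metis Ck_on.simps(1) continuous_at_imp_continuous_on continuous_on_eq_continuous_at)
next
  case (Suc k)
  then have "f differentiable_on U" unfolding differentiable_on_def
    by (metis Ck_on_SucD(1) differentiable_def differentiable_at_withinI)
  moreover have "Ck_on k U (\<lambda>x. frechet_derivative f (at x) v)" for v
  proof (rule Suc.IH)
    fix x assume "x \<in> U"
    then obtain V where "open V" "x \<in> V" "Ck_on (Suc k) V f" using Suc.prems by blast
    then show "\<exists>V. open V \<and> x \<in> V \<and> Ck_on k V (\<lambda>x. frechet_derivative f (at x) v)"
      by (intro exI[of _ V]) auto
  qed
  ultimately show ?case by simp
qed

section \<open>Closure properties of C^k maps\<close>

lemma Ck_on_const: "open U \<Longrightarrow> Ck_on k U (\<lambda>x. c)"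
  by (induction k arbitrary: c) (auto intro!: Ck_on_SucI[where f' = "\<lambda>_ _. 0"] derivative_intros)

lemma Ck_on_bounded_linear:
  assumes "bounded_linear f" "open U" shows "Ck_on k U f"
proof (cases k)
  case 0
  then show ?thesis using assms by (simp add: linear_continuous_on)
next
  case (Suc m)
  then show ?thesis
    using assms by (auto intro!: Ck_on_SucI[where f' = "\<lambda>_. f"] Ck_on_const bounded_linear_imp_has_derivative simp del: Ck_on.simps)
qed

lemma Ck_on_linear_comp:
  assumes "bounded_linear h" "open U" "Ck_on k U f" shows "Ck_on k U (\<lambda>x. h (f x))"
  using assms(3)
proof (induction k arbitrary: f)
  case 0
  then show ?case using assms(1) by (auto intro: bounded_linear.continuous_on)
next
  case (Suc k)
  show ?case
    using Ck_on_SucD[OF assms(2) Suc.prems] Suc.IH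
    by (intro Ck_on_SucI[OF assms(2), where f' = "\<lambda>x v. h (frechet_derivative f (at x) v)"])
      (auto intro: bounded_linear.has_derivative[OF assms(1)])
qed

lemma Ck_on_add:
  assumes "open U" "Ck_on k U f" "Ck_on k U g" shows "Ck_on k U (\<lambda>x. f x + g x)"
  using assms(2,3)
proof (induction k arbitrary: f g)
  case 0
  then show ?case by (auto intro: continuous_intros)
next
  case (Suc k)
  show ?case
    using Ck_on_SucD[OF assms(1) Suc.prems(1)] Ck_on_SucD[OF assms(1) Suc.prems(2)] Suc.IH
    by (intro Ck_on_SucI[OF assms(1), where f' = "\<lambda>x v. frechet_derivative f (at x) v + frechet_derivative g (at x) v"])
      (auto intro: has_derivative_add)
qed

lemma Ck_on_sum:
  assumes "open U" "\<And>i. i \<in> I \<Longrightarrow> Ck_on k U (f i)" shows "Ck_on k U (\<lambda>x. \<Sum>i\<in>I. f i x)"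
proof (cases "finite I")
  case True
  then show ?thesis using assms(2)
    by (induction I) (auto intro: Ck_on_const Ck_on_add assms(1))
qed (use assms Ck_on_const in auto)

lemma Ck_on_bilinear:
  assumes "bounded_bilinear bil" "open U" "Ck_on k U f" "Ck_on k U g"
  shows "Ck_on k U (\<lambda>x. bil (f x) (g x))"
  using assms(3,4)
proof (induction k arbitrary: f g)
  case 0
  then show ?case using bounded_bilinear.continuous_on[OF assms(1)] by auto
next
  case (Suc k)
  note f = Ck_on_SucD[OF assms(2) Suc.prems(1)] and g = Ck_on_SucD[OF assms(2) Suc.prems(2)]
  show ?case
  proof (rule Ck_on_SucI[OF assms(2)])
    fix x assume "x \<in> U"
    then show "((\<lambda>x. bil (f x) (g x)) has_derivative
      (\<lambda>v. bil (f x) (frechet_derivative g (at x) v) + bil (frechet_derivative f (at x) v) (g x))) (at x)"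
      by (intro bounded_bilinear.FDERIV[OF assms(1)] f g)
  next
    fix v
    show "Ck_on k U (\<lambda>x. bil (f x) (frechet_derivative g (at x) v) + bil (frechet_derivative f (at x) v) (g x))"
      by (intro Ck_on_add assms(2) Suc.IH f g Ck_on_Suc_imp[OF Suc.prems(1)] Ck_on_Suc_imp[OF Suc.prems(2)])
  qed
qed

lemmas Ck_on_scaleR = Ck_on_bilinear[OF bounded_bilinear_scaleR]
lemmas Ck_on_mult = Ck_on_bilinear[OF bounded_bilinear_mult]
lemmas Ck_on_minus = Ck_on_linear_comp[OF bounded_linear_minus[OF bounded_linear_ident]]

lemma Ck_on_diff:
  assumes "open U" "Ck_on k U f" "Ck_on k U g" shows "Ck_on k U (\<lambda>x. f x - g x)"
  using Ck_on_add[OF assms(1,2) Ck_on_minus[OF assms(1,3)]] by simp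

lemma linear_Basis_expand:
  fixes L :: "'a::euclidean_space \<Rightarrow> 'b::real_vector"
  assumes "linear L" shows "L v = (\<Sum>i\<in>Basis. (v \<bullet> i) *\<^sub>R L i)"
proof -
  have "L v = L (\<Sum>i\<in>Basis. (v \<bullet> i) *\<^sub>R i)" by (simp add: euclidean_representation)
  then show ?thesis using assms by (simp add: linear_sum linear_scale)
qed

text \<open>The chain rule gives the derivative of \<open>g\<close> at a moving point applied to a
  moving vector, whereas \<open>Ck_on\<close> concerns fixed directions only. Expanding the inner
  vector in the basis turns this into a sum of scalar coordinates times derivatives in fixed
  directions, to which the induction hypothesis applies; this is where finite dimension
  enters.\<close>

lemma Ck_on_compose:
  fixes f :: "'a::real_normed_vector \<Rightarrow> 'b::euclidean_space" and g :: "'b \<Rightarrow> 'c::real_normed_vector"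
  assumes "open U" "open V" "f ` U \<subseteq> V" "Ck_on k U f" "Ck_on k V g"
  shows "Ck_on k U (\<lambda>x. g (f x))"
  using assms(4,5)
proof (induction k arbitrary: g)
  case 0
  then show ?case using assms(3) by (auto intro: continuous_on_compose2)
next
  case (Suc k)
  note f = Ck_on_SucD[OF assms(1) Suc.prems(1)] and g = Ck_on_SucD[OF assms(2) Suc.prems(2)]
  show ?case
  proof (rule Ck_on_SucI[OF assms(1)])
    fix x assume x: "x \<in> U"
    then have "f x \<in> V" using assms(3) by auto
    note gd = g(1)[OF this]
    have "((\<lambda>x. g (f x)) has_derivative
        (\<lambda>v. frechet_derivative g (at (f x)) (frechet_derivative f (at x) v))) (at x)"
      using diff_chain_at[OF f(1)[OF x] gd] by (simp add: o_def)
    also have "(\<lambda>v. frechet_derivative g (at (f x)) (frechet_derivative f (at x) v)) =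
       (\<lambda>v. \<Sum>i\<in>Basis. (frechet_derivative f (at x) v \<bullet> i) *\<^sub>R frechet_derivative g (at (f x)) i)"
      using linear_Basis_expand[OF has_derivative_linear[OF gd]] by blast
    finally show "((\<lambda>x. g (f x)) has_derivative
        (\<lambda>v. \<Sum>i\<in>Basis. (frechet_derivative f (at x) v \<bullet> i) *\<^sub>R frechet_derivative g (at (f x)) i)) (at x)" .
  next
    fix v
    show "Ck_on k U (\<lambda>x. \<Sum>i\<in>Basis. (frechet_derivative f (at x) v \<bullet> i) *\<^sub>R frechet_derivative g (at (f x)) i)"
      by (intro Ck_on_sum Ck_on_scaleR assms(1) Ck_on_linear_comp[OF bounded_linear_inner_left] f
         Suc.IH g Ck_on_Suc_imp[OF Suc.prems(1)])
  qed
qed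

lemma Ck_on_Pair:
  assumes "open U" "Ck_on k U f" "Ck_on k U g" shows "Ck_on k U (\<lambda>x. (f x, g x))"
proof -
  have "Ck_on k U (\<lambda>x. (f x, 0) + (0, g x))"
    by (intro Ck_on_add assms(1) Ck_on_linear_comp[OF _ assms(1,2)] Ck_on_linear_comp[OF _ assms(1,3)])
      (intro bounded_linear_Pair bounded_linear_ident bounded_linear_zero)+
  then show ?thesis by simp
qed

lemma Ck_on_vec_lambda:
  fixes f :: "'n::finite \<Rightarrow> 'a::real_normed_vector \<Rightarrow> 'b::euclidean_space"
  assumes "open U" "\<And>i. Ck_on k U (f i)" shows "Ck_on k U (\<lambda>x. \<chi> i. f i x)"
proof -
  have "bounded_linear (axis i :: 'b \<Rightarrow> 'b ^ 'n)" for i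
    by (auto intro!: linear_conv_bounded_linear[THEN iffD1] linearI simp: axis_def vec_eq_iff)
  then have "Ck_on k U (\<lambda>x. \<Sum>i\<in>UNIV. axis i (f i x))"
    by (intro Ck_on_sum assms Ck_on_linear_comp[of "axis _"])
  moreover have "(\<Sum>i\<in>UNIV. axis i (f i x)) = (\<chi> i. f i x)" for x
    by (simp add: vec_eq_iff axis_def)
  ultimately show ?thesis by simp
qed

section \<open>Elementary functions\<close>

lemma Ck_on_sin_cos:
  "Ck_on k UNIV (sin :: real \<Rightarrow> real) \<and> Ck_on k UNIV (cos :: real \<Rightarrow> real)"
proof (induction k)
  case 0
  then show ?case by (simp add: continuous_on_sin continuous_on_cos)
next
  case (Suc k)
  show ?case
    by (intro conjI Ck_on_SucI[OF open_UNIV, of sin "\<lambda>x v. v * cos x"] Ck_on_SucI[OF open_UNIV, of cos "\<lambda>x v. v * - sin x"])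
      (use Suc in \<open>auto intro!: Ck_on_mult Ck_on_const Ck_on_minus derivative_eq_intros\<close>)
qed

lemma Ck_on_inverse: "Ck_on k {x. x \<noteq> 0} (inverse :: real \<Rightarrow> real)"
proof (induction k)
  case 0
  then show ?case by (auto intro: continuous_on_inverse)
next
  case (Suc k)
  have o: "open {x::real. x \<noteq> 0}" by (simp add: open_Collect_neq)
  show ?case
    by (rule Ck_on_SucI[OF o, of _ "\<lambda>x v. - (inverse x * v * inverse x)"])
      (use Suc o in \<open>auto intro!: Ck_on_mult Ck_on_const Ck_on_minus has_derivative_inverse'\<close>)
qed

text \<open>The derivative is written through the reciprocal of \<open>sqrt\<close> itself, so that
  the induction hypothesis composed with \<open>Ck_on_inverse\<close> closes the step.\<close>

lemma Ck_on_sqrt: "Ck_on k {x. x > 0} sqrt"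
proof (induction k)
  case 0
  then show ?case by (auto intro: continuous_intros)
next
  case (Suc k)
  have o: "open {x::real. x > 0}" "open {x::real. x \<noteq> 0}" by (simp_all add: open_Collect_neq open_Collect_less)
  have i: "Ck_on k {x. x > 0} (\<lambda>x. inverse (sqrt x))"
    by (rule Ck_on_compose[OF o _ Suc Ck_on_inverse]) auto
  show ?case
  proof (rule Ck_on_SucI[OF o(1)])
    show "(sqrt has_derivative (\<lambda>v. v * (inverse (sqrt x) / 2))) (at x)" if "x \<in> {x. x > 0}" for x :: real
      using that by (auto intro!: derivative_eq_intros simp: field_simps)
    show "Ck_on k {x. x > 0} (\<lambda>x. v * (inverse (sqrt x) / 2))" for v
      by (intro Ck_on_mult Ck_on_const Ck_on_linear_comp[OF bounded_linear_divide] o i)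
  qed
qed

subsection \<open>Smooth maps\<close>

text \<open>Openness is bundled in, which spares most closure rules a side condition;
  \<open>smooth_on_smooth\<close> links this notion to \<open>smooth_on\<close> on open
  sets.\<close>

definition smooth :: "'a::real_normed_vector set \<Rightarrow> ('a \<Rightarrow> 'b::real_normed_vector) \<Rightarrow> bool" where
  "smooth U f \<longleftrightarrow> open U \<and> (\<forall>k. Ck_on k U f)"

lemma smooth_open: "smooth U f \<Longrightarrow> open U"
  by (simp add: smooth_def)

lemma smooth_subset: "smooth U f \<Longrightarrow> open V \<Longrightarrow> V \<subseteq> U \<Longrightarrow> smooth V f"
  by (auto simp: smooth_def intro: Ck_on_subset)

lemma smooth_cong: "smooth U f \<Longrightarrow> (\<And>x. x \<in> U \<Longrightarrow> f x = g x) \<Longrightarrow> smooth U g"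
  unfolding smooth_def using Ck_on_cong by metis

lemma smooth_has_derivative:
  "smooth U f \<Longrightarrow> x \<in> U \<Longrightarrow> (f has_derivative frechet_derivative f (at x)) (at x)"
  unfolding smooth_def using Ck_on_SucD(1) by blast

lemma smooth_continuous_on: "smooth U f \<Longrightarrow> continuous_on U f"
  unfolding smooth_def using Ck_on_imp_continuous_on by blast

lemma smooth_frechet: "smooth U f \<Longrightarrow> smooth U (\<lambda>x. frechet_derivative f (at x) v)"
  unfolding smooth_def using Ck_on_SucD(2) by blast

lemma smooth_const: "open U \<Longrightarrow> smooth U (\<lambda>x. c)"
  by (simp add: smooth_def Ck_on_const)
lemma smooth_bounded_linear: "open U \<Longrightarrow> bounded_linear f \<Longrightarrow> smooth U f"
  by (simp add: smooth_def Ck_on_bounded_linear)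
lemma smooth_linear_comp: "bounded_linear h \<Longrightarrow> smooth U f \<Longrightarrow> smooth U (\<lambda>x. h (f x))"
  by (simp add: smooth_def Ck_on_linear_comp)
lemma smooth_add: "smooth U f \<Longrightarrow> smooth U g \<Longrightarrow> smooth U (\<lambda>x. f x + g x)"
  by (simp add: smooth_def Ck_on_add)
lemma smooth_diff: "smooth U f \<Longrightarrow> smooth U g \<Longrightarrow> smooth U (\<lambda>x. f x - g x)"
  by (simp add: smooth_def Ck_on_diff)
lemma smooth_minus: "smooth U f \<Longrightarrow> smooth U (\<lambda>x. - f x)"
  by (simp add: smooth_def Ck_on_minus)
lemma smooth_sum: "open U \<Longrightarrow> (\<And>i. i \<in> I \<Longrightarrow> smooth U (f i)) \<Longrightarrow> smooth U (\<lambda>x. \<Sum>i\<in>I. f i x)"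
  by (simp add: smooth_def Ck_on_sum)
lemma smooth_bilinear:
  "bounded_bilinear bil \<Longrightarrow> smooth U f \<Longrightarrow> smooth U g \<Longrightarrow> smooth U (\<lambda>x. bil (f x) (g x))"
  by (simp add: smooth_def Ck_on_bilinear)
lemmas smooth_scaleR = smooth_bilinear[OF bounded_bilinear_scaleR]
lemmas smooth_mult = smooth_bilinear[OF bounded_bilinear_mult]
lemma smooth_Pair: "smooth U f \<Longrightarrow> smooth U g \<Longrightarrow> smooth U (\<lambda>x. (f x, g x))"
  by (simp add: smooth_def Ck_on_Pair)
lemma smooth_compose:
  fixes f :: "'a::real_normed_vector \<Rightarrow> 'b::euclidean_space"
  shows "smooth V g \<Longrightarrow> smooth U f \<Longrightarrow> f ` U \<subseteq> V \<Longrightarrow> smooth U (\<lambda>x. g (f x))"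
  unfolding smooth_def using Ck_on_compose[of U V f _ g] by blast
lemma smooth_vec_lambda:
  fixes f :: "'n::finite \<Rightarrow> 'a::real_normed_vector \<Rightarrow> 'b::euclidean_space"
  shows "open U \<Longrightarrow> (\<And>i. smooth U (f i)) \<Longrightarrow> smooth U (\<lambda>x. \<chi> i. f i x)"
  by (simp add: smooth_def Ck_on_vec_lambda)

lemma smooth_sin: "smooth U f \<Longrightarrow> smooth U (\<lambda>x. sin (f x :: real))"
  and smooth_cos: "smooth U f \<Longrightarrow> smooth U (\<lambda>x. cos (f x :: real))"
  using Ck_on_sin_cos smooth_compose[of UNIV sin U f] smooth_compose[of UNIV cos U f]
  by (simp_all add: smooth_def)
lemma smooth_inverse: "smooth U f \<Longrightarrow> (\<And>x. x \<in> U \<Longrightarrow> f x \<noteq> 0) \<Longrightarrow> smooth U (\<lambda>x. inverse (f x :: real))"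
  by (rule smooth_compose[of "{x. x \<noteq> 0}"]) (auto simp: smooth_def open_Collect_neq Ck_on_inverse)
lemma smooth_sqrt: "smooth U f \<Longrightarrow> (\<And>x. x \<in> U \<Longrightarrow> f x > 0) \<Longrightarrow> smooth U (\<lambda>x. sqrt (f x))"
  by (rule smooth_compose[of "{x. x > 0}"]) (auto simp: smooth_def open_Collect_less Ck_on_sqrt)

lemma smooth_on_smooth:
  assumes "open W" "smooth_on W f" shows "smooth W f"
  unfolding smooth_def
proof (intro conjI allI Ck_on_local assms(1))
  fix k x assume "x \<in> W"
  then obtain U g where U: "open U" "x \<in> U" "\<And>k. Ck_on k U g" "\<And>y. y \<in> W \<inter> U \<Longrightarrow> g y = f y"
    using assms(2) unfolding smooth_on_def by metis
  then have "Ck_on k (W \<inter> U) f"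
    using assms(1) by (intro Ck_on_cong[of _ g f] Ck_on_subset[OF U(3)]) auto
  then show "\<exists>V. open V \<and> x \<in> V \<and> Ck_on k V f"
    using U(1,2) assms(1) \<open>x \<in> W\<close> by (intro exI[of _ "W \<inter> U"]) auto
qed

lemma smooth_onI: 
  assumes "\<And>x. x \<in> S \<Longrightarrow> \<exists>U g. x \<in> U \<and> smooth U g \<and> (\<forall>y\<in>S \<inter> U. g y = f y)"
  shows "smooth_on S f"
  unfolding smooth_on_def using assms unfolding smooth_def by metis

lemma smooth_onE:
  assumes "smooth_on S f" "x \<in> S"
  obtains U g where "x \<in> U" "smooth U g" "\<And>y. y \<in> S \<inter> U \<Longrightarrow> g y = f y"
  using assms unfolding smooth_on_def smooth_def by metis

text \<open>The local extensions compose once the domain of the inner one is cut down to the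
  preimage of the domain of the outer one.\<close>

lemma smooth_on_compose:
  fixes f :: "'a::real_normed_vector \<Rightarrow> 'b::euclidean_space"
  assumes g: "smooth_on T g" and f: "smooth_on S f" and "f ` S \<subseteq> T"
  shows "smooth_on S (\<lambda>x. g (f x))"
proof (rule smooth_onI)
  fix x assume x: "x \<in> S"
  obtain U f' where f': "x \<in> U" "smooth U f'" "\<And>y. y \<in> S \<inter> U \<Longrightarrow> f' y = f y"
    using smooth_onE[OF f x] by metis
  obtain V g' where g': "f x \<in> V" "smooth V g'" "\<And>y. y \<in> T \<inter> V \<Longrightarrow> g' y = g y"
    using smooth_onE[OF g, of "f x"] assms(3) x by (metis image_subset_iff)
  have o: "open (U \<inter> f' -` V)"
    using smooth_continuous_on[OF f'(2)] smooth_open f'(2) g'(2) continuous_open_preimage by metis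
  have "smooth (U \<inter> f' -` V) (\<lambda>x. g' (f' x))"
    by (rule smooth_compose[OF g'(2) smooth_subset[OF f'(2) o]]) auto
  then show "\<exists>U h. x \<in> U \<and> smooth U h \<and> (\<forall>y\<in>S \<inter> U. h y = g (f y))"
    using f' g' x assms(3) by (intro exI[of _ "U \<inter> f' -` V"] exI[of _ "\<lambda>x. g' (f' x)"]) auto
qed

subsection \<open>Estimates for continuously differentiable maps\<close>

lemma norm_linear_le_sum_Basis:
  fixes L :: "'a::euclidean_space \<Rightarrow> 'b::real_normed_vector"
  assumes "linear L" shows "norm (L v) \<le> (\<Sum>i\<in>Basis. norm (L i)) * norm v"
proof -
  have "norm (L v) \<le> (\<Sum>i\<in>Basis. norm ((v \<bullet> i) *\<^sub>R L i))"
    by (subst linear_Basis_expand[OF assms]) (rule norm_sum)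
  also have "\<dots> \<le> (\<Sum>i\<in>Basis. norm v * norm (L i))"
    by (intro sum_mono) (simp add: Basis_le_norm mult_right_mono)
  finally show ?thesis by (simp add: sum_distrib_left mult.commute)
qed

text \<open>One radius \<open>d\<close> serves all points of \<open>K\<close>: a Lebesgue number of
  a cover by open sets on which the derivative varies little. The mean value inequality is then
  applied on a ball that may leave \<open>K\<close> but stays in \<open>U\<close>.\<close>

lemma C1_uniformly_differentiable:
  fixes f :: "'a::euclidean_space \<Rightarrow> 'b::real_normed_vector"
  assumes "open U" and C1: "Ck_on (Suc 0) U f" and K: "compact K" "K \<subseteq> U" and "e > 0"
  shows "\<exists>d>0. \<forall>p\<in>K. \<forall>h. norm h < d \<longrightarrow> p + h \<in> U \<and>
     norm (f (p + h) - f p - frechet_derivative f (at p) h) \<le> e * norm h"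
proof -
  define D where "D p = frechet_derivative f (at p)" for p
  note D = Ck_on_SucD[OF assms(1) C1, folded D_def]
  have lin: "linear (D p)" if "p \<in> U" for p using D(1)[OF that] has_derivative_linear by blast
  \<comment> \<open>The operator norm is bounded by the sum of the norms over the
    \<open>DIM('a)\<close> basis vectors, hence the division. Points of \<open>N p\<close> are
    within half of \<open>e'\<close> of the centre, so any two of them are within \<open>e'\<close>
    of each other.\<close>
  define e' where "e' = e / DIM('a)"
  have e': "e' > 0" using \<open>e > 0\<close> by (simp add: e'_def)
  define N where "N p = {x \<in> U. \<forall>i\<in>Basis. norm (D x i - D p i) < e' / 2}" for p
  have Nopen: "open (N p)" for p
  proof -
    have "open {x \<in> U. norm (D x i - D p i) < e' / 2}" for i
    proof -
      have "open (U \<inter> (\<lambda>x. norm (D x i - D p i)) -` {..<e' / 2})"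
        using D(2)[of i] by (intro continuous_open_preimage assms(1) continuous_intros) auto
      moreover have "U \<inter> (\<lambda>x. norm (D x i - D p i)) -` {..<e' / 2} = {x \<in> U. norm (D x i - D p i) < e' / 2}" by auto
      ultimately show ?thesis by simp
    qed
    then have "open (U \<inter> (\<Inter>i\<in>Basis. {x \<in> U. norm (D x i - D p i) < e' / 2}))"
      by (intro open_Int open_INT finite_Basis ballI assms(1))
    moreover have "N p = U \<inter> (\<Inter>i\<in>Basis. {x \<in> U. norm (D x i - D p i) < e' / 2})" by (auto simp: N_def)
    ultimately show ?thesis by simp
  qed
  have "K \<subseteq> \<Union> (N ` K)" using K(2) e' by (auto simp: N_def)
  from Heine_Borel_lemma[OF K(1) this] Nopen obtain d where d: "d > 0" "\<And>x. x \<in> K \<Longrightarrow> \<exists>G\<in>N ` K. ball x d \<subseteq> G"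
    by blast
  show ?thesis
  proof (intro exI[of _ d] conjI d(1) ballI allI impI)
    fix p h assume p: "p \<in> K" and h: "norm (h :: 'a) < d"
    from d(2)[OF p] obtain q where q: "ball p d \<subseteq> N q" by auto
    have inU: "ball p d \<subseteq> U" using q by (auto simp: N_def)
    show ph: "p + h \<in> U" using inU h by (auto simp: dist_norm)
    have pd: "p \<in> ball p d" using d(1) by simp
    have B: "onorm (\<lambda>v. D x v - D p v) \<le> e" if "x \<in> ball p d" for x
    proof (rule onorm_le)
      fix v
      have xU: "x \<in> U" "p \<in> U" using that inU pd by auto
      have "linear (\<lambda>v. D x v - D p v)" by (intro linear_compose_sub lin xU)
      then have "norm (D x v - D p v) \<le> (\<Sum>i\<in>Basis. norm (D x i - D p i)) * norm v"
        by (rule norm_linear_le_sum_Basis)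
      also have "(\<Sum>i\<in>Basis. norm (D x i - D p i)) \<le> (\<Sum>i\<in>(Basis::'a set). e')"
      proof (rule sum_mono)
        fix i :: 'a assume i: "i \<in> Basis"
        have "x \<in> N q" "p \<in> N q" using q that pd by blast+
        then have "norm (D x i - D q i) < e'/2" "norm (D p i - D q i) < e'/2"
          using i by (auto simp: N_def)
        then show "norm (D x i - D p i) \<le> e'"
          using norm_triangle_ineq4[of "D x i - D q i" "D p i - D q i"] by simp
      qed
      also have "\<dots> = e" by (simp add: e'_def)
      finally show "norm (D x v - D p v) \<le> e * norm v" by (simp add: mult_right_mono)
    qed
    have "norm (f (p + h) - f p - D p ((p + h) - p)) \<le> norm ((p + h) - p) * e"
    proof (rule differentiable_bound_linearization[where S = "ball p d"])
      fix t :: real assume t: "t \<in> {0..1}"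
      have "norm (t *\<^sub>R h) \<le> 1 * norm h" using t unfolding norm_scaleR by (intro mult_right_mono) auto
      then show "p + t *\<^sub>R (p + h - p) \<in> ball p d" using h by (auto simp: dist_norm)
    next
      fix x assume "x \<in> ball p d"
      then show "(f has_derivative D x) (at x within ball p d)"
        using D(1) inU has_derivative_at_withinI by blast
    next
      fix x assume "x \<in> ball p d"
      from B[OF this] show "onorm (D x - D p) \<le> e" by (simp add: fun_diff_def)
    qed (rule pd)
    then show "norm (f (p + h) - f p - frechet_derivative f (at p) h) \<le> e * norm h"
      by (simp add: D_def mult.commute)
  qed
qed

lemma Ck_on_Suc_le: "Ck_on (Suc k) U f \<Longrightarrow> Ck_on (Suc 0) U f"
  by (induction k) (auto dest: Ck_on_Suc_imp simp del: Ck_on.simps)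

lemma smooth_C1: "smooth U f \<Longrightarrow> Ck_on (Suc 0) U f"
  unfolding smooth_def by blast

lemma C1_derivative_bounded:
  fixes f :: "'a::euclidean_space \<Rightarrow> 'b::real_normed_vector"
  assumes "open U" and C1: "Ck_on (Suc 0) U f" and K: "compact K" "K \<subseteq> U"
  shows "\<exists>B\<ge>0. \<forall>p\<in>K. \<forall>h. norm (frechet_derivative f (at p) h) \<le> B * norm h"
proof -
  define N where "N p = (\<Sum>i\<in>Basis. norm (frechet_derivative f (at p) i))" for p
  note D = Ck_on_SucD[OF assms(1) C1]
  have "continuous_on K N" unfolding N_def
    using D(2) K(2) by (intro continuous_intros) (auto intro: continuous_on_subset)
  then have "bounded (N ` K)" using K(1) compact_continuous_image compact_imp_bounded by blast
  then obtain B where B: "\<And>p. p \<in> K \<Longrightarrow> norm (N p) \<le> B" by (auto simp: bounded_iff)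
  have "norm (frechet_derivative f (at p) h) \<le> \<bar>B\<bar> * norm h" if "p \<in> K" for p h
  proof -
    have "norm (frechet_derivative f (at p) h) \<le> N p * norm h" unfolding N_def
      using that D(1) K(2) has_derivative_linear by (intro norm_linear_le_sum_Basis) blast
    also have "\<dots> \<le> \<bar>B\<bar> * norm h" using B[OF that] by (intro mult_right_mono) auto
    finally show ?thesis .
  qed
  then show ?thesis by (intro exI[of _ "\<bar>B\<bar>"]) auto
qed

section \<open>Ordinary differential equations and smooth dependence on parameters\<close>

lemma vector_derivative_bound:
  fixes f :: "real \<Rightarrow> 'a::real_normed_vector"
  assumes "convex S" "\<And>t. t \<in> S \<Longrightarrow> (f has_vector_derivative f' t) (at t within S)"
    and "\<And>t. t \<in> S \<Longrightarrow> norm (f' t) \<le> B" "s \<in> S" "t \<in> S"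
  shows "norm (f s - f t) \<le> B * \<bar>s - t\<bar>"
proof -
  have "norm (f s - f t) \<le> B * norm (s - t)"
  proof (rule differentiable_bound[OF assms(1)])
    show "(f has_derivative (\<lambda>h. h *\<^sub>R f' x)) (at x within S)" if "x \<in> S" for x
      using assms(2)[OF that] by (simp add: has_vector_derivative_def)
    show "onorm (\<lambda>h. h *\<^sub>R f' x) \<le> B" if "x \<in> S" for x
      using assms(3)[OF that] by (intro onorm_le) (simp add: mult.commute[of B] mult_left_mono)
  qed (use assms in auto)
  then show ?thesis by simp
qed

text \<open>Exhausts an open interval by compact symmetric ones: halfway between the modulus of
  \<open>t\<close> and \<open>a\<close> there is still room around \<open>t\<close>.\<close>

lemma abs_midpoint:
  assumes "t \<in> {-a<..<a::real}"
  shows "0 < (\<bar>t\<bar> + a) / 2" "(\<bar>t\<bar> + a) / 2 < a" "t \<in> {-((\<bar>t\<bar> + a) / 2)<..<(\<bar>t\<bar> + a) / 2}"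
proof -
  have t: "\<bar>t\<bar> < a" "0 \<le> \<bar>t\<bar>" "t \<le> \<bar>t\<bar>" "- t \<le> \<bar>t\<bar>" using assms by auto
  show "0 < (\<bar>t\<bar> + a) / 2" using t by simp
  show "(\<bar>t\<bar> + a) / 2 < a" using t by simp
  show "t \<in> {-((\<bar>t\<bar> + a) / 2)<..<(\<bar>t\<bar> + a) / 2}"
    using t by (simp add: field_simps)
qed

text \<open>Let M be the maximum of the norm of \<open>e\<close> on the compact interval. The mean
  value inequality gives M <= |e 0| + a (L M + d), and a L <= 1/4 allows a quarter of M to be
  absorbed, which is the origin of 4/3. Symmetric intervals treat both directions of time at once.
  The second estimate bounds the drift from the initial value.\<close>

lemma gronwall_short:
  fixes e :: "real \<Rightarrow> 'a::real_normed_vector"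
  assumes "0 \<le> a" "0 \<le> L" "a * L \<le> 1/4" "0 \<le> d"
    and der: "\<And>t. t \<in> {-a..a} \<Longrightarrow> (e has_vector_derivative e' t) (at t within {-a..a})"
    and bnd: "\<And>t. t \<in> {-a..a} \<Longrightarrow> norm (e' t) \<le> L * norm (e t) + d"
    and t: "t \<in> {-a..a}"
  shows "norm (e t) \<le> 4/3 * (norm (e 0) + a * d)"
    and "norm (e t - e 0) \<le> a * (L * (4/3 * (norm (e 0) + a * d)) + d)"
proof -
  have "continuous_on {-a..a} (\<lambda>t. norm (e t))"
    using der by (intro continuous_on_norm) (meson continuous_on_eq_continuous_within has_vector_derivative_continuous)
  then obtain s where s: "s \<in> {-a..a}" "\<And>t. t \<in> {-a..a} \<Longrightarrow> norm (e t) \<le> norm (e s)"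
    using continuous_attains_sup[of "{-a..a}" "\<lambda>t. norm (e t)"] assms(1) by fastforce
  have step: "norm (e r - e 0) \<le> a * (L * norm (e s) + d)" if "r \<in> {-a..a}" for r
  proof -
    have "norm (e r - e 0) \<le> (L * norm (e s) + d) * \<bar>r - 0\<bar>"
    proof (rule vector_derivative_bound[OF _ der])
      fix t assume "t \<in> {-a..a}"
      then show "norm (e' t) \<le> L * norm (e s) + d"
        using bnd s(2) assms(2) by (meson add_right_mono mult_left_mono order_trans)
    qed (use that assms(1) in auto)
    also have "\<dots> \<le> (L * norm (e s) + d) * a"
      using that assms by (intro mult_left_mono) auto
    finally show ?thesis by (simp add: mult.commute)
  qed
  have "norm (e s) \<le> norm (e 0) + norm (e s - e 0)" by (rule norm_triangle_sub)
  also have "\<dots> \<le> norm (e 0) + a * d + (a * L) * norm (e s)" using step[OF s(1)] by (simp add: algebra_simps)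
  also have "\<dots> \<le> norm (e 0) + a * d + 1/4 * norm (e s)"
    using mult_right_mono[OF assms(3) norm_ge_zero[of "e s"]] by simp
  finally have M: "norm (e s) \<le> 4/3 * (norm (e 0) + a * d)" by simp
  with s(2)[OF t] show "norm (e t) \<le> 4/3 * (norm (e 0) + a * d)" by linarith
  have "a * (L * norm (e s) + d) \<le> a * (L * (4/3 * (norm (e 0) + a * d)) + d)"
    using M assms by (intro mult_left_mono add_right_mono) auto
  with step[OF t] show "norm (e t - e 0) \<le> a * (L * (4/3 * (norm (e 0) + a * d)) + d)" by linarith
qed

section \<open>Existence and uniqueness of solutions\<close>

lemma ode_unique:
  fixes u v :: "real \<Rightarrow> 'a::real_normed_vector"
  assumes "0 \<le> a" "0 \<le> L" "a * L \<le> 1/4"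
    and u: "\<And>t. t \<in> {-a..a} \<Longrightarrow> (u has_vector_derivative u' t) (at t within {-a..a})"
    and v: "\<And>t. t \<in> {-a..a} \<Longrightarrow> (v has_vector_derivative v' t) (at t within {-a..a})"
    and lip: "\<And>t. t \<in> {-a..a} \<Longrightarrow> norm (u' t - v' t) \<le> L * norm (u t - v t)"
    and "u 0 = v 0" "t \<in> {-a..a}"
  shows "u t = v t"
  using gronwall_short(1)[of a L 0 "\<lambda>t. u t - v t" "\<lambda>t. u' t - v' t" t] assms
  by (auto intro!: has_vector_derivative_diff)

text \<open>The right-hand side is Lipschitz on the whole space, so the Picard iterates never leave
  its domain. The operator contracts the sup norm by a L <= 1/4; the increments are dominated by a
  geometric series, and the uniform limit is a fixed point.\<close>

lemma ode_exists_closed: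
  fixes f :: "real \<Rightarrow> 'a::banach \<Rightarrow> 'a"
  assumes "0 < a" "0 \<le> L" "a * L \<le> 1/4"
    and cont: "continuous_on ({-a..a} \<times> UNIV) (\<lambda>(t, y). f t y)"
    and lip: "\<And>t y z. t \<in> {-a..a} \<Longrightarrow> norm (f t y - f t z) \<le> L * norm (y - z)"
  shows "\<exists>u. u 0 = c \<and> (\<forall>t\<in>{-a..a}. (u has_vector_derivative f t (u t)) (at t within {-a..a}))"
proof -
  define I where "I = {-a..a}"
  \<comment> \<open>An integral over \<open>{0..t}\<close> would vanish for negative
    \<open>t\<close>; starting at \<open>-a\<close> and subtracting the value at 0 covers both
    signs.\<close>
  define T where "T u t = c + (integral {-a..t} (\<lambda>s. f s (u s)) - integral {-a..0} (\<lambda>s. f s (u s)))" for u t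
  have contf: "continuous_on I (\<lambda>t. f t (u t))" if "continuous_on I u" for u
  proof -
    have "continuous_on I (\<lambda>t. (\<lambda>(t, y). f t y) (t, u t))"
      by (rule continuous_on_compose2[OF cont]) (auto simp: I_def intro!: continuous_on_Pair continuous_on_id that[unfolded I_def])
    then show ?thesis by simp
  qed
  have dT: "(T u has_vector_derivative f t (u t)) (at t within I)" if "continuous_on I u" "t \<in> I" for u t
  proof -
    have "((\<lambda>t. integral {-a..t} (\<lambda>s. f s (u s))) has_vector_derivative f t (u t)) (at t within I)"
      using integral_has_vector_derivative[OF contf[OF that(1), unfolded I_def]] that(2) by (simp add: I_def)
    from has_vector_derivative_add[OF has_vector_derivative_const has_vector_derivative_diff[OF this has_vector_derivative_const]]
    show ?thesis unfolding T_def by simp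
  qed
  have T0: "T u 0 = c" for u by (simp add: T_def)
  have cT: "continuous_on I (T u)" if "continuous_on I u" for u
    using dT[OF that] by (meson continuous_on_eq_continuous_within has_vector_derivative_continuous)
  have contr: "norm (T u t - T v t) \<le> M / 4"
    if "continuous_on I u" "continuous_on I v" "\<And>t. t \<in> I \<Longrightarrow> norm (u t - v t) \<le> M" "t \<in> I" for u v M t
  proof -
    have "norm ((T u t - T v t) - (T u 0 - T v 0)) \<le> (L * M) * \<bar>t - 0\<bar>"
    proof (rule vector_derivative_bound[where S = I])
      show "((\<lambda>t. T u t - T v t) has_vector_derivative f t (u t) - f t (v t)) (at t within I)" if "t \<in> I" for t
        by (intro has_vector_derivative_diff dT) fact+
      show "norm (f t (u t) - f t (v t)) \<le> L * M" if "t \<in> I" for t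
        using lip[of t "u t" "v t"] \<open>\<And>t. t \<in> I \<Longrightarrow> norm (u t - v t) \<le> M\<close>[OF that] that assms(2)
        by (metis I_def mult_left_mono order_trans)
    qed (use that assms(1) in \<open>auto simp: I_def\<close>)
    also have "\<dots> \<le> (L * M) * a"
    proof -
      have "0 \<le> M" using that(3)[OF that(4)] norm_ge_zero order_trans by blast
      then show ?thesis using that(4) assms(2) by (intro mult_left_mono) (auto simp: I_def)
    qed
    also have "\<dots> = (a * L) * M" by simp
    also have "\<dots> \<le> 1/4 * M"
      using that(3)[OF that(4)] norm_ge_zero order_trans assms(3) by (intro mult_right_mono) blast+
    finally show ?thesis by (simp add: T0)
  qed
  define u where "u n = (T ^^ n) (\<lambda>_. c)" for n
  have uS: "u (Suc n) = T (u n)" for n by (simp add: u_def)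
  have cu: "continuous_on I (u n)" for n
    by (induction n) (simp add: u_def, simp add: uS cT)
  have "bounded ((\<lambda>t. u 1 t - u 0 t) ` I)"
    using compact_continuous_image[of I "\<lambda>t. u 1 t - u 0 t"] cu
    by (intro compact_imp_bounded) (auto simp: I_def intro: continuous_intros)
  then obtain M where M: "\<And>t. t \<in> I \<Longrightarrow> norm (u 1 t - u 0 t) \<le> M" by (auto simp: bounded_iff)
  have geo: "norm (u (Suc n) t - u n t) \<le> M * (1/4)^n" if "t \<in> I" for n t
    using that
  proof (induction n arbitrary: t)
    case 0 then show ?case using M by simp
  next
    case (Suc n)
    then show ?case using contr[OF cu cu, of "Suc n" n "M * (1/4)^n" t] by (simp add: uS)
  qed
  have "\<exists>U. uniform_limit I (\<lambda>n t. \<Sum>i<n. u (Suc i) t - u i t) U sequentially"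
    using Weierstrass_m_test[of I "\<lambda>n t. u (Suc n) t - u n t" "\<lambda>n. M * (1/4)^n"] geo
    by (auto intro: summable_mult summable_geometric)
  moreover have "(\<lambda>n t. \<Sum>i<n. u (Suc i) t - u i t) = (\<lambda>n t. u n t - c)"
    by (intro ext) (subst sum_lessThan_telescope, simp add: u_def)
  ultimately obtain U0 where "uniform_limit I (\<lambda>n t. u n t - c) U0 sequentially" by auto
  then have "uniform_limit I (\<lambda>n t. u n t - c + c) (\<lambda>t. U0 t + c) sequentially"
    by (intro uniform_limit_add uniform_limit_const)
  then obtain U where U: "uniform_limit I u U sequentially" by auto
  have cU: "continuous_on I U"
    by (rule uniform_limit_theorem[OF _ U]) (auto simp: cu)
  have fix_U: "T U t = U t" if t: "t \<in> I" for t
  proof -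
    have 1: "(\<lambda>n. u n t) \<longlonglongrightarrow> U t" using tendsto_uniform_limitI[OF U t] .
    have "(\<lambda>n. T (u n) t) \<longlonglongrightarrow> T U t"
    proof (rule metric_LIMSEQ_I)
      fix r :: real assume "r > 0"
      from uniform_limitD[OF U this] obtain N where N: "\<And>n t. n \<ge> N \<Longrightarrow> t \<in> I \<Longrightarrow> dist (u n t) (U t) < r"
        by (auto simp: eventually_sequentially)
      have "dist (T (u n) t) (T U t) < r" if "n \<ge> N" for n
        using contr[OF cu cU, of n r t] N[OF that] t \<open>r > 0\<close> by (fastforce simp: dist_norm)
      then show "\<exists>N. \<forall>n\<ge>N. dist (T (u n) t) (T U t) < r" by blast
    qed
    then have "(\<lambda>n. u (Suc n) t) \<longlonglongrightarrow> T U t" by (simp add: uS)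
    then show ?thesis using LIMSEQ_unique LIMSEQ_Suc[OF 1] by blast
  qed
  have "(U has_vector_derivative f t (U t)) (at t within I)" if "t \<in> I" for t
    by (rule has_vector_derivative_transform[OF that _ dT[OF cU that]]) (use fix_U in auto)
  moreover have "U 0 = c" using fix_U[of 0] T0 assms(1) by (simp add: I_def)
  ultimately show ?thesis unfolding I_def by blast
qed

text \<open>Solutions on the closed symmetric subintervals agree by uniqueness, so they glue to one
  solution on the open interval, whose end points lie outside the hypotheses.\<close>

lemma ode_exists:
  fixes f :: "real \<Rightarrow> 'a::banach \<Rightarrow> 'a"
  assumes "0 < a" "0 \<le> L" "a * L \<le> 1/4"
    and cont: "continuous_on ({-a<..<a} \<times> UNIV) (\<lambda>(t, y). f t y)"
    and lip: "\<And>t y z. t \<in> {-a<..<a} \<Longrightarrow> norm (f t y - f t z) \<le> L * norm (y - z)"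
  shows "\<exists>u. u 0 = c \<and> (\<forall>t\<in>{-a<..<a}. (u has_vector_derivative f t (u t)) (at t))"
proof -
  have sm: "b * L \<le> 1/4" if "b < a" for b
    using mult_right_mono[of b a L] that assms by linarith
  have "\<exists>u. u 0 = c \<and> (\<forall>t\<in>{-b..b}. (u has_vector_derivative f t (u t)) (at t within {-b..b}))" if "0 < b" "b < a" for b
    by (rule ode_exists_closed[OF that(1) assms(2) sm[OF that(2)]])
      (use that lip in \<open>auto intro: continuous_on_subset[OF cont]\<close>)
  then obtain w where w: "\<And>b. 0 < b \<Longrightarrow> b < a \<Longrightarrow> w b 0 = c"
    "\<And>b t. 0 < b \<Longrightarrow> b < a \<Longrightarrow> t \<in> {-b..b} \<Longrightarrow> (w b has_vector_derivative f t (w b t)) (at t within {-b..b})"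
    by metis
  have agree: "w b t = w b' t" if b: "0 < b" "b \<le> b'" "b' < a" "t \<in> {-b..b}" for b b' t
  proof (rule ode_unique[where a = b and L = L])
    show "(w b has_vector_derivative f t (w b t)) (at t within {-b..b})" if "t \<in> {-b..b}" for t
      using w(2)[of b t] b that by auto
    show "(w b' has_vector_derivative f t (w b' t)) (at t within {-b..b})" if "t \<in> {-b..b}" for t
      using w(2)[of b' t] b that by (auto intro: has_vector_derivative_within_subset)
    show "w b 0 = w b' 0" using w(1)[of b] w(1)[of b'] b by auto
  qed (use b assms(2) sm lip in auto)
  define \<tau> where "\<tau> t = (\<bar>t\<bar> + a) / 2" for t
  have \<tau>: "0 < \<tau> t" "\<tau> t < a" "t \<in> {-\<tau> t<..<\<tau> t}" if "t \<in> {-a<..<a}" for t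
    using abs_midpoint[OF that] unfolding \<tau>_def .
  \<comment> \<open>The value at \<open>t\<close> is read off from a solution on an interval with
    \<open>t\<close> in its interior, so that \<open>u\<close> agrees with this one solution near
    \<open>t\<close> and inherits its derivative.\<close>
  define u where "u t = w (\<tau> t) t" for t
  have "u 0 = c" using w(1) assms(1) by (simp add: u_def \<tau>_def)
  moreover have "(u has_vector_derivative f t (u t)) (at t)" if t: "t \<in> {-a<..<a}" for t
  proof -
    note b = \<tau>[OF t]
    have "(w (\<tau> t) has_vector_derivative f t (w (\<tau> t) t)) (at t within {-\<tau> t<..<\<tau> t})"
      using w(2)[OF b(1,2), of t] b(3) by (auto intro: has_vector_derivative_within_subset)
    then have "(w (\<tau> t) has_vector_derivative f t (w (\<tau> t) t)) (at t)"
      by (metis b(3) at_within_open open_greaterThanLessThan)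
    then have "(w (\<tau> t) has_vector_derivative f t (u t)) (at t)" by (simp add: u_def)
    then show ?thesis
    proof (rule has_vector_derivative_transform_within_open)
      show "w (\<tau> t) s = u s" if s: "s \<in> {-\<tau> t<..<\<tau> t}" for s
      proof -
        have "s \<in> {-a<..<a}" using s b(2) unfolding greaterThanLessThan_iff by linarith
        note b' = \<tau>[OF this]
        have "s \<in> {-\<tau> s..\<tau> s}" "s \<in> {-\<tau> t..\<tau> t}" using b' s by auto
        then have "w (\<tau> t) s = w (\<tau> s) s"
          using agree[of "\<tau> s" "\<tau> t" s] agree[of "\<tau> t" "\<tau> s" s] b b' by (metis linear)
        then show ?thesis unfolding u_def .
      qed
    qed (use b in auto)
  qed
  ultimately show ?thesis by blast
qed

section \<open>Dependence on parameters\<close>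

lemma continuous_at_param:
  fixes u :: "'a::metric_space \<times> 'b::metric_space \<Rightarrow> 'c::metric_space"
  assumes c: "isCont (\<lambda>t. u (t, x)) t"
    and un: "\<And>e. e > 0 \<Longrightarrow> \<exists>d>0. \<forall>x' s. dist x' x < d \<longrightarrow> dist s t < d \<longrightarrow> dist (u (s, x')) (u (s, x)) \<le> e"
  shows "isCont u (t, x)"
  unfolding continuous_at_eps_delta
proof (intro allI impI)
  fix e :: real assume e: "e > 0"
  obtain d1 where d1: "d1 > 0" "\<And>x' s. dist x' x < d1 \<Longrightarrow> dist s t < d1 \<Longrightarrow> dist (u (s, x')) (u (s, x)) \<le> e/2"
    using un[of "e/2"] e by auto
  obtain d2 where d2: "d2 > 0" "\<And>s. dist s t < d2 \<Longrightarrow> dist (u (s, x)) (u (t, x)) < e/2"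
    using c e unfolding continuous_at_eps_delta by (metis half_gt_zero)
  show "\<exists>d>0. \<forall>p. dist p (t, x) < d \<longrightarrow> dist (u p) (u (t, x)) < e"
  proof (intro exI[of _ "min d1 d2"] conjI allI impI)
    fix p assume "dist p (t, x) < min d1 d2"
    moreover obtain s x' where p: "p = (s, x')" by (cases p)
    ultimately have "dist s t < d1" "dist s t < d2" "dist x' x < d1"
      using dist_fst_le[of p "(t, x)"] dist_snd_le[of p "(t, x)"] by auto
    then show "dist (u p) (u (t, x)) < e"
      using d1(2)[of x' s] d2(2)[of s] dist_triangle[of "u p" "u (t, x)" "u (s, x)"] p by auto
  qed (use d1 d2 in auto)
qed

text \<open>The solution \<open>w v\<close> of the variational equation is the candidate for the
  derivative in direction \<open>v\<close>. The error u(x + h) - u(x) - w h satisfies a Gronwall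
  inequality whose inhomogeneity is small compared to |h|, because \<open>F\<close> is uniformly
  differentiable along the compact trajectory; hence the error is o(|h|). As the time derivative is
  continuous, the partial derivatives combine to a joint one. The initial value varies through the
  linear map \<open>c\<close>, which is the identity for flows and 0 for linear equations with a
  fixed initial value.\<close>

lemma ode_param_differentiable:
  fixes F :: "real \<times> 'p::euclidean_space \<times> 'e::euclidean_space \<Rightarrow> 'e"
  assumes D: "open D" and C1: "Ck_on (Suc 0) D F" and P: "open P"
    and a: "0 < a" "0 \<le> L" "a * L \<le> 1/4"
    and u: "\<And>t x. t \<in> {-a<..<a} \<Longrightarrow> x \<in> P \<Longrightarrow> (t, x, u (t, x)) \<in> D \<and>
       ((\<lambda>t. u (t, x)) has_vector_derivative F (t, x, u (t, x))) (at t)"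
    and lip: "\<And>t x y z. (t, x, y) \<in> D \<Longrightarrow> (t, x, z) \<in> D \<Longrightarrow> norm (F (t, x, y) - F (t, x, z)) \<le> L * norm (y - z)"
    and dlip: "\<And>p k. p \<in> D \<Longrightarrow> norm (frechet_derivative F (at p) (0, 0, k)) \<le> L * norm k"
    and c: "linear c" "\<And>x y. x \<in> P \<Longrightarrow> y \<in> P \<Longrightarrow> u (0, x) - u (0, y) = c (x - y)"
    and w: "\<And>v t x. t \<in> {-a<..<a} \<Longrightarrow> x \<in> P \<Longrightarrow>
      ((\<lambda>t. w v (t, x)) has_vector_derivative frechet_derivative F (at (t, x, u (t, x))) (0, v, w v (t, x))) (at t)"
      "\<And>v x. x \<in> P \<Longrightarrow> w v (0, x) = c v"
    and t: "t \<in> {-a<..<a}" and x: "x \<in> P"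
  shows "(u has_derivative (\<lambda>(r, v). r *\<^sub>R F (t, x, u (t, x)) + w v (t, x))) (at (t, x))"
proof -
  define DF where "DF p = frechet_derivative F (at p)" for p
  have lin: "linear (DF p)" if "p \<in> D" for p
    using Ck_on_SucD(1)[OF D C1 that] has_derivative_linear unfolding DF_def by blast
  define \<tau> where "\<tau> t = (\<bar>t\<bar> + a) / 2" for t
  have \<tau>: "0 < \<tau> t" "\<tau> t < a" "t \<in> {-\<tau> t<..<\<tau> t}" "\<tau> t * L \<le> 1/4" if t: "t \<in> {-a<..<a}" for t
  proof -
    show s: "0 < \<tau> t" "\<tau> t < a" "t \<in> {-\<tau> t<..<\<tau> t}" using abs_midpoint[OF t] unfolding \<tau>_def .
    then show "\<tau> t * L \<le> 1/4" using mult_right_mono[of "\<tau> t" a L] a by linarith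
  qed
  have uw: "((\<lambda>t. u (t, x)) has_vector_derivative F (t, x, u (t, x))) (at t within S)"
     "((\<lambda>t. w v (t, x)) has_vector_derivative DF (t, x, u (t, x)) (0, v, w v (t, x))) (at t within S)"
     if "t \<in> {-a<..<a}" "x \<in> P" for t x S v
    using u[OF that] w(1)[OF that] by (auto intro: has_vector_derivative_at_within simp: DF_def)
  have Lips: "\<exists>C\<ge>0. \<exists>d>0. \<forall>h. norm h < d \<longrightarrow> x + h \<in> P \<and> (\<forall>s\<in>{-\<tau> t..\<tau> t}. norm (u (s, x + h) - u (s, x)) \<le> C * norm h)"
    and resid: "\<And>\<epsilon>. \<epsilon> > 0 \<Longrightarrow> \<exists>d>0. \<forall>h. norm h < d \<longrightarrow> norm (u (t, x + h) - u (t, x) - w h (t, x)) \<le> \<epsilon> * norm h"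
    if t: "t \<in> {-a<..<a}" and x: "x \<in> P" for t x
  proof -
    note \<tau> = \<tau>[OF t]
    let ?I = "{-\<tau> t..\<tau> t}"
    have I: "s \<in> {-a<..<a}" if "s \<in> ?I" for s using that \<tau>(2) by auto
    have cont_u: "continuous_on ?I (\<lambda>s. u (s, x))"
      using uw(1)[OF I x] by (meson continuous_on_eq_continuous_within has_vector_derivative_continuous)
    \<comment> \<open>The trajectory over a compact time interval, along which \<open>F\<close>
      admits uniform estimates.\<close>
    define K where "K = (\<lambda>s. (s, x, u (s, x))) ` ?I"
    have K: "compact K" "K \<subseteq> D"
      unfolding K_def using u[OF I x] by (auto intro!: compact_continuous_image continuous_intros cont_u)
    obtain B where B: "B \<ge> 0" "\<And>p h. p \<in> K \<Longrightarrow> norm (DF p h) \<le> B * norm h"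
      using C1_derivative_bounded[OF D C1 K] unfolding DF_def by blast
    obtain dP where dP: "dP > 0" "ball x dP \<subseteq> P" using P x open_contains_ball by blast
    have xP: "x + h \<in> P" if "norm h < dP" for h using dP(2) that by (auto simp: dist_norm)
    obtain C' where C': "C' > 0" "\<And>v. norm (c v) \<le> C' * norm v" using linear_bounded_pos[OF c(1)] by blast
    \<comment> \<open>From Gronwall's estimate: \<open>C'\<close> bounds the change of the initial
      value, and \<open>B + 1\<close> the change of \<open>F\<close> under a shift of the parameter
      alone, \<open>B\<close> for the derivative and 1 for the error of linearization.\<close>
    define C where "C = 4/3 * (C' + \<tau> t * (B + 1))"
    have C0: "C \<ge> 0" using C' B \<tau> by (simp add: C_def)
    obtain d0 where d0: "d0 > 0" "\<And>p h. p \<in> K \<Longrightarrow> norm h < d0 \<Longrightarrow> p + h \<in> D \<and> norm (F (p + h) - F p - DF p h) \<le> 1 * norm h"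
      using C1_uniformly_differentiable[OF D C1 K zero_less_one] unfolding DF_def by metis
    have est: "norm (u (s, x + h) - u (s, x)) \<le> C * norm h" if h: "norm h < min dP d0" and s: "s \<in> ?I" for s h
    proof -
      have h': "norm h < dP" "norm h < d0" using h by auto
      have "norm (u (s, x + h) - u (s, x)) \<le> 4/3 * (norm (u (0, x + h) - u (0, x)) + \<tau> t * ((B + 1) * norm h))"
      proof (rule gronwall_short(1)[where L = L and e' = "\<lambda>s. F (s, x + h, u (s, x + h)) - F (s, x, u (s, x))" and a = "\<tau> t"])
        fix s assume s: "s \<in> ?I"
        show "((\<lambda>s. u (s, x + h) - u (s, x)) has_vector_derivative F (s, x + h, u (s, x + h)) - F (s, x, u (s, x))) (at s within ?I)"
          by (intro has_vector_derivative_diff uw I s x xP h')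
        have p: "(s, x, u (s, x)) \<in> K" using s by (auto simp: K_def)
        have "norm (0::real, h, 0::'e) < d0" using h' by (simp add: norm_Pair)
        from d0(2)[OF p this] have q: "(s, x + h, u (s, x)) \<in> D"
          "norm (F (s, x + h, u (s, x)) - F (s, x, u (s, x)) - DF (s, x, u (s, x)) (0, h, 0)) \<le> norm h"
          by (auto simp: norm_Pair)
        have "norm (DF (s, x, u (s, x)) (0, h, 0)) \<le> B * norm h" using B(2)[OF p, of "(0, h, 0)"] by (simp add: norm_Pair)
        then have "norm (F (s, x + h, u (s, x)) - F (s, x, u (s, x))) \<le> (B + 1) * norm h"
          using q(2) norm_triangle_sub[of "F (s, x + h, u (s, x)) - F (s, x, u (s, x))" "DF (s, x, u (s, x)) (0, h, 0)"]
          by (simp add: algebra_simps)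
        moreover have "norm (F (s, x + h, u (s, x + h)) - F (s, x + h, u (s, x))) \<le> L * norm (u (s, x + h) - u (s, x))"
          using lip q(1) u[OF I[OF s] xP[OF h'(1)]] by blast
        ultimately show "norm (F (s, x + h, u (s, x + h)) - F (s, x, u (s, x))) \<le> L * norm (u (s, x + h) - u (s, x)) + (B + 1) * norm h"
          using norm_triangle_mono[of "F (s, x + h, u (s, x + h)) - F (s, x + h, u (s, x))" _ "F (s, x + h, u (s, x)) - F (s, x, u (s, x))"]
          by fastforce
      qed (use \<tau> a B s in auto)
      also have "norm (u (0, x + h) - u (0, x)) \<le> C' * norm h"
        using C'(2)[of h] c(2)[OF xP[OF h'(1)] x] by simp
      finally show ?thesis by (simp add: C_def field_simps)
    qed
    show "\<exists>C\<ge>0. \<exists>d>0. \<forall>h. norm h < d \<longrightarrow> x + h \<in> P \<and> (\<forall>s\<in>{-\<tau> t..\<tau> t}. norm (u (s, x + h) - u (s, x)) \<le> C * norm h)"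
      using est C0 dP(1) d0(1) xP by (intro exI[of _ C] conjI exI[of _ "min dP d0"]) auto
    show "\<exists>d>0. \<forall>h. norm h < d \<longrightarrow> norm (u (t, x + h) - u (t, x) - w h (t, x)) \<le> \<epsilon> * norm h" if \<epsilon>: "\<epsilon> > 0" for \<epsilon>
    proof -
      \<comment> \<open>Chosen so that the Gronwall constant \<open>4/3 * \<tau> t * (1 + C)\<close>
        turns it into \<epsilon>; \<open>1 + C\<close> bounds the joint displacement of parameter
        and solution relative to |h|.\<close>
      define \<eta> where "\<eta> = \<epsilon> / (4/3 * \<tau> t * (1 + C))"
      have \<eta>: "\<eta> > 0" using \<epsilon> \<tau>(1) C0 by (simp add: \<eta>_def)
      obtain d1 where d1: "d1 > 0" "\<And>p h. p \<in> K \<Longrightarrow> norm h < d1 \<Longrightarrow> p + h \<in> D \<and> norm (F (p + h) - F p - DF p h) \<le> \<eta> * norm h"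
        using C1_uniformly_differentiable[OF D C1 K \<eta>] unfolding DF_def by metis
      define d where "d = min (min dP d0) (d1 / (1 + C))"
      have d: "d > 0" using d1(1) d0(1) dP(1) C0 by (simp add: d_def)
      have "norm (u (t, x + h) - u (t, x) - w h (t, x)) \<le> \<epsilon> * norm h" if h: "norm h < d" for h
      proof -
        have h': "norm h < min dP d0" "norm h < dP" "norm h < d1 / (1 + C)" using h by (auto simp: d_def)
        then have hd1: "(1 + C) * norm h < d1" using C0 by (simp add: field_simps)
        have "norm (u (t, x + h) - u (t, x) - w h (t, x)) \<le> 4/3 * (norm (u (0, x + h) - u (0, x) - w h (0, x)) + \<tau> t * (\<eta> * ((1 + C) * norm h)))"
        proof (rule gronwall_short(1)[where L = L and a = "\<tau> t" and
              e' = "\<lambda>s. F (s, x + h, u (s, x + h)) - F (s, x, u (s, x)) - DF (s, x, u (s, x)) (0, h, w h (s, x))"])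
          fix s assume s: "s \<in> ?I"
          show "((\<lambda>s. u (s, x + h) - u (s, x) - w h (s, x)) has_vector_derivative 
             F (s, x + h, u (s, x + h)) - F (s, x, u (s, x)) - DF (s, x, u (s, x)) (0, h, w h (s, x))) (at s within ?I)"
            by (intro has_vector_derivative_diff uw I s x xP h')
          let ?e = "u (s, x + h) - u (s, x)" and ?p = "(s, x, u (s, x))"
          have p: "?p \<in> K" using s by (auto simp: K_def)
          have n: "norm (0::real, h, ?e) \<le> (1 + C) * norm h"
            using est[OF h'(1) s] norm_Pair_le[of h ?e] by (simp add: norm_Pair algebra_simps)
          have 1: "norm (F (s, x + h, u (s, x + h)) - F ?p - DF ?p (0, h, ?e)) \<le> \<eta> * norm (0::real, h, ?e)"
            using d1(2)[OF p, of "(0, h, ?e)"] n hd1 by auto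
          also have "\<dots> \<le> \<eta> * ((1 + C) * norm h)" using n \<eta> by (intro mult_left_mono) auto
          finally have 1: "norm (F (s, x + h, u (s, x + h)) - F ?p - DF ?p (0, h, ?e)) \<le> \<eta> * ((1 + C) * norm h)" .
          have pD: "?p \<in> D" using p K by auto
          have "DF ?p (0, 0, ?e - w h (s, x)) = DF ?p ((0, h, ?e) - (0, h, w h (s, x)))" by simp
          also have "\<dots> = DF ?p (0, h, ?e) - DF ?p (0, h, w h (s, x))"
            using lin[OF pD] linear_diff by blast
          finally have 2: "norm (DF ?p (0, h, ?e) - DF ?p (0, h, w h (s, x))) \<le> L * norm (?e - w h (s, x))"
            using dlip[OF pD, of "?e - w h (s, x)"] by (simp add: DF_def)
          show "norm (F (s, x + h, u (s, x + h)) - F ?p - DF ?p (0, h, w h (s, x))) 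
             \<le> L * norm (?e - w h (s, x)) + \<eta> * ((1 + C) * norm h)"
            using norm_triangle_mono[OF 1 2] by (simp add: algebra_simps)
        qed (use \<tau> a \<eta> C0 in auto)
        also have "u (0, x + h) - u (0, x) - w h (0, x) = 0"
          using c(2)[OF xP[OF h'(2)] x] w(2)[OF x] by simp
        also have "4/3 * (norm (0::'e) + \<tau> t * (\<eta> * ((1 + C) * norm h))) = \<epsilon> * norm h"
        proof -
          have "4/3 * \<tau> t * (1 + C) \<noteq> 0" using \<tau>(1) C0 by auto
          then have "\<eta> * (4/3 * \<tau> t * (1 + C)) = \<epsilon>" by (metis \<eta>_def nonzero_eq_divide_eq)
          then show ?thesis by (metis (no_types, opaque_lifting) add.left_neutral mult.assoc mult.commute norm_zero)
        qed
        finally show ?thesis .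
      qed
      then show ?thesis using d by blast
    qed
  qed
  \<comment> \<open>The functions \<open>w v\<close> are given separately for each \<open>v\<close>.
    Linearity in \<open>v\<close> comes from uniqueness, since sums and multiples solve the same
    initial value problem.\<close>
  have lw: "linear (\<lambda>v. w v (t, x))" if t: "t \<in> {-a<..<a}" and x: "x \<in> P" for t x
  proof -
    note \<tau> = \<tau>[OF t]
    let ?I = "{-\<tau> t..\<tau> t}"
    have I: "s \<in> {-a<..<a}" if "s \<in> ?I" for s using that \<tau>(2) by auto
    have pD: "(s, x, u (s, x)) \<in> D" if "s \<in> ?I" for s using u[OF I[OF that] x] by blast
    have un: "z t = w v (t, x)" if z: "\<And>s. s \<in> ?I \<Longrightarrow> (z has_vector_derivative DF (s, x, u (s, x)) (0, v, z s)) (at s within ?I)"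
      and z0: "z 0 = c v" for z v
    proof (rule ode_unique[where a = "\<tau> t" and L = L and v = "\<lambda>t. w v (t, x)", OF _ _ _ z uw(2)[OF I x]])
      fix s assume s: "s \<in> ?I"
      have "DF (s, x, u (s, x)) (0, v, z s) - DF (s, x, u (s, x)) (0, v, w v (s, x)) =
         DF (s, x, u (s, x)) ((0, v, z s) - (0, v, w v (s, x)))"
        using linear_diff[OF lin[OF pD[OF s]]] by metis
      then show "norm (DF (s, x, u (s, x)) (0, v, z s) - DF (s, x, u (s, x)) (0, v, w v (s, x))) \<le> L * norm (z s - w v (s, x))"
        using dlip[OF pD[OF s], of "z s - w v (s, x)"] by (simp add: DF_def)
    qed (use \<tau> a z0 w(2)[OF x] in auto)
    show ?thesis
    proof (rule linearI)
      fix v v'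
      have "w v (t, x) + w v' (t, x) = w (v + v') (t, x)"
      proof (rule un[of "\<lambda>s. w v (s, x) + w v' (s, x)"])
        fix s assume s: "s \<in> ?I"
        have "DF (s, x, u (s, x)) (0, v, w v (s, x)) + DF (s, x, u (s, x)) (0, v', w v' (s, x)) =
          DF (s, x, u (s, x)) (0, v + v', w v (s, x) + w v' (s, x))"
          using linear_add[OF lin[OF pD[OF s]], of "(0, v, w v (s, x))" "(0, v', w v' (s, x))"] by simp
        then show "((\<lambda>s. w v (s, x) + w v' (s, x)) has_vector_derivative DF (s, x, u (s, x)) (0, v + v', w v (s, x) + w v' (s, x))) (at s within ?I)"
          using has_vector_derivative_add[OF uw(2)[OF I[OF s] x, of v ?I] uw(2)[OF I[OF s] x, of v' ?I]] by simp
      qed (use w(2)[OF x] linear_add[OF c(1)] in auto)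
      then show "w (v + v') (t, x) = w v (t, x) + w v' (t, x)" by simp
    next
      fix r v
      have "r *\<^sub>R w v (t, x) = w (r *\<^sub>R v) (t, x)"
      proof (rule un[of "\<lambda>s. r *\<^sub>R w v (s, x)"])
        fix s assume s: "s \<in> ?I"
        have "r *\<^sub>R DF (s, x, u (s, x)) (0, v, w v (s, x)) = DF (s, x, u (s, x)) (0, r *\<^sub>R v, r *\<^sub>R w v (s, x))"
          using linear_scale[OF lin[OF pD[OF s]], of r "(0, v, w v (s, x))"] by simp
        then show "((\<lambda>s. r *\<^sub>R w v (s, x)) has_vector_derivative DF (s, x, u (s, x)) (0, r *\<^sub>R v, r *\<^sub>R w v (s, x))) (at s within ?I)"
          using bounded_linear.has_vector_derivative[OF bounded_linear_scaleR_right[of r] uw(2)[OF I[OF s] x, of v ?I]] by simp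
      qed (use w(2)[OF x] linear_scale[OF c(1)] in auto)
      then show "w (r *\<^sub>R v) (t, x) = r *\<^sub>R w v (t, x)" by simp
    qed
  qed
  have dx: "((\<lambda>x. u (t, x)) has_derivative (\<lambda>v. w v (t, x))) (at x)" if t: "t \<in> {-a<..<a}" and x: "x \<in> P" for t x
    unfolding has_derivative_at_alt
  proof (intro conjI allI impI)
    show "bounded_linear (\<lambda>v. w v (t, x))" using lw[OF t x] linear_conv_bounded_linear by blast
    fix \<epsilon> :: real assume "\<epsilon> > 0"
    from resid[OF t x this] obtain d where d: "d > 0" "\<And>h. norm h < d \<Longrightarrow> norm (u (t, x + h) - u (t, x) - w h (t, x)) \<le> \<epsilon> * norm h" by blast
    then show "\<exists>d>0. \<forall>y. norm (y - x) < d \<longrightarrow> norm (u (t, y) - u (t, x) - w (y - x) (t, x)) \<le> \<epsilon> * norm (y - x)"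
      by (metis add_diff_cancel_left' diff_add_cancel add.commute)
  qed
  have cu: "isCont u (t, x)" if t: "t \<in> {-a<..<a}" and x: "x \<in> P" for t x
  proof (rule continuous_at_param)
    show "isCont (\<lambda>t. u (t, x)) t" using uw(1)[OF t x] has_vector_derivative_continuous by blast
    fix e :: real assume e: "e > 0"
    obtain C d where C: "C \<ge> 0" "d > 0" "\<And>h s. norm h < d \<Longrightarrow> s \<in> {-\<tau> t..\<tau> t} \<Longrightarrow> norm (u (s, x + h) - u (s, x)) \<le> C * norm h"
      using Lips[OF t x] by blast
    have "open {-\<tau> t<..<\<tau> t}" "t \<in> {-\<tau> t<..<\<tau> t}" using \<tau>[OF t] by auto
    then obtain d2 where d2: "d2 > 0" "ball t d2 \<subseteq> {-\<tau> t<..<\<tau> t}" using open_contains_ball by blast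
    show "\<exists>d>0. \<forall>x' s. dist x' x < d \<longrightarrow> dist s t < d \<longrightarrow> dist (u (s, x')) (u (s, x)) \<le> e"
    proof (intro exI[of _ "min (min d d2) (e / (C + 1))"] conjI allI impI)
      fix x' s assume *: "dist x' x < min (min d d2) (e / (C + 1))" "dist s t < min (min d d2) (e / (C + 1))"
      then have "s \<in> ball t d2" by (simp add: dist_commute)
      then have "s \<in> {-\<tau> t..\<tau> t}" using d2(2) by fastforce
      then have "norm (u (s, x + (x' - x)) - u (s, x)) \<le> C * norm (x' - x)" using * by (intro C) (auto simp: dist_norm)
      also have "\<dots> \<le> C * (e / (C + 1))" using * C(1) by (intro mult_left_mono) (auto simp: dist_norm)
      also have "\<dots> \<le> e" using C(1) e by (simp add: field_simps)
      finally show "dist (u (s, x')) (u (s, x)) \<le> e" by (simp add: dist_norm)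
    qed (use C d2 e in auto)
  qed
  \<comment> \<open>\<open>has_derivative_partialsI\<close> asks for continuity of the partial
    derivative in the second argument. The time derivative is the one known to be continuous,
    through the equation, so the arguments are swapped here and swapped back at the end.\<close>
  have "((\<lambda>(x, t). u (t, x)) has_derivative (\<lambda>(v, r). w v (t, x) + blinfun_scaleR_left (F (t, x, u (t, x))) r)) (at (x, t) within P \<times> {-a<..<a})"
  proof (rule has_derivative_partialsI[where fy = "\<lambda>x t. blinfun_scaleR_left (F (t, x, u (t, x)))"])
    show "((\<lambda>x. u (t, x)) has_derivative (\<lambda>v. w v (t, x))) (at x within P)"
      using dx[OF t x] has_derivative_at_withinI by blast
    show "((\<lambda>t. u (t, y)) has_derivative blinfun_scaleR_left (F (s, y, u (s, y)))) (at s within {-a<..<a})" if "y \<in> P" "s \<in> {-a<..<a}" for y s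
      using uw(1)[OF that(2,1)] by (simp add: has_vector_derivative_def)
    have "isCont (\<lambda>p. F (snd p, fst p, u (snd p, fst p))) (x, t)"
    proof (rule isCont_o2[where g = F and f = "\<lambda>p. (snd p, fst p, u (snd p, fst p))"])
      show "isCont F ((\<lambda>p. (snd p, fst p, u (snd p, fst p))) (x, t))"
        using u[OF t x] Ck_on_imp_continuous_on[OF C1] unfolding continuous_on_eq_continuous_at[OF D] by simp
      have "isCont (\<lambda>p. u (snd p, fst p)) (x, t)"
        by (rule isCont_o2[where g = u and f = "\<lambda>p. (snd p, fst p)"]) (intro continuous_intros, simp add: cu[OF t x])
      then show "isCont (\<lambda>p. (snd p, fst p, u (snd p, fst p))) (x, t)" by (intro continuous_intros)
    qed
    then have "isCont (\<lambda>p. blinfun_scaleR_left (F (snd p, fst p, u (snd p, fst p)))) (x, t)"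
      by (rule bounded_linear.isCont[OF bounded_linear_blinfun_scaleR_left])
    then show "continuous (at (x, t) within P \<times> {-a<..<a}) (\<lambda>(x, t). blinfun_scaleR_left (F (t, x, u (t, x))))"
      by (auto simp: case_prod_unfold intro: continuous_at_imp_continuous_at_within)
  qed (use t in auto)
  moreover have "at (x, t) within P \<times> {-a<..<a} = at (x, t)"
    using P x t by (intro at_within_open) (auto simp: open_Times)
  ultimately have "((\<lambda>(x, t). u (t, x)) has_derivative (\<lambda>(v, r). w v (t, x) + r *\<^sub>R F (t, x, u (t, x)))) (at (x, t))"
    by simp
  then have g: "((\<lambda>(x, t). u (t, x)) has_derivative (\<lambda>(v, r). w v (t, x) + r *\<^sub>R F (t, x, u (t, x)))) (at (snd (t, x), fst (t, x)))"
    by simp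
  have "((\<lambda>p::real \<times> 'p. (snd p, fst p)) has_derivative (\<lambda>p. (snd p, fst p))) (at (t, x))"
    by (intro derivative_intros)
  from has_derivative_compose[where f = "\<lambda>p. (snd p, fst p)" and g = "\<lambda>(x, t). u (t, x)", OF this g]
  show ?thesis by (simp add: case_prod_unfold add.commute)
qed

section \<open>Families of linear maps, regular for each fixed argument\<close>

lemma linear_family_continuous_on:
  fixes A :: "'p::topological_space \<Rightarrow> 'a::euclidean_space \<Rightarrow> 'b::real_normed_vector"
  assumes "\<And>p. p \<in> P \<Longrightarrow> linear (A p)" "\<And>w. continuous_on P (\<lambda>p. A p w)" "continuous_on P y"
  shows "continuous_on P (\<lambda>p. A p (y p))"
proof -
  have "continuous_on P (\<lambda>p. \<Sum>i\<in>Basis. (y p \<bullet> i) *\<^sub>R A p i)"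
    by (intro continuous_intros assms)
  then show ?thesis
    by (rule continuous_on_eq) (simp add: linear_Basis_expand[OF assms(1), symmetric])
qed

lemma linear_family_Ck:
  fixes A :: "'p::real_normed_vector \<Rightarrow> 'a::euclidean_space \<Rightarrow> 'b::real_normed_vector"
  assumes "open P" "\<And>p. p \<in> P \<Longrightarrow> linear (A p)" "\<And>w. Ck_on k P (\<lambda>p. A p w)" "Ck_on k P y"
  shows "Ck_on k P (\<lambda>p. A p (y p))"
proof (rule Ck_on_cong[OF assms(1)])
  show "Ck_on k P (\<lambda>p. \<Sum>i\<in>Basis. (y p \<bullet> i) *\<^sub>R A p i)"
    by (intro Ck_on_sum Ck_on_scaleR assms Ck_on_linear_comp[OF bounded_linear_inner_left])
qed (simp add: linear_Basis_expand[OF assms(2), symmetric])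

text \<open>Expansion in the basis reduces this product rule to scalar factors, so that
  differentiability of \<open>A\<close> for each fixed argument suffices and no operator-valued
  derivative occurs.\<close>

lemma linear_family_has_derivative:
  fixes A :: "'p::real_normed_vector \<Rightarrow> 'a::euclidean_space \<Rightarrow> 'b::real_normed_vector"
  assumes "open P" "p \<in> P" "\<And>p. p \<in> P \<Longrightarrow> linear (A p)"
    "\<And>w. ((\<lambda>p. A p w) has_derivative A' w) (at p)" "(y has_derivative y') (at p)"
  shows "((\<lambda>p. A p (y p)) has_derivative (\<lambda>h. A p (y' h) + A' (y p) h)) (at p)"
proof -
  have "((\<lambda>p. \<Sum>i\<in>Basis. (y p \<bullet> i) *\<^sub>R A p i) has_derivative
     (\<lambda>h. \<Sum>i\<in>Basis. (y p \<bullet> i) *\<^sub>R A' i h + (y' h \<bullet> i) *\<^sub>R A p i)) (at p)"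
    by (intro has_derivative_sum has_derivative_scaleR assms bounded_linear.has_derivative[OF bounded_linear_inner_left])
  also have "(\<lambda>h. \<Sum>i\<in>Basis. (y p \<bullet> i) *\<^sub>R A' i h + (y' h \<bullet> i) *\<^sub>R A p i) = (\<lambda>h. A p (y' h) + A' (y p) h)"
  proof
    fix h
    have "((\<lambda>q. A q (y p)) has_derivative (\<lambda>h. \<Sum>i\<in>Basis. (y p \<bullet> i) *\<^sub>R A' i h)) (at p)"
    proof (rule has_derivative_transform_within_open[OF _ assms(1,2)])
      show "((\<lambda>q. \<Sum>i\<in>Basis. (y p \<bullet> i) *\<^sub>R A q i) has_derivative (\<lambda>h. \<Sum>i\<in>Basis. (y p \<bullet> i) *\<^sub>R A' i h)) (at p)"
        by (intro has_derivative_sum bounded_linear.has_derivative[OF bounded_linear_scaleR_right] assms)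
    qed (simp add: linear_Basis_expand[OF assms(3), symmetric])
    then have "A' (y p) = (\<lambda>h. \<Sum>i\<in>Basis. (y p \<bullet> i) *\<^sub>R A' i h)"
      using assms(4) has_derivative_unique by blast
    then show "(\<Sum>i\<in>Basis. (y p \<bullet> i) *\<^sub>R A' i h + (y' h \<bullet> i) *\<^sub>R A p i) = A p (y' h) + A' (y p) h"
      using linear_Basis_expand[OF assms(3)[OF assms(2)], of "y' h"] by (simp add: sum.distrib)
  qed
  finally show ?thesis
    by (rule has_derivative_transform_within_open[OF _ assms(1,2)])
      (simp add: linear_Basis_expand[OF assms(3), symmetric])
qed

text \<open>\<open>A q w\<close> equals its basis expansion in \<open>w\<close> for all q near p, so
  uniqueness of the derivative passes the expansion on to \<open>A'\<close>.\<close>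

lemma linear_family_derivative_linear:
  fixes A :: "'p::real_normed_vector \<Rightarrow> 'a::euclidean_space \<Rightarrow> 'b::real_normed_vector"
  assumes "open P" "p \<in> P" "\<And>p. p \<in> P \<Longrightarrow> linear (A p)"
    "\<And>w. ((\<lambda>p. A p w) has_derivative A' w) (at p)"
  shows "linear (\<lambda>w. A' w h)"
proof -
  have "A' w h = (\<Sum>i\<in>Basis. (w \<bullet> i) *\<^sub>R A' i h)" for w
  proof -
    have "((\<lambda>q. A q w) has_derivative (\<lambda>h. \<Sum>i\<in>Basis. (w \<bullet> i) *\<^sub>R A' i h)) (at p)"
    proof (rule has_derivative_transform_within_open[OF _ assms(1,2)])
      show "((\<lambda>q. \<Sum>i\<in>Basis. (w \<bullet> i) *\<^sub>R A q i) has_derivative (\<lambda>h. \<Sum>i\<in>Basis. (w \<bullet> i) *\<^sub>R A' i h)) (at p)"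
        by (intro has_derivative_sum bounded_linear.has_derivative[OF bounded_linear_scaleR_right] assms)
    qed (simp add: linear_Basis_expand[OF assms(3), symmetric])
    then have "A' w = (\<lambda>h. \<Sum>i\<in>Basis. (w \<bullet> i) *\<^sub>R A' i h)"
      using assms(4)[of w] has_derivative_unique by blast
    then show ?thesis by (rule fun_cong)
  qed
  then have "(\<lambda>w. A' w h) = (\<lambda>w. \<Sum>i\<in>Basis. (w \<bullet> i) *\<^sub>R A' i h)"
    by (intro ext)
  moreover have "linear (\<lambda>w. \<Sum>i\<in>Basis. (w \<bullet> i) *\<^sub>R A' i h)"
    by (simp add: linear_iff inner_add_left scaleR_add_left sum.distrib scaleR_sum_right)
  ultimately show ?thesis by (simp only:)
qed

text \<open>Induction on \<open>k\<close>, for all inhomogeneities at once: the spatial derivative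
  of \<open>y\<close> solves an equation with the same \<open>A\<close> and the inhomogeneity DA(y)
  + Db, which is C^k as soon as \<open>y\<close> is, while the time derivative is given by the
  equation. Thus \<open>y\<close> gains one order. The initial value \<open>c\<close> is constant in
  \<open>x\<close>, so the differentiated equation starts from 0.\<close>

lemma linear_ode_Ck:
  fixes A :: "real \<times> 'p::euclidean_space \<Rightarrow> 'e::euclidean_space \<Rightarrow> 'e"
  defines "P a B \<equiv> {-a<..<a::real} \<times> B"
  assumes B: "open B" and a: "0 < a" "0 \<le> L" "a * L \<le> 1/4"
    and lin: "\<And>p. p \<in> P a B \<Longrightarrow> linear (A p)"
    and bound: "\<And>p w. p \<in> P a B \<Longrightarrow> norm (A p w) \<le> L * norm w"
    and A: "\<And>w. Ck_on k (P a B) (\<lambda>p. A p w)"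
    and b: "Ck_on k (P a B) b"
    and y: "\<And>t x. t \<in> {-a<..<a} \<Longrightarrow> x \<in> B \<Longrightarrow> ((\<lambda>t. y (t, x)) has_vector_derivative A (t, x) (y (t, x)) + b (t, x)) (at t)"
      "\<And>x. x \<in> B \<Longrightarrow> y (0, x) = c"
  shows "Ck_on k (P a B) y"
  using A b y
proof (induction k arbitrary: b c y)
  case 0
  have cA: "\<And>w. continuous_on (P a B) (\<lambda>p. A p w)" and cb: "continuous_on (P a B) b" using "0.prems" by auto
  have yc: "isCont (\<lambda>t. y (t, x)) t" if "t \<in> {-a<..<a}" "x \<in> B" for t x
    using "0.prems"(3)[OF that] has_vector_derivative_continuous by blast
  have "isCont y (t, x)" if t: "t \<in> {-a<..<a}" and x: "x \<in> B" for t x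
  proof (rule continuous_at_param[OF yc[OF t x]])
    fix e :: real assume e: "e > 0"
    define \<tau> where "\<tau> = (\<bar>t\<bar> + a) / 2"
    have \<tau>: "0 < \<tau>" "\<tau> < a" "t \<in> {-\<tau><..<\<tau>}" "\<tau> * L \<le> 1/4"
    proof -
      show s: "0 < \<tau>" "\<tau> < a" "t \<in> {-\<tau><..<\<tau>}" using abs_midpoint[OF t] unfolding \<tau>_def .
      then show "\<tau> * L \<le> 1/4" using mult_right_mono[of "\<tau>" a L] a by linarith
    qed
    let ?I = "{-\<tau>..\<tau>}"
    have I: "s \<in> {-a<..<a}" if "s \<in> ?I" for s using that \<tau>(2) by auto
    obtain r where r: "r > 0" "cball x r \<subseteq> B" using B x open_contains_cball by blast
    \<comment> \<open>Here \<open>y\<close> is frozen at the parameter \<open>x\<close>. The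
      difference of two solutions then splits into a part controlled by \<open>L\<close> and a part
      governed by the uniform continuity of \<open>H\<close> on a compact set.\<close>
    define H where "H p = A p (y (fst p, x)) + b p" for p
    have sub: "?I \<times> cball x r \<subseteq> P a B" using I r by (auto simp: P_def)
    have "continuous_on (?I \<times> cball x r) (\<lambda>p. y (fst p, x))"
    proof (rule continuous_on_compose2[of ?I "\<lambda>s. y (s, x)"])
      show "continuous_on ?I (\<lambda>s. y (s, x))"
        using yc[OF I x] by (simp add: continuous_at_imp_continuous_on)
    qed (auto intro: continuous_intros)
    note yx = this
    have "linear (A p)" if "p \<in> ?I \<times> cball x r" for p using lin sub that by blast
    from linear_family_continuous_on[where A = A, OF this continuous_on_subset[OF cA sub] yx]
    have "continuous_on (?I \<times> cball x r) (\<lambda>p. A p (y (fst p, x)))" by simp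
    then have "continuous_on (?I \<times> cball x r) H" unfolding H_def
      by (intro continuous_on_add continuous_on_subset[OF cb sub])
    then have "uniformly_continuous_on (?I \<times> cball x r) H"
      by (intro compact_uniformly_continuous compact_Times) auto
    moreover define \<eta> where "\<eta> = e / (4/3 * \<tau>)"
    ultimately obtain d where d: "d > 0" "\<And>p q. p \<in> ?I \<times> cball x r \<Longrightarrow> q \<in> ?I \<times> cball x r \<Longrightarrow> dist p q < d \<Longrightarrow> dist (H p) (H q) < \<eta>"
      using e \<tau>(1) unfolding uniformly_continuous_on_def by (metis zero_less_divide_iff mult_pos_pos zero_less_divide_iff zero_less_numeral)
    have un: "norm (y (s, x') - y (s, x)) \<le> e" if x': "dist x' x < min r d" and s: "s \<in> ?I" for x' s
    proof -
      have x'B: "x' \<in> cball x r" "x' \<in> B" using x' r by (auto simp: dist_commute)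
      have "norm (y (s, x') - y (s, x)) \<le> 4/3 * (norm (y (0, x') - y (0, x)) + \<tau> * \<eta>)"
      proof (rule gronwall_short(1)[where L = L and a = \<tau> and
            e' = "\<lambda>s. (A (s, x') (y (s, x')) + b (s, x')) - (A (s, x) (y (s, x)) + b (s, x))"])
        fix s assume s: "s \<in> ?I"
        show "((\<lambda>s. y (s, x') - y (s, x)) has_vector_derivative (A (s, x') (y (s, x')) + b (s, x')) - (A (s, x) (y (s, x)) + b (s, x))) (at s within ?I)"
          by (intro has_vector_derivative_diff has_vector_derivative_at_within[OF "0.prems"(3)] I s x x'B)
        have pP: "(s, x') \<in> P a B" using I[OF s] x'B by (simp add: P_def)
        have "dist (H (s, x')) (H (s, x)) < \<eta>" using s x'B x' r by (intro d(2)) (auto simp: dist_Pair_Pair)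
        then have 1: "norm (H (s, x') - H (s, x)) \<le> \<eta>" by (simp add: dist_norm)
        have 2: "norm (A (s, x') (y (s, x') - y (s, x))) \<le> L * norm (y (s, x') - y (s, x))" by (rule bound[OF pP])
        have "(A (s, x') (y (s, x')) + b (s, x')) - (A (s, x) (y (s, x)) + b (s, x)) = A (s, x') (y (s, x') - y (s, x)) + (H (s, x') - H (s, x))"
          by (simp add: H_def linear_diff[OF lin[OF pP]])
        then show "norm ((A (s, x') (y (s, x')) + b (s, x')) - (A (s, x) (y (s, x)) + b (s, x))) \<le> L * norm (y (s, x') - y (s, x)) + \<eta>"
          using norm_triangle_mono[OF 2 1] by simp
      qed (use \<tau> a s e in \<open>auto simp: \<eta>_def\<close>)
      also have "\<dots> = e" using "0.prems"(4) x x'B \<tau>(1) by (simp add: \<eta>_def)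
      finally show ?thesis .
    qed
    have "open {-\<tau><..<\<tau>}" "t \<in> {-\<tau><..<\<tau>}" using \<tau> by auto
    then obtain d2 where d2: "d2 > 0" "ball t d2 \<subseteq> {-\<tau><..<\<tau>}" using open_contains_ball by blast
    show "\<exists>d>0. \<forall>x' s. dist x' x < d \<longrightarrow> dist s t < d \<longrightarrow> dist (y (s, x')) (y (s, x)) \<le> e"
    proof (intro exI[of _ "min (min r d) d2"] conjI allI impI)
      fix x' s assume *: "dist x' x < min (min r d) d2" "dist s t < min (min r d) d2"
      then have "s \<in> ball t d2" by (simp add: dist_commute)
      then have "s \<in> ?I" using d2(2) by fastforce
      then show "dist (y (s, x')) (y (s, x)) \<le> e" using un[of x' s] * by (simp add: dist_norm)
    qed (use r d d2 in auto)
  qed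
  then show ?case by (auto simp: P_def intro!: continuous_at_imp_continuous_on)
next
  case (Suc k)
  note A1 = Suc.prems(1) and b1 = Suc.prems(2) and y1 = Suc.prems(3) and y0 = Suc.prems(4)
  have oP: "open (P a B)" using B by (simp add: P_def open_Times)
  have Pi: "(t, x) \<in> P a B" if "t \<in> {-a<..<a}" "x \<in> B" for t x using that by (simp add: P_def)
  have Ak: "Ck_on k (P a B) (\<lambda>p. A p w)" for w using Ck_on_Suc_imp[OF A1] .
  have yk: "Ck_on k (P a B) y" by (rule Suc.IH[OF Ak Ck_on_Suc_imp[OF b1] y1 y0])
  define DA where "DA w p = frechet_derivative (\<lambda>p. A p w) (at p)" for w p
  define Db where "Db p = frechet_derivative b (at p)" for p
  note dA = Ck_on_SucD[OF oP A1, folded DA_def] and db = Ck_on_SucD[OF oP b1, folded Db_def]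
  have linDA: "linear (\<lambda>w. DA w p h)" if "p \<in> P a B" for p h
    by (rule linear_family_derivative_linear[OF oP that lin dA(1)[OF that]])
  \<comment> \<open>The linear equation seen as a nonlinear one in the unknown \<open>w\<close>, the
    form in which \<open>ode_param_differentiable\<close> applies to it.\<close>
  define F where "F = (\<lambda>(t, x, w). A (t, x) w + b (t, x))"
  define D where "D = {-a<..<a} \<times> B \<times> (UNIV :: 'e set)"
  have oD: "open D" using B by (simp add: D_def open_Times)
  define \<pi> :: "real \<times> 'p \<times> 'e \<Rightarrow> real \<times> 'p" where "\<pi> q = (fst q, fst (snd q))" for q
  have bl\<pi>: "bounded_linear \<pi>" unfolding \<pi>_def
    by (intro bounded_linear_Pair bounded_linear_fst bounded_linear_snd bounded_linear_compose[OF bounded_linear_fst bounded_linear_snd])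
  have \<pi>P: "\<pi> q \<in> P a B" if "q \<in> D" for q using that by (auto simp: D_def \<pi>_def P_def)
  have Feq: "F = (\<lambda>q. A (\<pi> q) (snd (snd q)) + b (\<pi> q))" by (auto simp: F_def \<pi>_def)
  have bl22: "bounded_linear (\<lambda>q::real \<times> 'p \<times> 'e. snd (snd q))"
    by (intro bounded_linear_compose[OF bounded_linear_snd bounded_linear_snd])
  have im\<pi>: "\<pi> ` D \<subseteq> P a B" using \<pi>P by auto
  have C1: "Ck_on (Suc 0) D F" unfolding Feq
    by (rule Ck_on_add[OF oD linear_family_Ck[OF oD lin[OF \<pi>P] _ Ck_on_bounded_linear[OF bl22 oD]]
          Ck_on_compose[OF oD oP im\<pi> Ck_on_bounded_linear[OF bl\<pi> oD] Ck_on_Suc_le[OF b1]]])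
      (assumption, rule Ck_on_compose[OF oD oP im\<pi> Ck_on_bounded_linear[OF bl\<pi> oD] Ck_on_Suc_le[OF A1]])
  have DF: "frechet_derivative F (at (t, x, w)) (r, v, k) = A (t, x) k + DA w (t, x) (r, v) + Db (t, x) (r, v)"
    if "t \<in> {-a<..<a}" "x \<in> B" for t x w r v k
  proof -
    have q: "(t, x, w) \<in> D" using that by (simp add: D_def)
    have *: "((\<lambda>q. A (\<pi> q) z) has_derivative (\<lambda>h. DA z (\<pi> (t, x, w)) (\<pi> h))) (at (t, x, w))" for z
      by (rule has_derivative_compose[OF bounded_linear_imp_has_derivative[OF bl\<pi>] dA(1)[OF \<pi>P[OF q]]])
    have "(F has_derivative (\<lambda>h. (A (\<pi> (t, x, w)) (snd (snd h)) + DA (snd (snd (t, x, w))) (\<pi> (t, x, w)) (\<pi> h)) + Db (\<pi> (t, x, w)) (\<pi> h))) (at (t, x, w))"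
      unfolding Feq
      by (rule has_derivative_add[OF
          linear_family_has_derivative[OF oD q lin[OF \<pi>P] * bounded_linear_imp_has_derivative[OF bl22]]
          has_derivative_compose[OF bounded_linear_imp_has_derivative[OF bl\<pi>] db(1)[OF \<pi>P[OF q]]]])
    from frechet_derivative_at[OF this, symmetric] show ?thesis by (simp add: \<pi>_def)
  qed
  \<comment> \<open>The inhomogeneity of the equation differentiated in the spatial direction
    \<open>v\<close>.\<close>
  define bv where "bv v p = DA (y p) p (0, v) + Db p (0, v)" for v p
  have bvk: "Ck_on k (P a B) (bv v)" for v unfolding bv_def
    by (rule Ck_on_add[OF oP linear_family_Ck[where A = "\<lambda>p w. DA w p (0, v)", OF oP linDA dA(2) yk] db(2)])
  have "\<exists>w. w 0 = 0 \<and> (\<forall>t\<in>{-a<..<a}. (w has_vector_derivative A (t, x) (w t) + bv v (t, x)) (at t))" if x: "x \<in> B" for v x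
  proof (rule ode_exists[OF a])
    have sl: "continuous_on ({-a<..<a} \<times> (UNIV :: 'e set)) (\<lambda>q. (fst q, x))" by (intro continuous_intros)
    have im: "(\<lambda>q. (fst q, x)) ` ({-a<..<a} \<times> (UNIV :: 'e set)) \<subseteq> P a B" using Pi x by auto
    have "continuous_on ({-a<..<a} \<times> UNIV) (\<lambda>q. A (fst q, x) (snd q) + bv v (fst q, x))"
      by (rule continuous_on_add[OF linear_family_continuous_on[where A = "\<lambda>q. A (fst q, x)"]
          continuous_on_compose2[OF Ck_on_imp_continuous_on[OF bvk] sl im]])
        (use lin im in blast, rule continuous_on_compose2[OF Ck_on_imp_continuous_on[OF Ak] sl im],
         intro continuous_intros)
    then show "continuous_on ({-a<..<a} \<times> UNIV) (\<lambda>(t, w). A (t, x) w + bv v (t, x))"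
      by (simp add: case_prod_unfold)
    show "norm (A (t, x) w + bv v (t, x) - (A (t, x) z + bv v (t, x))) \<le> L * norm (w - z)" if "t \<in> {-a<..<a}" for t w z
      using bound[OF Pi[OF that x], of "w - z"] linear_diff[OF lin[OF Pi[OF that x]]] by simp
  qed
  note exw = this
  define w' where "w' v x = (SOME w. w 0 = 0 \<and> (\<forall>t\<in>{-a<..<a}. (w has_vector_derivative A (t, x) (w t) + bv v (t, x)) (at t)))" for v x
  have w': "w' v x 0 = 0"
     "t \<in> {-a<..<a} \<Longrightarrow> (w' v x has_vector_derivative A (t, x) (w' v x t) + bv v (t, x)) (at t)" if "x \<in> B" for v x t
    using someI_ex[OF exw[OF that, of v]] unfolding w'_def by blast+
  define w where "w v p = w' v (snd p) (fst p)" for v p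
  have wk: "Ck_on k (P a B) (w v)" for v
    by (rule Suc.IH[OF Ak bvk[of v], of _ 0]) (use w' in \<open>auto simp: w_def\<close>)
  have dy: "(y has_derivative (\<lambda>(r, v). r *\<^sub>R F (t, x, y (t, x)) + w v (t, x))) (at (t, x))" if t: "t \<in> {-a<..<a}" and x: "x \<in> B" for t x
  proof (rule ode_param_differentiable[OF oD C1 B a, where c = "\<lambda>_. 0"])
    show "(t, x, y (t, x)) \<in> D \<and> ((\<lambda>t. y (t, x)) has_vector_derivative F (t, x, y (t, x))) (at t)"
      if "t \<in> {-a<..<a}" "x \<in> B" for t x
      using y1[OF that] that by (auto simp: D_def F_def)
    show "norm (F (t, x, z) - F (t, x, z')) \<le> L * norm (z - z')" if "(t, x, z) \<in> D" for t x z z'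
    proof -
      have "(t, x) \<in> P a B" using that by (auto simp: D_def P_def)
      from bound[OF this, of "z - z'"] linear_diff[OF lin[OF this]] show ?thesis by (simp add: F_def)
    qed
    show "norm (frechet_derivative F (at p) (0, 0, k)) \<le> L * norm k" if "p \<in> D" for p k
    proof -
      obtain t x z where p: "p = (t, x, z)" by (cases p)
      have tx: "t \<in> {-a<..<a}" "x \<in> B" using that by (auto simp: D_def p)
      have "DA z (t, x) (0, 0) = 0" "Db (t, x) (0, 0) = 0"
        using linear_0[OF has_derivative_linear[OF dA(1)[OF Pi[OF tx]]]] linear_0[OF has_derivative_linear[OF db(1)[OF Pi[OF tx]]]]
        by (auto simp: zero_prod_def)
      then show ?thesis using DF[OF tx, of z 0 0 k] bound[OF Pi[OF tx], of k] by (simp add: p)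
    qed
    show "((\<lambda>t. w v (t, x)) has_vector_derivative frechet_derivative F (at (t, x, y (t, x))) (0, v, w v (t, x))) (at t)"
      if "t \<in> {-a<..<a}" "x \<in> B" for v t x
      using w'(2)[OF that(2,1), of v] DF[OF that] by (simp add: w_def bv_def add.assoc)
    show "w v (0, x) = 0" if "x \<in> B" for v x using w'(1)[OF that] by (simp add: w_def)
  qed (use t x y0 in \<open>auto simp: linear_zero\<close>)
  show ?case
  proof (rule Ck_on_SucI[OF oP])
    fix p assume "p \<in> P a B"
    then show "(y has_derivative (\<lambda>h. fst h *\<^sub>R (A p (y p) + b p) + w (snd h) p)) (at p)"
      using dy by (auto simp: P_def F_def case_prod_unfold)
  next
    fix h
    show "Ck_on k (P a B) (\<lambda>p. fst h *\<^sub>R (A p (y p) + b p) + w (snd h) p)"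
      by (rule Ck_on_add[OF oP Ck_on_scaleR[OF oP Ck_on_const[OF oP]
          Ck_on_add[OF oP linear_family_Ck[OF oP lin Ak yk] Ck_on_Suc_imp[OF b1]]] wk])
  qed
qed

text \<open>The field is made global by composing it with the nearest-point map of the ball of
  radius 3r/4. As \<open>X\<close> vanishes at 0, solutions grow at most by the factor 4/3, so those
  starting in the ball of radius r/2 stay within 2r/3 and never meet the modification. Smoothness is
  a bootstrap: the coefficients of the variational equation are C^k if the flow is, hence so are its
  solutions, and these are the spatial derivatives of the flow. The last estimate provides
  injectivity and immersivity of the time maps.\<close>

lemma flow_smooth:
  fixes X :: "real \<times> 'e::euclidean_space \<Rightarrow> 'e"
  assumes a: "0 < a" "0 \<le> L" "a * L \<le> 1/4" and r: "0 < r"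
    and X: "smooth ({-a<..<a} \<times> ball 0 r) X"
    and dX: "\<And>t x k. t \<in> {-a<..<a} \<Longrightarrow> x \<in> ball 0 r \<Longrightarrow> norm (frechet_derivative X (at (t, x)) (0, k)) \<le> L * norm k"
    and X0: "\<And>t. t \<in> {-a<..<a} \<Longrightarrow> X (t, 0) = 0"
  obtains \<phi> where "smooth ({-a<..<a} \<times> ball 0 (r/2)) \<phi>"
    "\<And>t x. t \<in> {-a<..<a} \<Longrightarrow> x \<in> ball 0 (r/2) \<Longrightarrow> \<phi> (t, x) \<in> ball 0 r"
    "\<And>x. x \<in> ball 0 (r/2) \<Longrightarrow> \<phi> (0, x) = x"
    "\<And>t. t \<in> {-a<..<a} \<Longrightarrow> \<phi> (t, 0) = 0"
    "\<And>t x. t \<in> {-a<..<a} \<Longrightarrow> x \<in> ball 0 (r/2) \<Longrightarrow> ((\<lambda>t. \<phi> (t, x)) has_vector_derivative X (t, \<phi> (t, x))) (at t)"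
    "\<And>t x v. t \<in> {-a<..<a} \<Longrightarrow> x \<in> ball 0 (r/2) \<Longrightarrow> ((\<lambda>t. frechet_derivative \<phi> (at (t, x)) (0, v)) has_vector_derivative
        frechet_derivative X (at (t, \<phi> (t, x))) (0, frechet_derivative \<phi> (at (t, x)) (0, v))) (at t)"
    "\<And>x v. x \<in> ball 0 (r/2) \<Longrightarrow> frechet_derivative \<phi> (at (0, x)) (0, v) = v"
    "\<And>t x y. t \<in> {-a<..<a} \<Longrightarrow> x \<in> ball 0 (r/2) \<Longrightarrow> y \<in> ball 0 (r/2) \<Longrightarrow> norm (x - y) / 2 \<le> norm (\<phi> (t, x) - \<phi> (t, y))"
proof -
  let ?J = "{-a<..<a}" and ?B = "ball (0::'e) (r/2)"
  define P where "P = ?J \<times> ?B"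
  have oP: "open P" by (simp add: P_def open_Times)
  define DX where "DX p = frechet_derivative X (at p)" for p
  have hX: "(X has_derivative DX (t, x)) (at (t, x))" if "t \<in> ?J" "x \<in> ball 0 r" for t x
    unfolding DX_def using smooth_has_derivative[OF X] that by auto
  have linDX: "linear (DX (t, x))" if "t \<in> ?J" "x \<in> ball 0 r" for t x
    using hX[OF that] has_derivative_linear by blast
  have lipX: "norm (X (t, x) - X (t, y)) \<le> L * norm (x - y)" if t: "t \<in> ?J" and "x \<in> ball 0 r" "y \<in> ball 0 r" for t x y
  proof (rule differentiable_bound[where S = "ball 0 r" and f' = "\<lambda>z k. DX (t, z) (0, k)"])
    show "((\<lambda>x. X (t, x)) has_derivative (\<lambda>k. DX (t, z) (0, k))) (at z within ball 0 r)" if "z \<in> ball 0 r" for z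
      by (rule has_derivative_at_withinI, rule has_derivative_compose[where f = "\<lambda>x. (t, x)" and f' = "\<lambda>k. (0, k)" and g = X])
        (auto intro!: derivative_eq_intros hX t that)
    show "onorm (\<lambda>k. DX (t, z) (0, k)) \<le> L" if "z \<in> ball 0 r" for z
      using dX[OF t that] by (intro onorm_le) (simp add: DX_def)
  qed (use that in auto)
  define \<pi> where "\<pi> = closest_point (cball (0::'e) (3/4 * r))"
  have \<pi>r: "\<pi> y \<in> ball 0 r" for y
    using closest_point_in_set[of "cball (0::'e) (3/4*r)" y] r by (auto simp: \<pi>_def)
  have \<pi>l: "dist (\<pi> x) (\<pi> y) \<le> dist x y" for x y
    unfolding \<pi>_def using r by (intro closest_point_lipschitz) auto
  have \<pi>i: "\<pi> y = y" if "norm y \<le> 3/4 * r" for y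
    using that by (simp add: \<pi>_def closest_point_self)
  have c\<pi>: "continuous_on UNIV \<pi>" unfolding \<pi>_def using r by (intro continuous_on_closest_point) auto
  have ex: "\<exists>u. u 0 = x \<and> (\<forall>t\<in>?J. (u has_vector_derivative X (t, \<pi> (u t))) (at t))" for x
  proof (rule ode_exists[OF a])
    have "continuous_on (?J \<times> UNIV) (\<lambda>q. X (fst q, \<pi> (snd q)))"
      by (rule continuous_on_compose2[OF smooth_continuous_on[OF X]])
        (use \<pi>r in \<open>auto intro!: continuous_intros continuous_on_compose2[OF c\<pi>]\<close>)
    then show "continuous_on (?J \<times> UNIV) (\<lambda>(t, y). X (t, \<pi> y))" by (simp add: case_prod_unfold)
    show "norm (X (t, \<pi> y) - X (t, \<pi> z)) \<le> L * norm (y - z)" if "t \<in> ?J" for t y z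
      using lipX[OF that \<pi>r \<pi>r, of y z] \<pi>l[of y z] a(2) by (metis dist_norm mult_left_mono order_trans)
  qed
  then obtain u where u: "\<And>x. u x 0 = x" "\<And>x t. t \<in> ?J \<Longrightarrow> (u x has_vector_derivative X (t, \<pi> (u x t))) (at t)"
    by metis
  define \<phi> where "\<phi> p = u (snd p) (fst p)" for p
  have small: "norm (\<phi> (t, x)) \<le> 4/3 * norm x" if t: "t \<in> ?J" for t x
  proof -
    have "norm (u x t) \<le> 4/3 * (norm (u x 0) + \<bar>t\<bar> * 0)"
    proof (rule gronwall_short(1)[where L = L and e' = "\<lambda>t. X (t, \<pi> (u x t))"])
      show "\<bar>t\<bar> * L \<le> 1/4" using mult_right_mono[of "\<bar>t\<bar>" a L] t a unfolding greaterThanLessThan_iff by linarith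
      fix s assume "s \<in> {-\<bar>t\<bar>..\<bar>t\<bar>}"
      then have s: "s \<in> ?J" using t by auto
      show "(u x has_vector_derivative X (s, \<pi> (u x s))) (at s within {-\<bar>t\<bar>..\<bar>t\<bar>})"
        using u(2)[OF s] has_vector_derivative_at_within by blast
      have "norm (X (s, \<pi> (u x s)) - X (s, 0)) \<le> L * norm (\<pi> (u x s) - 0)" using s r \<pi>r by (intro lipX) auto
      also have "\<dots> \<le> L * norm (u x s)"
        using \<pi>l[of "u x s" 0] \<pi>i[of 0] r a(2) by (intro mult_left_mono) auto
      finally show "norm (X (s, \<pi> (u x s))) \<le> L * norm (u x s) + 0" using X0[OF s] by simp
    qed (use a in auto)
    then show ?thesis by (simp add: \<phi>_def u(1))
  qed
  have in34: "norm (\<phi> (t, x)) \<le> 3/4 * r" "\<phi> (t, x) \<in> ball 0 r" if "t \<in> ?J" "x \<in> ?B" for t x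
    using small[OF that(1), of x] that(2) r by auto
  have d\<phi>: "((\<lambda>t. \<phi> (t, x)) has_vector_derivative X (t, \<phi> (t, x))) (at t)" if "t \<in> ?J" "x \<in> ?B" for t x
    using u(2)[OF that(1), of x] \<pi>i[OF in34(1)[OF that]] by (simp add: \<phi>_def)
  define A where "A p k = DX (fst p, \<phi> p) (0, k)" for p k
  have linA: "linear (A p)" if "p \<in> P" for p
  proof -
    have "linear (DX (fst p, \<phi> p) \<circ> (\<lambda>k. (0, k)))"
      using that in34(2) by (intro linear_compose linDX) (auto simp: P_def linear_iff)
    moreover have "A p = DX (fst p, \<phi> p) \<circ> (\<lambda>k. (0, k))" by (auto simp: A_def)
    ultimately show ?thesis by simp
  qed
  have boundA: "norm (A p k) \<le> L * norm k" if "p \<in> P" for p k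
    using that dX in34(2) by (auto simp: A_def DX_def P_def)
  have grow: "norm (x - y) / 2 \<le> norm (\<phi> (t, x) - \<phi> (t, y))" "norm (\<phi> (t, x) - \<phi> (t, y)) \<le> 4/3 * norm (x - y)"
    if t: "t \<in> ?J" and x: "x \<in> ?B" and y: "y \<in> ?B" for t x y
  proof -
    have tL: "\<bar>t\<bar> * L \<le> 1/4" using mult_right_mono[of "\<bar>t\<bar>" a L] t a unfolding greaterThanLessThan_iff by linarith
    have I: "s \<in> ?J" if "s \<in> {-\<bar>t\<bar>..\<bar>t\<bar>}" for s using that t by auto
    have der: "((\<lambda>t. \<phi> (t, x) - \<phi> (t, y)) has_vector_derivative X (s, \<phi> (s, x)) - X (s, \<phi> (s, y))) (at s within {-\<bar>t\<bar>..\<bar>t\<bar>})"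
      if "s \<in> {-\<bar>t\<bar>..\<bar>t\<bar>}" for s
      by (intro has_vector_derivative_diff has_vector_derivative_at_within[OF d\<phi>] I that x y)
    have bd: "norm (X (s, \<phi> (s, x)) - X (s, \<phi> (s, y))) \<le> L * norm (\<phi> (s, x) - \<phi> (s, y)) + 0" if "s \<in> {-\<bar>t\<bar>..\<bar>t\<bar>}" for s
      using lipX[OF I[OF that] in34(2)[OF I[OF that] x] in34(2)[OF I[OF that] y]] by simp
    have tt: "t \<in> {-\<bar>t\<bar>..\<bar>t\<bar>}" by auto
    note G = gronwall_short[of "\<bar>t\<bar>" L 0 "\<lambda>t. \<phi> (t, x) - \<phi> (t, y)", OF abs_ge_zero a(2) tL order_refl der bd tt]
    have z: "\<phi> (0, x) - \<phi> (0, y) = x - y" by (simp add: \<phi>_def u(1))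
    show "norm (\<phi> (t, x) - \<phi> (t, y)) \<le> 4/3 * norm (x - y)" using G(1) by (simp add: z)
    \<comment> \<open>The difference of two solutions drifts by at most 1/4 * 4/3 = 1/3 of its
      initial size, which leaves two thirds; one half is kept.\<close>
    have "norm ((\<phi> (t, x) - \<phi> (t, y)) - (x - y)) \<le> (\<bar>t\<bar> * L) * (4/3 * norm (x - y))" using G(2) by (simp add: z mult.assoc)
    also have "\<dots> \<le> 1/4 * (4/3 * norm (x - y))" by (rule mult_right_mono[OF tL]) simp
    finally have "norm ((\<phi> (t, x) - \<phi> (t, y)) - (x - y)) \<le> norm (x - y) / 3" by simp
    moreover have "norm (x - y) \<le> norm (\<phi> (t, x) - \<phi> (t, y)) + norm ((\<phi> (t, x) - \<phi> (t, y)) - (x - y))"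
      by (metis norm_minus_commute norm_triangle_sub)
    ultimately show "norm (x - y) / 2 \<le> norm (\<phi> (t, x) - \<phi> (t, y))" using norm_ge_zero[of "x - y"] by linarith
  qed
  have cont\<phi>: "Ck_on 0 P \<phi>"
  proof -
    have "isCont \<phi> (t, x)" if t: "t \<in> ?J" and x: "x \<in> ?B" for t x
    proof (rule continuous_at_param)
      show "isCont (\<lambda>t. \<phi> (t, x)) t" using d\<phi>[OF t x] has_vector_derivative_continuous by blast
      fix e :: real assume e: "e > 0"
      obtain d1 where d1: "d1 > 0" "ball t d1 \<subseteq> ?J" using t open_contains_ball open_greaterThanLessThan by blast
      obtain d2 where d2: "d2 > 0" "ball x d2 \<subseteq> ?B" using x open_contains_ball open_ball by blast
      show "\<exists>d>0. \<forall>x' s. dist x' x < d \<longrightarrow> dist s t < d \<longrightarrow> dist (\<phi> (s, x')) (\<phi> (s, x)) \<le> e"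
      proof (intro exI[of _ "min (min d1 d2) (e/2)"] conjI allI impI)
        fix x' s assume *: "dist x' x < min (min d1 d2) (e/2)" "dist s t < min (min d1 d2) (e/2)"
        have "s \<in> ball t d1" "x' \<in> ball x d2" using * by (auto simp: dist_commute)
        then have "s \<in> ?J" "x' \<in> ?B" using d1 d2 by blast+
        from grow(2)[OF this x] show "dist (\<phi> (s, x')) (\<phi> (s, x)) \<le> e" using * e by (simp add: dist_norm)
      qed (use d1 d2 e in auto)
    qed
    then show ?thesis by (auto simp: P_def intro!: continuous_at_imp_continuous_on)
  qed
  have Ak: "Ck_on k P (\<lambda>p. A p w)" if k: "Ck_on k P \<phi>" for k w
    unfolding A_def
  proof (rule Ck_on_compose[OF oP smooth_open[OF X], where g = "\<lambda>q. DX q (0, w)" and f = "\<lambda>p. (fst p, \<phi> p)"])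
    show "Ck_on k P (\<lambda>p. (fst p, \<phi> p))" by (intro Ck_on_Pair oP k Ck_on_bounded_linear bounded_linear_fst)
    show "Ck_on k (?J \<times> ball 0 r) (\<lambda>q. DX q (0, w))" using smooth_frechet[OF X] by (auto simp: DX_def smooth_def)
  qed (use in34(2) in \<open>auto simp: P_def\<close>)
  have "\<exists>w. w 0 = v \<and> (\<forall>t\<in>?J. (w has_vector_derivative A (t, x) (w t)) (at t))" if x: "x \<in> ?B" for v x
  proof (rule ode_exists[OF a])
    have pP: "(t, x) \<in> P" if "t \<in> ?J" for t using that x by (simp add: P_def)
    have sl: "continuous_on (?J \<times> (UNIV :: 'e set)) (\<lambda>q. (fst q, x))" by (intro continuous_intros)
    have im: "(\<lambda>q. (fst q, x)) ` (?J \<times> (UNIV :: 'e set)) \<subseteq> P" using pP by auto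
    have "continuous_on (?J \<times> UNIV) (\<lambda>q. A (fst q, x) (snd q))"
      by (rule linear_family_continuous_on[where A = "\<lambda>q. A (fst q, x)"])
        (use linA im in blast, rule continuous_on_compose2[OF Ck_on_imp_continuous_on[OF Ak[OF cont\<phi>]] sl im],
         intro continuous_intros)
    then show "continuous_on (?J \<times> UNIV) (\<lambda>(t, w). A (t, x) w)" by (simp add: case_prod_unfold)
    show "norm (A (t, x) w - A (t, x) z) \<le> L * norm (w - z)" if "t \<in> ?J" for t w z
      using boundA[OF pP[OF that], of "w - z"] linear_diff[OF linA[OF pP[OF that]]] by simp
  qed
  note exw = this
  define w' where "w' v x = (SOME w. w 0 = v \<and> (\<forall>t\<in>?J. (w has_vector_derivative A (t, x) (w t)) (at t)))" for v x
  have w': "w' v x 0 = v"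
     "t \<in> ?J \<Longrightarrow> (w' v x has_vector_derivative A (t, x) (w' v x t)) (at t)" if "x \<in> ?B" for v x t
    using someI_ex[OF exw[OF that, of v]] unfolding w'_def by blast+
  define w where "w v p = w' v (snd p) (fst p)" for v p
  \<comment> \<open>The initial point enters as a parameter on which the right-hand side is
    constant; it acts through the initial value only.\<close>
  define F where "F = (\<lambda>(t::real, x::'e, y). X (t, y))"
  define D where "D = ?J \<times> (UNIV :: 'e set) \<times> ball (0::'e) r"
  have oD: "open D" by (simp add: D_def open_Times)
  define \<sigma> :: "real \<times> 'e \<times> 'e \<Rightarrow> real \<times> 'e" where "\<sigma> q = (fst q, snd (snd q))" for q
  have bl\<sigma>: "bounded_linear \<sigma>" unfolding \<sigma>_def
    by (intro bounded_linear_Pair bounded_linear_fst bounded_linear_compose[OF bounded_linear_snd bounded_linear_snd])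
  have Feq: "F = (\<lambda>q. X (\<sigma> q))" by (auto simp: F_def \<sigma>_def)
  have C1: "Ck_on (Suc 0) D F" unfolding Feq
    by (rule Ck_on_compose[OF oD smooth_open[OF X] _ Ck_on_bounded_linear[OF bl\<sigma> oD] smooth_C1[OF X]])
      (auto simp: D_def \<sigma>_def)
  have DF: "frechet_derivative F (at (t, x, y)) (q, v, k) = DX (t, y) (q, k)" if "t \<in> ?J" "y \<in> ball 0 r" for t x y q v k
  proof -
    have "(F has_derivative (\<lambda>h. DX (t, y) (\<sigma> h))) (at (t, x, y))" unfolding Feq
      by (rule has_derivative_compose[OF bounded_linear_imp_has_derivative[OF bl\<sigma>]]) (simp add: \<sigma>_def hX[OF that])
    from frechet_derivative_at[OF this, symmetric] show ?thesis by (simp add: \<sigma>_def)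
  qed
  have d: "(\<phi> has_derivative (\<lambda>(q, v). q *\<^sub>R F (t, x, \<phi> (t, x)) + w v (t, x))) (at (t, x))" if t: "t \<in> ?J" and x: "x \<in> ?B" for t x
  proof (rule ode_param_differentiable[OF oD C1 open_ball a, where c = "\<lambda>v. v"])
    show "(t, x, \<phi> (t, x)) \<in> D \<and> ((\<lambda>t. \<phi> (t, x)) has_vector_derivative F (t, x, \<phi> (t, x))) (at t)"
      if "t \<in> ?J" "x \<in> ?B" for t x
      using d\<phi>[OF that] that in34(2)[OF that] by (auto simp: D_def F_def)
    show "norm (F (t, x, y) - F (t, x, z)) \<le> L * norm (y - z)" if "(t, x, y) \<in> D" "(t, x, z) \<in> D" for t x y z
      using lipX[of t y z] that by (simp add: F_def D_def)
    show "norm (frechet_derivative F (at p) (0, 0, k)) \<le> L * norm k" if "p \<in> D" for p k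
      using that DF dX by (auto simp: D_def DX_def)
    show "((\<lambda>t. w v (t, x)) has_vector_derivative frechet_derivative F (at (t, x, \<phi> (t, x))) (0, v, w v (t, x))) (at t)"
      if "t \<in> ?J" "x \<in> ?B" for v t x
      using w'(2)[OF that(2,1), of v] DF[OF that(1) in34(2)[OF that]] by (simp add: w_def A_def)
    show "w v (0, x) = v" if "x \<in> ?B" for v x using w'(1)[OF that] by (simp add: w_def)
  qed (use t x in \<open>auto simp: \<phi>_def u(1) linear_iff\<close>)
  have Ck: "Ck_on k P \<phi>" for k
  proof (induction k)
    case 0 show ?case by (rule cont\<phi>)
  next
    case (Suc k)
    have wk: "Ck_on k P (w v)" for v unfolding P_def
    proof (rule linear_ode_Ck[OF open_ball a, where A = A and b = "\<lambda>_. 0" and c = v])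
      show "((\<lambda>t. w v (t, x)) has_vector_derivative A (t, x) (w v (t, x)) + 0) (at t)" if "t \<in> ?J" "x \<in> ?B" for t x
        using w'(2)[OF that(2,1), of v] by (simp add: w_def)
      show "w v (0, x) = v" if "x \<in> ?B" for x using w'(1)[OF that] by (simp add: w_def)
    qed (fold P_def, fact linA, fact boundA, fact Ak[OF Suc], rule Ck_on_const[OF oP])
    show ?case
    proof (rule Ck_on_SucI[OF oP])
      fix p assume "p \<in> P"
      then show "(\<phi> has_derivative (\<lambda>h. fst h *\<^sub>R X (fst p, \<phi> p) + w (snd h) p)) (at p)"
        using d by (auto simp: P_def F_def case_prod_unfold)
    next
      fix h
      have "Ck_on k P (\<lambda>p. X (fst p, \<phi> p))"
        by (rule Ck_on_compose[OF oP smooth_open[OF X] _ Ck_on_Pair[OF oP Ck_on_bounded_linear[OF bounded_linear_fst oP] Suc]])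
          (use in34(2) X in \<open>auto simp: P_def smooth_def\<close>)
      then show "Ck_on k P (\<lambda>p. fst h *\<^sub>R X (fst p, \<phi> p) + w (snd h) p)"
        by (intro Ck_on_add Ck_on_scaleR Ck_on_const oP wk)
    qed
  qed
  have D\<phi>: "frechet_derivative \<phi> (at (t, x)) (0, v) = w v (t, x)" if "t \<in> ?J" "x \<in> ?B" for t x v
    using frechet_derivative_at[OF d[OF that], symmetric] by simp
  have Dw: "((\<lambda>t. frechet_derivative \<phi> (at (t, x)) (0, v)) has_vector_derivative
        DX (t, \<phi> (t, x)) (0, frechet_derivative \<phi> (at (t, x)) (0, v))) (at t)" if "t \<in> ?J" "x \<in> ?B" for t x v
  proof (rule has_vector_derivative_transform_within_open[OF _ open_greaterThanLessThan that(1)])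
    show "((\<lambda>t. w v (t, x)) has_vector_derivative DX (t, \<phi> (t, x)) (0, frechet_derivative \<phi> (at (t, x)) (0, v))) (at t)"
      using w'(2)[OF that(2,1), of v] D\<phi>[OF that] by (simp add: w_def A_def)
  qed (use D\<phi> that in simp)
  show thesis
  proof (rule that[of \<phi>])
    show "smooth (?J \<times> ?B) \<phi>" using Ck oP by (simp add: smooth_def P_def)
    show "\<phi> (0, x) = x" for x by (simp add: \<phi>_def u(1))
    show "\<phi> (t, 0) = 0" if "t \<in> ?J" for t using small[OF that, of 0] by simp
    show "frechet_derivative \<phi> (at (0, x)) (0, v) = v" if "x \<in> ?B" for x v
      using D\<phi>[of 0 x v] w'(1)[OF that] a(1) that by (simp add: w_def)
  qed (use in34 d\<phi> Dw grow DX_def in auto)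
qed

section \<open>Gray stability\<close>

text \<open>Since \<open>f\<close> vanishes at \<open>p\<close>, the variation of \<open>g\<close>
  contributes a small factor times a term of order |q - p|, so continuity of \<open>g\<close> is
  enough. This serves where the coordinates of an unknown solution are so far only known to be
  continuous.\<close>

lemma has_derivative_scaleR_vanishing:
  fixes g :: "'a::real_normed_vector \<Rightarrow> real" and f :: "'a \<Rightarrow> 'b::real_normed_vector"
  assumes g: "isCont g p" and f: "(f has_derivative f') (at p)" "f p = 0"
  shows "((\<lambda>q. g q *\<^sub>R f q) has_derivative (\<lambda>h. g p *\<^sub>R f' h)) (at p)"
proof -
  have "((\<lambda>q. (g q - g p) *\<^sub>R f q) has_derivative (\<lambda>h. 0)) (at p)"
    unfolding has_derivative_at_alt
  proof (intro conjI allI impI)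
    fix e :: real assume e: "e > 0"
    obtain K where K: "\<And>h. norm (f' h) \<le> norm h * K" "K > 0"
      using bounded_linear.pos_bounded[OF has_derivative_bounded_linear[OF f(1)]] by blast
    obtain d1 where d1: "d1 > 0" "\<And>q. norm (q - p) < d1 \<Longrightarrow> norm (f q - f p - f' (q - p)) \<le> 1 * norm (q - p)"
      using f(1) zero_less_one unfolding has_derivative_at_alt by blast
    obtain d2 where d2: "d2 > 0" "\<And>q. dist q p < d2 \<Longrightarrow> dist (g q) (g p) < e / (1 + K)"
      using g e K(2) unfolding continuous_at_eps_delta by (metis add_pos_pos divide_pos_pos zero_less_one)
    have "norm ((g q - g p) *\<^sub>R f q) \<le> e * norm (q - p)" if q: "norm (q - p) < min d1 d2" for q
    proof -
      have "norm (f q) \<le> norm (f' (q - p)) + norm (f q - f p - f' (q - p))"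
        using norm_triangle_sub[of "f q" "f' (q - p)"] f(2) by simp
      also have "\<dots> \<le> (1 + K) * norm (q - p)" using K(1)[of "q - p"] d1(2)[of q] q by (simp add: algebra_simps)
      finally have 1: "norm (f q) \<le> (1 + K) * norm (q - p)" .
      have 2: "\<bar>g q - g p\<bar> \<le> e / (1 + K)" using d2(2)[of q] q by (simp add: dist_norm)
      have "norm ((g q - g p) *\<^sub>R f q) \<le> (e / (1 + K)) * ((1 + K) * norm (q - p))"
        unfolding norm_scaleR using 1 2 e K by (intro mult_mono) auto
      then show ?thesis using K(2) by simp
    qed
    then show "\<exists>d>0. \<forall>y. norm (y - p) < d \<longrightarrow> norm ((g y - g p) *\<^sub>R f y - (g p - g p) *\<^sub>R f p - 0) \<le> e * norm (y - p)"
      using d1 d2 by (intro exI[of _ "min d1 d2"]) auto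
  qed simp
  from has_derivative_add[OF this bounded_linear.has_derivative[OF bounded_linear_scaleR_right[of "g p"] f(1)]]
  show ?thesis by (simp add: algebra_simps)
qed

text \<open>The derivative of \<open>y\<close> in direction \<open>h\<close> again solves a system
  with the matrix \<open>B p\<close>, now with right-hand side Db(h) - DB(y)(h), so induction on the
  order applies. The uniform lower bound yields continuity of \<open>y\<close>, and
  \<open>has_derivative_scaleR_vanishing\<close> its first derivative.\<close>

lemma linear_solve_smooth:
  fixes B :: "'p::euclidean_space \<Rightarrow> 'v::euclidean_space \<Rightarrow> 'v"
  assumes P: "open P" and lin: "\<And>p. p \<in> P \<Longrightarrow> linear (B p)"
    and lower: "0 < c" "\<And>p v. p \<in> P \<Longrightarrow> c * norm v \<le> norm (B p v)"
    and B: "\<And>v. smooth P (\<lambda>p. B p v)" and b: "smooth P b" and sol: "\<And>p. p \<in> P \<Longrightarrow> B p (y p) = b p"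
  shows "smooth P y"
proof -
  have "Ck_on k P y" if "Ck_on k P b" "\<And>p. p \<in> P \<Longrightarrow> B p (y p) = b p" for k b y
    using that
  proof (induction k arbitrary: b y)
    case 0
    have "isCont y p" if p: "p \<in> P" for p
    proof -
      let ?g = "\<lambda>q. (b q - b p) - (B q (y p) - B p (y p))"
      have "isCont b p" "isCont (\<lambda>q. B q (y p)) p"
        using 0(1) smooth_continuous_on[OF B] p P by (auto simp: continuous_on_eq_continuous_at)
      then have "((\<lambda>q. b q) \<longlongrightarrow> b p) (at p)" "((\<lambda>q. B q (y p)) \<longlongrightarrow> B p (y p)) (at p)"
        by (auto simp: isCont_def)
      then have "(?g \<longlongrightarrow> (b p - b p) - (B p (y p) - B p (y p))) (at p)"
        by (intro tendsto_intros)
      then have "(?g \<longlongrightarrow> 0) (at p)" by simp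
      from tendsto_divide[OF tendsto_norm[OF this] tendsto_const[of c]]
      have "((\<lambda>q. norm (?g q) / c) \<longlongrightarrow> 0) (at p)" using lower(1) by simp
      moreover have "eventually (\<lambda>q. norm (y q - y p) \<le> norm (?g q) / c) (at p)"
      proof -
        have "eventually (\<lambda>q. q \<in> P) (at p)" using P p eventually_at_topological by blast
        then show ?thesis
        proof (rule eventually_mono)
          fix q assume q: "q \<in> P"
          have "B q (y q - y p) = ?g q" using 0(2)[OF q] 0(2)[OF p] linear_diff[OF lin[OF q]] by simp
          then have "c * norm (y q - y p) \<le> norm (?g q)" using lower(2)[OF q, of "y q - y p"] by (simp only:)
          then show "norm (y q - y p) \<le> norm (?g q) / c"
            using lower(1) by (simp only: pos_le_divide_eq mult.commute[of _ c])
        qed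
      qed
      ultimately have "((\<lambda>q. y q - y p) \<longlongrightarrow> 0) (at p)" by (rule Lim_null_comparison[rotated])
      then show ?thesis by (simp add: isCont_def LIM_zero_iff)
    qed
    then show ?case by (simp add: continuous_at_imp_continuous_on)
  next
    case (Suc k)
    note sol = Suc.prems(2)
    have yk: "Ck_on k P y" by (rule Suc.IH[OF Ck_on_Suc_imp[OF Suc.prems(1)] sol])
    have yc: "isCont y p" if "p \<in> P" for p
      using Ck_on_imp_continuous_on[OF yk] that P by (simp add: continuous_on_eq_continuous_at)
    define DB where "DB v p = frechet_derivative (\<lambda>p. B p v) (at p)" for v p
    define Db where "Db p = frechet_derivative b (at p)" for p
    note dB = smooth_has_derivative[OF B, folded DB_def] and db = Ck_on_SucD[OF P Suc.prems(1), folded Db_def]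
    have linDB: "linear (\<lambda>w. DB w p h)" if "p \<in> P" for p h
      by (rule linear_family_derivative_linear[OF P that lin dB[OF that]])
    define J where "J p = inv (B p)" for p
    have J: "linear (J p)" "J p \<circ> B p = id" "B p (J p v) = v" if "p \<in> P" for p v
    proof -
      have i: "inj (B p)"
        unfolding linear_injective_0[OF lin[OF that]]
      proof (intro allI impI)
        fix v assume "B p v = 0"
        then have "c * norm v \<le> 0" using lower(2)[OF that, of v] by simp
        then show "v = 0" using lower(1) by (simp add: mult_le_0_iff)
      qed
      have s: "surj (B p)" using linear_injective_imp_surjective[OF lin[OF that] i] by simp
      show "linear (J p)" unfolding J_def using bij_is_inj s i lin[OF that]
        by (intro inj_linear_imp_inv_linear) auto
      show "J p \<circ> B p = id" "B p (J p v) = v" unfolding J_def using i s by (auto simp: surj_f_inv_f)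
    qed
    define Y where "Y h p = J p (Db p h - DB (y p) p h)" for h p
    have dy: "(y has_derivative (\<lambda>h. Y h p)) (at p)" if p: "p \<in> P" for p
    proof -
      \<comment> \<open>With the matrix frozen at p, B p (y q) is b q minus the sum of the y_i(q) (B
        q i - B p i). Every bracket vanishes at q = p, so the sum is differentiable there although
        \<open>y\<close> is only known to be continuous; the inverse of \<open>B p\<close> then
        gives the derivative of \<open>y\<close>.\<close>
      have "((\<lambda>q. \<Sum>i\<in>Basis. (y q \<bullet> i) *\<^sub>R (B q i - B p i)) has_derivative (\<lambda>h. \<Sum>i\<in>Basis. (y p \<bullet> i) *\<^sub>R (DB i p h - 0))) (at p)"
        by (intro has_derivative_sum has_derivative_scaleR_vanishing has_derivative_diff has_derivative_const dB p)
          (auto intro!: continuous_intros yc p)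
      from has_derivative_diff[OF db(1)[OF p] this]
      have "((\<lambda>q. b q - (\<Sum>i\<in>Basis. (y q \<bullet> i) *\<^sub>R (B q i - B p i))) has_derivative (\<lambda>h. Db p h - DB (y p) p h)) (at p)"
        using linear_Basis_expand[OF linDB[OF p], of "y p"] by simp
      then have "((\<lambda>q. B p (y q)) has_derivative (\<lambda>h. Db p h - DB (y p) p h)) (at p)"
      proof (rule has_derivative_transform_within_open[OF _ P p])
        fix q assume q: "q \<in> P"
        have "(\<Sum>i\<in>Basis. (y q \<bullet> i) *\<^sub>R (B q i - B p i)) = B q (y q) - B p (y q)"
          using linear_Basis_expand[OF lin[OF q], of "y q"] linear_Basis_expand[OF lin[OF p], of "y q"]
          by (simp add: scaleR_diff_right sum_subtractf)
        then show "b q - (\<Sum>i\<in>Basis. (y q \<bullet> i) *\<^sub>R (B q i - B p i)) = B p (y q)" using sol[OF q] by simp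
      qed
      from bounded_linear.has_derivative[OF linear_conv_bounded_linear[THEN iffD1, OF J(1)[OF p]] this]
      show ?thesis unfolding Y_def using pointfree_idE[OF J(2)[OF p]] by simp
    qed
    show ?case
    proof (rule Ck_on_SucI[OF P dy])
      fix h
      show "Ck_on k P (Y h)"
      proof (rule Suc.IH)
        have DBk: "Ck_on k P (\<lambda>p. DB v p h)" for v
          using smooth_frechet[OF B, of v h] unfolding DB_def smooth_def by blast
        show "Ck_on k P (\<lambda>p. Db p h - DB (y p) p h)"
          by (rule Ck_on_diff[OF P db(2) linear_family_Ck[where A = "\<lambda>p v. DB v p h", OF P linDB DBk yk]])
        show "B p (Y h p) = Db p h - DB (y p) p h" if "p \<in> P" for p
          using J(3)[OF that] by (simp add: Y_def)
      qed
    qed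
  qed
  then show ?thesis using P b sol unfolding smooth_def by blast
qed

text \<open>Continuity for each fixed vector becomes uniform over unit vectors because finitely many
  basis vectors control the operator norm.\<close>

lemma linear_family_close:
  fixes A :: "'p::real_normed_vector \<Rightarrow> 'a::euclidean_space \<Rightarrow> 'b::real_normed_vector"
  assumes U: "open U" "0 \<in> U" and lin: "\<And>p. p \<in> U \<Longrightarrow> linear (A p)"
    and c: "\<And>v. continuous_on U (\<lambda>p. A p v)" and e: "e > 0"
  shows "\<exists>d>0. ball 0 d \<subseteq> U \<and> (\<forall>p\<in>ball 0 d. \<forall>v. norm (A p v - A 0 v) \<le> e * norm v)"
proof -
  let ?N = "\<lambda>p. \<Sum>i\<in>Basis. norm (A p i - A 0 i)"
  have "continuous_on U ?N" using c by (intro continuous_intros)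
  then have "open (U \<inter> ?N -` {..<e})" using U by (intro continuous_open_preimage) auto
  moreover have "0 \<in> U \<inter> ?N -` {..<e}" using U e by simp
  ultimately obtain d where d: "d > 0" "ball 0 d \<subseteq> U \<inter> ?N -` {..<e}" using open_contains_ball by blast
  have "norm (A p v - A 0 v) \<le> e * norm v" if "p \<in> ball 0 d" for p v
  proof -
    have p: "p \<in> U" "?N p < e" using d(2) that by auto
    have "norm (A p v - A 0 v) \<le> ?N p * norm v"
      using norm_linear_le_sum_Basis[OF linear_compose_sub[OF lin[OF p(1)] lin[OF U(2)]]] .
    also have "\<dots> \<le> e * norm v" using p(2) by (intro mult_right_mono) auto
    finally show ?thesis .
  qed
  then show ?thesis using d by blast
qed

text \<open>With an antiderivative M of \<open>m\<close>, the product f exp(-M) is constant, so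
  vanishing propagates in both directions.\<close>

lemma scalar_linear_ode_zero_iff:
  fixes f m :: "real \<Rightarrow> real"
  assumes "continuous_on {0..s} m" "0 \<le> s"
    and f: "\<And>t. t \<in> {0..s} \<Longrightarrow> (f has_real_derivative m t * f t) (at t within {0..s})"
  shows "f s = 0 \<longleftrightarrow> f 0 = 0"
proof -
  obtain M where M: "\<And>t. t \<in> {0..s} \<Longrightarrow> (M has_real_derivative m t) (at t within {0..s})"
    using antiderivative_continuous[OF assms(1)] unfolding has_real_derivative_iff_has_vector_derivative by metis
  have "((\<lambda>t. f t * exp (- M t)) has_derivative (\<lambda>h. 0)) (at t within {0..s})" if "t \<in> {0..s}" for t
  proof -
    have "((\<lambda>t. f t * exp (- M t)) has_real_derivative 0) (at t within {0..s})"
      using f[OF that] M[OF that] by (auto intro!: derivative_eq_intros simp: algebra_simps)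
    then show ?thesis by (simp add: has_field_derivative_def lambda_zero)
  qed
  then have "f s * exp (- M s) = f 0 * exp (- M 0)"
    by (rule has_derivative_zero_unique[where s = "{0..s}", rotated]) (use assms(2) in auto)
  then show ?thesis by (metis exp_not_eq_zero mult_eq_0_iff)
qed

text \<open>If D v = 0, then f(x + t v) - f x is o(t), against the lower bound c t |v|.\<close>

lemma derivative_injective_of_lower_bound:
  assumes f: "(f has_derivative D) (at x)" and U: "open U" "x \<in> U"
    and lower: "0 < c" "\<And>y. y \<in> U \<Longrightarrow> c * norm (y - x) \<le> norm (f y - f x)" and "D v = 0"
  shows "v = 0"
proof (rule ccontr)
  assume v: "v \<noteq> 0"
  obtain d1 where d1: "d1 > 0" "\<And>y. norm (y - x) < d1 \<Longrightarrow> norm (f y - f x - D (y - x)) \<le> (c/2) * norm (y - x)"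
    using f lower(1) unfolding has_derivative_at_alt by (metis half_gt_zero)
  obtain d2 where d2: "d2 > 0" "ball x d2 \<subseteq> U" using U open_contains_ball by blast
  define t where "t = min d1 d2 / (2 * norm v)"
  have t: "t > 0" "norm (t *\<^sub>R v) < d1" "norm (t *\<^sub>R v) < d2" using d1(1) d2(1) v by (auto simp: t_def)
  have "D (t *\<^sub>R v) = 0" using \<open>D v = 0\<close> has_derivative_linear[OF f] by (simp add: linear_scale)
  then have "norm (f (x + t *\<^sub>R v) - f x) \<le> (c/2) * norm (t *\<^sub>R v)" using d1(2)[of "x + t *\<^sub>R v"] t by simp
  moreover have "x + t *\<^sub>R v \<in> U" using d2(2) t(3) by (auto simp: dist_norm)
  then have "c * norm (t *\<^sub>R v) \<le> norm (f (x + t *\<^sub>R v) - f x)" using lower(2)[of "x + t *\<^sub>R v"] by simp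
  ultimately have "c * norm (t *\<^sub>R v) \<le> (c/2) * norm (t *\<^sub>R v)" by simp
  then show False using lower(1) t(1) v by simp
qed

section \<open>One-forms on open sets and the bordered matrix\<close>

definition form_family :: "'v::euclidean_space set \<Rightarrow> ('v \<Rightarrow> 'v \<Rightarrow> real) \<Rightarrow> bool" where
  "form_family U \<eta> \<longleftrightarrow> (\<forall>x\<in>U. linear (\<eta> x)) \<and> (\<forall>v. smooth U (\<lambda>x. \<eta> x v))"

text \<open>The matrix of \<open>d \<eta>\<close>, bordered by \<open>\<eta>\<close>; it is invertible exactly where \<open>\<eta>\<close> is a
  contact form.\<close>

definition bordered :: "('v::euclidean_space \<Rightarrow> 'v \<Rightarrow> real) \<Rightarrow> 'v \<Rightarrow> 'v \<times> real \<Rightarrow> 'v \<times> real" where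
  "bordered \<eta> x \<xi> = (\<Sum>i\<in>Basis. (ext_deriv \<eta> x (fst \<xi>) i + snd \<xi> * \<eta> x i) *\<^sub>R i, \<eta> x (fst \<xi>))"

lemma form_family_derivative:
  assumes "form_family U \<eta>" "x \<in> U"
  shows "((\<lambda>z. \<eta> z v) has_derivative frechet_derivative (\<lambda>z. \<eta> z v) (at x)) (at x)"
    and "linear (\<lambda>h. frechet_derivative (\<lambda>z. \<eta> z v) (at x) h)"
    and "linear (\<lambda>v. frechet_derivative (\<lambda>z. \<eta> z v) (at x) h)"
proof -
  have U: "open U" using assms unfolding form_family_def smooth_def by blast
  show 1: "((\<lambda>z. \<eta> z v) has_derivative frechet_derivative (\<lambda>z. \<eta> z v) (at x)) (at x)" for v
    using assms smooth_has_derivative unfolding form_family_def by blast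
  show "linear (\<lambda>h. frechet_derivative (\<lambda>z. \<eta> z v) (at x) h)" using has_derivative_linear[OF 1] .
  show "linear (\<lambda>v. frechet_derivative (\<lambda>z. \<eta> z v) (at x) h)"
    by (rule linear_family_derivative_linear[OF U assms(2) _ 1]) (use assms(1) in \<open>auto simp: form_family_def\<close>)
qed

lemma form_family_ext_deriv_linear:
  assumes "form_family U \<eta>" "x \<in> U"
  shows "linear (\<lambda>u. ext_deriv \<eta> x u v)" "linear (\<lambda>v. ext_deriv \<eta> x u v)"
  unfolding ext_deriv_def by (intro linear_compose_sub form_family_derivative[OF assms])+

lemma bordered_linear:
  assumes "form_family U \<eta>" "x \<in> U" shows "linear (bordered \<eta> x)"
proof -
  note l = form_family_ext_deriv_linear(1)[OF assms]
  have "linear (\<eta> x)" using assms by (simp add: form_family_def)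
  then show ?thesis
    by (intro linearI) (auto simp: bordered_def linear_add[OF l] linear_add linear_scale[OF l] linear_scale
      sum.distrib scaleR_sum_right algebra_simps)
qed

lemma bordered_smooth:
  assumes "form_family U \<eta>" shows "smooth U (\<lambda>x. bordered \<eta> x \<xi>)"
proof -
  have U: "open U" and s: "\<And>v. smooth U (\<lambda>x. \<eta> x v)" using assms unfolding form_family_def smooth_def by blast+
  show ?thesis unfolding bordered_def ext_deriv_def
    by (intro smooth_Pair smooth_sum smooth_scaleR smooth_add smooth_diff smooth_mult smooth_const U s smooth_frechet)
qed

text \<open>The basis sum in \<open>bordered\<close> stores a covector as a vector; the inner
  product with \<open>w\<close> evaluates it.\<close>

lemma bordered_fst:
  assumes "form_family U \<eta>" "x \<in> U"
  shows "fst (bordered \<eta> x \<xi>) \<bullet> w = ext_deriv \<eta> x (fst \<xi>) w + snd \<xi> * \<eta> x w"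
proof -
  have l: "linear (\<lambda>w. ext_deriv \<eta> x (fst \<xi>) w + snd \<xi> * \<eta> x w)"
    using assms form_family_ext_deriv_linear(2)[OF assms] 
    by (intro linear_compose_add linear_compose[of "\<eta> x" "\<lambda>r. snd \<xi> * r", unfolded o_def])
      (auto simp: form_family_def linear_iff algebra_simps)
  show ?thesis
    using linear_Basis_expand[OF l, of w] by (simp add: bordered_def inner_sum_left inner_sum_right inner_commute mult.commute)
qed

text \<open>Moser's method. With a_t = \<beta> + t \<gamma>, a field X_t in the kernel of a_t is
  sought with d a_t(X_t, .) + \<mu> a_t = - \<gamma>. Along its flow the pullback of a_t satisfies a
  scalar linear equation with factor - \<mu>, so its kernel is constant in time. The unknowns (X,
  \<mu>) solve a system with the bordered matrix of a_t. As \<gamma> vanishes at 0, the point 0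
  rests and the flow reaches time one on a small ball; together with d \<gamma> = 0 at 0 this makes
  \<open>bordered \<gamma>\<close> vanish there, which keeps the system invertible near 0 for all
  times in question.\<close>

theorem gray_stability:
  fixes \<beta> \<gamma> :: "'v::euclidean_space \<Rightarrow> 'v \<Rightarrow> real"
  assumes r0: "0 < r0" and \<beta>: "form_family (ball 0 r0) \<beta>" and \<gamma>: "form_family (ball 0 r0) \<gamma>"
    and nz: "\<exists>v. \<beta> 0 v \<noteq> 0"
    and nd: "\<And>u. \<beta> 0 u = 0 \<Longrightarrow> (\<And>v. \<beta> 0 v = 0 \<Longrightarrow> ext_deriv \<beta> 0 u v = 0) \<Longrightarrow> u = 0"
    and \<gamma>0: "\<And>v. \<gamma> 0 v = 0" and d\<gamma>0: "\<And>u v. ext_deriv \<gamma> 0 u v = 0"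
  obtains F r where "0 < r" "smooth (ball 0 r) F" "F ` ball 0 r \<subseteq> ball 0 r0" "inj_on F (ball 0 r)"
    "\<And>x v. x \<in> ball 0 r \<Longrightarrow> frechet_derivative F (at x) v = 0 \<Longrightarrow> v = 0"
    "\<And>x v. x \<in> ball 0 r \<Longrightarrow> \<beta> x v = 0 \<longleftrightarrow>
       \<beta> (F x) (frechet_derivative F (at x) v) + \<gamma> (F x) (frechet_derivative F (at x) v) = 0"
proof -
  have z0: "0 \<in> ball (0::'v) r0" using r0 by simp
  \<comment> \<open>Nondegeneracy on the kernel of \<beta> kills the vector component; a vector
    outside the kernel then kills the scalar one.\<close>
  have "inj (bordered \<beta> 0)"
    unfolding linear_injective_0[OF bordered_linear[OF \<beta> z0]]
  proof (intro allI impI)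
    fix \<xi> assume \<xi>: "bordered \<beta> 0 \<xi> = 0"
    have 1: "ext_deriv \<beta> 0 (fst \<xi>) w + snd \<xi> * \<beta> 0 w = 0" for w
      using bordered_fst[OF \<beta> z0, of \<xi> w] \<xi> by simp
    have "\<beta> 0 (fst \<xi>) = 0" using \<xi> by (simp add: bordered_def zero_prod_def)
    then have f: "fst \<xi> = 0"
    proof (rule nd)
      show "ext_deriv \<beta> 0 (fst \<xi>) v = 0" if "\<beta> 0 v = 0" for v using 1[of v] that by simp
    qed
    then have "ext_deriv \<beta> 0 (fst \<xi>) w = 0" for w
      using linear_0[OF form_family_ext_deriv_linear(1)[OF \<beta> z0]] by metis
    then have "snd \<xi> = 0" using 1 nz by auto
    with f show "\<xi> = 0" by (simp add: prod_eq_iff)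
  qed
  then obtain c where c: "c > 0" "\<And>\<xi>. c * norm \<xi> \<le> norm (bordered \<beta> 0 \<xi>)"
    using linear_inj_bounded_below_pos[OF bordered_linear[OF \<beta> z0]] by metis
  have b\<gamma>0: "bordered \<gamma> 0 \<xi> = 0" for \<xi> by (simp add: bordered_def \<gamma>0 d\<gamma>0 zero_prod_def)
  \<comment> \<open>The budgets are c/4 for \<beta> and, as |t| < 2 on \<open>P\<close>, 2 * c/8 for
    \<gamma>; they leave the lower bound c/2 for the combined matrix \<open>M\<close>.\<close>
  obtain d1 where d1: "d1 > 0" "ball 0 d1 \<subseteq> ball (0::'v) r0" "\<And>x \<xi>. x \<in> ball 0 d1 \<Longrightarrow> norm (bordered \<beta> x \<xi> - bordered \<beta> 0 \<xi>) \<le> c/4 * norm \<xi>"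
    using linear_family_close[OF open_ball z0 bordered_linear[OF \<beta>] smooth_continuous_on[OF bordered_smooth[OF \<beta>]], of "c/4"] c(1) by auto
  obtain d2 where d2: "d2 > 0" "\<And>x \<xi>. x \<in> ball 0 d2 \<Longrightarrow> norm (bordered \<gamma> x \<xi>) \<le> c/8 * norm \<xi>"
    using linear_family_close[OF open_ball z0 bordered_linear[OF \<gamma>] smooth_continuous_on[OF bordered_smooth[OF \<gamma>]], of "c/8"] c(1)
    by (auto simp: b\<gamma>0)
  define r1 where "r1 = min d1 d2"
  have r1: "0 < r1" "ball 0 r1 \<subseteq> ball (0::'v) r0" using d1 d2 by (auto simp: r1_def)
  define P where "P = {-1<..<2::real} \<times> ball (0::'v) r1"
  have oP: "open P" by (simp add: P_def open_Times)
  have Pd: "\<bar>fst p\<bar> < 2" "snd p \<in> ball 0 r1" "snd p \<in> ball 0 r0" if "p \<in> P" for p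
    using that r1(2) by (auto simp: P_def)
  define M where "M p \<xi> = bordered \<beta> (snd p) \<xi> + fst p *\<^sub>R bordered \<gamma> (snd p) \<xi>" for p \<xi>
  have linM: "linear (M p)" if "p \<in> P" for p
    unfolding M_def[abs_def] using bordered_linear[OF \<beta> Pd(3)[OF that]] bordered_linear[OF \<gamma> Pd(3)[OF that]]
    by (intro linear_compose_add linear_compose_scale_right)
  have lowerM: "c/2 * norm \<xi> \<le> norm (M p \<xi>)" if p: "p \<in> P" for p \<xi>
  proof -
    have 1: "norm (bordered \<beta> (snd p) \<xi> - bordered \<beta> 0 \<xi>) \<le> c/4 * norm \<xi>"
      using d1(3) Pd(2)[OF p] by (simp add: r1_def)
    have "norm (fst p *\<^sub>R bordered \<gamma> (snd p) \<xi>) \<le> 2 * (c/8 * norm \<xi>)"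
      unfolding norm_scaleR using d2(2)[of "snd p" \<xi>] Pd(1,2)[OF p] by (intro mult_mono) (auto simp: r1_def)
    then have 2: "norm ((bordered \<beta> (snd p) \<xi> - bordered \<beta> 0 \<xi>) + fst p *\<^sub>R bordered \<gamma> (snd p) \<xi>) \<le> c/2 * norm \<xi>"
      using norm_triangle_mono[OF 1] by (fastforce simp: field_simps)
    have "M p \<xi> = bordered \<beta> 0 \<xi> + ((bordered \<beta> (snd p) \<xi> - bordered \<beta> 0 \<xi>) + fst p *\<^sub>R bordered \<gamma> (snd p) \<xi>)"
      by (simp add: M_def)
    then have "norm (bordered \<beta> 0 \<xi>) \<le> norm (M p \<xi>) + norm ((bordered \<beta> (snd p) \<xi> - bordered \<beta> 0 \<xi>) + fst p *\<^sub>R bordered \<gamma> (snd p) \<xi>)"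
      by (metis add_diff_cancel_right' norm_triangle_ineq4)
    then show ?thesis using 2 c(2)[of \<xi>] by simp
  qed
  have smooth_fst': "smooth P fst" and smooth_snd': "smooth P snd"
    using oP by (auto intro: smooth_bounded_linear bounded_linear_fst bounded_linear_snd)
  have via_snd: "smooth P (\<lambda>p. g (snd p))" if "smooth (ball 0 r0) g" for g :: "'v \<Rightarrow> 'w::real_normed_vector"
    by (rule smooth_compose[OF that smooth_snd']) (use Pd in auto)
  have smM: "smooth P (\<lambda>p. M p \<xi>)" for \<xi> unfolding M_def
    by (intro smooth_add smooth_scaleR smooth_fst' via_snd bordered_smooth \<beta> \<gamma>)
  \<comment> \<open>The second component 0 asks for X in the kernel of a_t, the first one for d
    a_t(X, .) + \<mu> a_t = - \<gamma>.\<close>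
  define rhs :: "real \<times> 'v \<Rightarrow> 'v \<times> real" where "rhs p = (\<Sum>i\<in>Basis. (- \<gamma> (snd p) i) *\<^sub>R i, 0)" for p
  have sm_\<beta>: "smooth (ball 0 r0) (\<lambda>x. \<beta> x v)" and sm_\<gamma>: "smooth (ball 0 r0) (\<lambda>x. \<gamma> x v)" for v
    using \<beta> \<gamma> by (auto simp: form_family_def)
  have lin_\<beta>: "linear (\<beta> x)" and lin_\<gamma>: "linear (\<gamma> x)" if "x \<in> ball 0 r0" for x
    using \<beta> \<gamma> that by (auto simp: form_family_def)
  have smr: "smooth P rhs" unfolding rhs_def
    by (intro smooth_Pair smooth_sum smooth_scaleR smooth_minus smooth_const oP via_snd sm_\<gamma>)
  have injM: "inj (M p)" if "p \<in> P" for p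
    unfolding linear_injective_0[OF linM[OF that]]
  proof (intro allI impI)
    fix v assume "M p v = 0"
    then have "c/2 * norm v \<le> 0" using lowerM[OF that, of v] by simp
    then show "v = 0" using c(1) by (simp add: mult_le_0_iff)
  qed
  define \<zeta> where "\<zeta> p = (SOME \<xi>. M p \<xi> = rhs p)" for p
  have \<zeta>: "M p (\<zeta> p) = rhs p" if "p \<in> P" for p
  proof -
    have "surj (M p)" using linear_injective_imp_surjective[OF linM[OF that] injM[OF that]] by simp
    then have "rhs p \<in> range (M p)" by simp
    then have "\<exists>\<xi>. M p \<xi> = rhs p" by (metis imageE)
    then show ?thesis unfolding \<zeta>_def by (rule someI_ex)
  qed
  have sm\<zeta>: "smooth P \<zeta>"
    by (rule linear_solve_smooth[OF oP linM _ lowerM smM smr \<zeta>]) (use c(1) in auto)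
  define X where "X p = fst (\<zeta> p)" for p
  define \<mu> where "\<mu> p = snd (\<zeta> p)" for p
  have smX: "smooth P X" and sm\<mu>: "smooth P \<mu>"
    unfolding X_def \<mu>_def using sm\<zeta> by (auto intro: smooth_linear_comp bounded_linear_fst bounded_linear_snd)
  define \<alpha> where "\<alpha> t x v = \<beta> x v + t * \<gamma> x v" for t x v
  have X1: "\<alpha> t x (X (t, x)) = 0" if "(t, x) \<in> P" for t x
    using arg_cong[OF \<zeta>[OF that], of snd] by (simp add: M_def bordered_def rhs_def \<alpha>_def X_def)
  have X2: "ext_deriv \<beta> x (X (t, x)) w + t * ext_deriv \<gamma> x (X (t, x)) w + \<mu> (t, x) * \<alpha> t x w = - \<gamma> x w" if p: "(t, x) \<in> P" for t x w
  proof -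
    have x: "x \<in> ball 0 r0" using Pd(3)[OF p] by simp
    have "fst (M (t, x) (\<zeta> (t, x))) \<bullet> w = fst (rhs (t, x)) \<bullet> w" using \<zeta>[OF p] by simp
    moreover have "fst (rhs (t, x)) \<bullet> w = - \<gamma> x w"
      using linear_Basis_expand[OF lin_\<gamma>[OF x], of w]
      by (simp add: rhs_def inner_sum_left inner_sum_right inner_commute sum_negf mult.commute)
    moreover have "fst (M (t, x) (\<zeta> (t, x))) \<bullet> w = ext_deriv \<beta> x (X (t, x)) w + \<mu> (t, x) * \<beta> x w + t * (ext_deriv \<gamma> x (X (t, x)) w + \<mu> (t, x) * \<gamma> x w)"
      by (simp add: M_def inner_add_left bordered_fst[OF \<beta> x] bordered_fst[OF \<gamma> x] X_def \<mu>_def)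
    ultimately show ?thesis by (simp add: \<alpha>_def algebra_simps)
  qed
  have X0: "X (t, 0) = 0" if "(t, 0) \<in> P" for t
  proof -
    have "M (t, 0) (\<zeta> (t, 0)) = 0" using \<zeta>[OF that] by (simp add: rhs_def \<gamma>0 zero_prod_def)
    then have "\<zeta> (t, 0) = 0" using injM[OF that] linM[OF that] linear_injective_0 by blast
    then show ?thesis by (simp add: X_def)
  qed
  \<comment> \<open>Compact inside \<open>P\<close>, and large enough for every time window of
    half-width a <= 1/2 around a point of [0, 1].\<close>
  define K where "K = {-1/2..3/2::real} \<times> cball (0::'v) (r1/2)"
  have K: "compact K" "K \<subseteq> P" using r1 by (auto simp: K_def P_def intro!: compact_Times)
  obtain L where L: "L \<ge> 0" "\<And>p h. p \<in> K \<Longrightarrow> norm (frechet_derivative X (at p) h) \<le> L * norm h"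
    using C1_derivative_bounded[OF oP smooth_C1[OF smX] K] by blast
  \<comment> \<open>The number of steps, each of length h = 1/N. The flow is constructed for times
    of modulus below a = 2 h, so that h is an interior time; N > 4 gives a <= 1/2, and N > 8 L gives
    a L <= 1/4.\<close>
  obtain N :: nat where N: "real N > max 4 (8 * L)" using reals_Archimedean2 by blast
  define h where "h = 1 / real N"
  define a where "a = 2 * h"
  have h: "0 < h" "h < a" "a \<le> 1/2" "a * L \<le> 1/4" "real N * h = 1" using N by (auto simp: h_def a_def field_simps)
  \<comment> \<open>\<open>flow_smooth\<close> is applied to the ball of radius r1/2 and accepts
    initial points in half of it.\<close>
  define r2 where "r2 = r1 / 4"
  have step: "\<exists>\<psi>. smooth (ball 0 r2) \<psi> \<and> \<psi> 0 = 0 \<and> \<psi> ` ball 0 r2 \<subseteq> ball 0 r1 \<and> inj_on \<psi> (ball 0 r2) \<and>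
     (\<forall>x\<in>ball 0 r2. \<forall>v. frechet_derivative \<psi> (at x) v = 0 \<longrightarrow> v = 0) \<and>
     (\<forall>x\<in>ball 0 r2. \<forall>v. \<alpha> t0 x v = 0 \<longleftrightarrow> \<alpha> (t0 + h) (\<psi> x) (frechet_derivative \<psi> (at x) v) = 0)"
    if t0: "t0 \<in> {0..1}" for t0
  proof -
    let ?J = "{-a<..<a}" and ?B = "ball (0::'v) (r1/2)" and ?C = "ball (0::'v) r2"
    define sh :: "real \<times> 'v \<Rightarrow> real \<times> 'v" where "sh p = (t0, 0) + p" for p
    have shK: "sh (s, x) \<in> K" if "s \<in> ?J" "x \<in> ?B" for s x
      using that t0 h(3) by (auto simp: sh_def K_def)
    have dsh: "(sh has_derivative (\<lambda>k. k)) (at p)" for p unfolding sh_def by (auto intro!: derivative_eq_intros)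
    have sm_sh: "smooth (?J \<times> ?B) sh" unfolding sh_def
      by (intro smooth_add smooth_const smooth_bounded_linear bounded_linear_ident) (auto intro: open_Times)
    define X' where "X' p = X (sh p)" for p
    have smX': "smooth (?J \<times> ?B) X'" unfolding X'_def
      by (rule smooth_compose[OF smX sm_sh]) (use shK K in auto)
    have DX': "frechet_derivative X' (at (s, x)) = frechet_derivative X (at (sh (s, x)))" if "s \<in> ?J" "x \<in> ?B" for s x
    proof -
      have "(X has_derivative frechet_derivative X (at (sh (s, x)))) (at (sh (s, x)))"
        using smooth_has_derivative[OF smX] shK[OF that] K by blast
      from has_derivative_compose[OF dsh this] show ?thesis
        unfolding X'_def by (rule frechet_derivative_at[symmetric])
    qed
    obtain \<phi> where \<phi>: "smooth (?J \<times> ball 0 (r1/2/2)) \<phi>"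
      "\<And>t x. t \<in> ?J \<Longrightarrow> x \<in> ball 0 (r1/2/2) \<Longrightarrow> \<phi> (t, x) \<in> ball 0 (r1/2)"
      "\<And>x. x \<in> ball 0 (r1/2/2) \<Longrightarrow> \<phi> (0, x) = x"
      "\<And>t. t \<in> ?J \<Longrightarrow> \<phi> (t, 0) = 0"
      "\<And>t x. t \<in> ?J \<Longrightarrow> x \<in> ball 0 (r1/2/2) \<Longrightarrow> ((\<lambda>t. \<phi> (t, x)) has_vector_derivative X' (t, \<phi> (t, x))) (at t)"
      "\<And>t x v. t \<in> ?J \<Longrightarrow> x \<in> ball 0 (r1/2/2) \<Longrightarrow> ((\<lambda>t. frechet_derivative \<phi> (at (t, x)) (0, v)) has_vector_derivative
          frechet_derivative X' (at (t, \<phi> (t, x))) (0, frechet_derivative \<phi> (at (t, x)) (0, v))) (at t)"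
      "\<And>x v. x \<in> ball 0 (r1/2/2) \<Longrightarrow> frechet_derivative \<phi> (at (0, x)) (0, v) = v"
      "\<And>t x y. t \<in> ?J \<Longrightarrow> x \<in> ball 0 (r1/2/2) \<Longrightarrow> y \<in> ball 0 (r1/2/2) \<Longrightarrow> norm (x - y) / 2 \<le> norm (\<phi> (t, x) - \<phi> (t, y))"
    proof (rule flow_smooth[of a L "r1/2" X'])
      show "norm (frechet_derivative X' (at (t, x)) (0, k)) \<le> L * norm k" if "t \<in> ?J" "x \<in> ?B" for t x k
        using L(2)[OF shK[OF that], of "(0, k)"] DX'[OF that] by (simp add: norm_Pair)
      show "X' (t, 0) = 0" if "t \<in> ?J" for t
        using X0[of "t0 + t"] shK[OF that, of 0] K r1(1) by (auto simp: X'_def sh_def)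
    qed (use h L r1 smX' in auto)
    have r2: "r1/2/2 = r2" by (simp add: r2_def)
    note \<phi> = \<phi>[unfolded r2]
    have hJ: "h \<in> ?J" using h by auto
    define \<psi> where "\<psi> x = \<phi> (h, x)" for x
    have sl: "smooth ?C (\<lambda>x. (h, x))" by (intro smooth_Pair smooth_const smooth_bounded_linear bounded_linear_ident) auto
    have D\<psi>: "frechet_derivative \<psi> (at x) = (\<lambda>v. frechet_derivative \<phi> (at (h, x)) (0, v))" if "x \<in> ?C" for x
    proof -
      have "(\<phi> has_derivative frechet_derivative \<phi> (at (h, x))) (at (h, x))"
        using smooth_has_derivative[OF \<phi>(1)] hJ that by blast
      then have "(\<psi> has_derivative (\<lambda>v. frechet_derivative \<phi> (at (h, x)) (0, v))) (at x)"
        unfolding \<psi>_def by (rule has_derivative_compose[where f = "\<lambda>x. (h, x)" and f' = "\<lambda>v. (0, v)", rotated])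
          (auto intro!: derivative_eq_intros)
      then show ?thesis by (rule frechet_derivative_at[symmetric])
    qed
    have sm\<psi>: "smooth ?C \<psi>" unfolding \<psi>_def by (rule smooth_compose[OF \<phi>(1) sl]) (use hJ in auto)
    have low: "1/2 * norm (y - x) \<le> norm (\<psi> y - \<psi> x)" if "x \<in> ?C" "y \<in> ?C" for x y
      using \<phi>(8)[OF hJ that(2,1)] by (simp add: \<psi>_def)
    have "inj_on \<psi> ?C" using low by (force intro!: inj_onI)
    moreover have "v = 0" if "x \<in> ?C" "frechet_derivative \<psi> (at x) v = 0" for x v
      by (rule derivative_injective_of_lower_bound[OF smooth_has_derivative[OF sm\<psi> that(1)] open_ball that(1) _ low[OF that(1)] that(2)]) simp
    moreover have "\<alpha> t0 x v = 0 \<longleftrightarrow> \<alpha> (t0 + h) (\<psi> x) (frechet_derivative \<psi> (at x) v) = 0" if x: "x \<in> ?C" for x v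
    proof -
      \<comment> \<open>\<open>w\<close> is the tangent vector \<open>v\<close> transported by the
        flow, and \<open>f\<close> is the value of the form on it. The goal is the equation f' = -
        \<mu> f, which preserves the vanishing of \<open>f\<close>.\<close>
      define w where "w s = frechet_derivative \<phi> (at (s, x)) (0, v)" for s
      define f where "f s = \<alpha> (t0 + s) (\<phi> (s, x)) (w s)" for s
      have fd: "(f has_real_derivative (- \<mu> (t0 + s, \<phi> (s, x))) * f s) (at s)" if s: "s \<in> ?J" for s
      proof -
        let ?y = "\<phi> (s, x)" and ?p = "(t0 + s, \<phi> (s, x))"
        let ?Xs = "X ?p"
        let ?W = "frechet_derivative X (at ?p) (0, w s)"
        have yB: "?y \<in> ?B" using \<phi>(2)[OF s x] .
        have pP: "?p \<in> P" using shK[OF s yB] K by (auto simp: sh_def)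
        have y0: "?y \<in> ball 0 r0" using Pd(3)[OF pP] by simp
        have d\<phi>: "((\<lambda>s. \<phi> (s, x)) has_derivative (\<lambda>k. k *\<^sub>R ?Xs)) (at s)"
          using \<phi>(5)[OF s x] by (simp add: has_vector_derivative_def X'_def sh_def)
        have dw: "(w has_derivative (\<lambda>k. k *\<^sub>R ?W)) (at s)"
          using \<phi>(6)[OF s x, of v] DX'[OF s yB] by (simp add: has_vector_derivative_def w_def[abs_def] sh_def)
        have along: "((\<lambda>s. \<eta> (\<phi> (s, x)) (w s)) has_derivative
            (\<lambda>k. \<eta> ?y (k *\<^sub>R ?W) + frechet_derivative (\<lambda>z. \<eta> z (w s)) (at ?y) (k *\<^sub>R ?Xs))) (at s)"
          if \<eta>: "form_family (ball 0 r0) \<eta>" for \<eta>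
        proof (rule linear_family_has_derivative[where A = "\<lambda>s. \<eta> (\<phi> (s, x))" and P = ?J, OF open_greaterThanLessThan s _ _ dw])
          fix s' assume "s' \<in> ?J"
          then have "\<phi> (s', x) \<in> ball 0 r0" using \<phi>(2)[OF _ x] r1 by fastforce
          then show "linear (\<eta> (\<phi> (s', x)))" using \<eta> by (simp add: form_family_def)
        next
          fix z
          show "((\<lambda>s. \<eta> (\<phi> (s, x)) z) has_derivative (\<lambda>k. frechet_derivative (\<lambda>y. \<eta> y z) (at ?y) (k *\<^sub>R ?Xs))) (at s)"
            by (rule has_derivative_compose[OF d\<phi> form_family_derivative(1)[OF \<eta> y0]])
        qed
        have dX: "(X has_derivative frechet_derivative X (at ?p)) (at ?p)"
          using smooth_has_derivative[OF smX pP] .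
        have Xy: "((\<lambda>y. X (t0 + s, y)) has_derivative (\<lambda>k. frechet_derivative X (at ?p) (0, k))) (at ?y)"
          by (rule has_derivative_compose[where f = "\<lambda>y. (t0 + s, y)" and f' = "\<lambda>v. (0, v)" and g = X])
            (auto intro!: derivative_eq_intros dX)
        \<comment> \<open>Prepares the spatial derivative of the identity a_t(X_t) = 0, the term
          d(a_t(X_t)) of Cartan's formula. It trades the derivative of \<open>X\<close> for
          derivatives of the forms, and these complete the exterior derivative.\<close>
        have across: "((\<lambda>y. \<eta> y (X (t0 + s, y))) has_derivative
            (\<lambda>k. \<eta> ?y (frechet_derivative X (at ?p) (0, k)) + frechet_derivative (\<lambda>z. \<eta> z ?Xs) (at ?y) k)) (at ?y)"
          if \<eta>: "form_family (ball 0 r0) \<eta>" for \<eta>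
          by (rule linear_family_has_derivative[where A = \<eta> and P = "ball 0 r0", OF open_ball y0 _ form_family_derivative(1)[OF \<eta> y0] Xy])
            (use \<eta> in \<open>auto simp: form_family_def\<close>)
        have D1: "((\<lambda>y. \<beta> y (X (t0 + s, y)) + (t0 + s) * \<gamma> y (X (t0 + s, y))) has_derivative
           (\<lambda>k. (\<beta> ?y (frechet_derivative X (at ?p) (0, k)) + frechet_derivative (\<lambda>z. \<beta> z ?Xs) (at ?y) k) +
             (t0 + s) * (\<gamma> ?y (frechet_derivative X (at ?p) (0, k)) + frechet_derivative (\<lambda>z. \<gamma> z ?Xs) (at ?y) k))) (at ?y)"
          by (intro has_derivative_add has_derivative_mult_right across \<beta> \<gamma>)
        have D0: "((\<lambda>y. \<beta> y (X (t0 + s, y)) + (t0 + s) * \<gamma> y (X (t0 + s, y))) has_derivative (\<lambda>k. 0)) (at ?y)"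
        proof (rule has_derivative_transform_within_open[OF has_derivative_const open_ball yB])
          fix y assume "y \<in> ?B"
          then have "(t0 + s, y) \<in> P" using shK[OF s, of y] K by (auto simp: sh_def)
          from X1[OF this] show "0 = \<beta> y (X (t0 + s, y)) + (t0 + s) * \<gamma> y (X (t0 + s, y))" by (simp add: \<alpha>_def)
        qed
        have cross: "(\<beta> ?y ?W + frechet_derivative (\<lambda>z. \<beta> z ?Xs) (at ?y) (w s)) +
             (t0 + s) * (\<gamma> ?y ?W + frechet_derivative (\<lambda>z. \<gamma> z ?Xs) (at ?y) (w s)) = 0"
          by (rule fun_cong[OF has_derivative_unique[OF D1 D0], of "w s"])
        have "((\<lambda>s. \<beta> (\<phi> (s, x)) (w s) + (t0 + s) * \<gamma> (\<phi> (s, x)) (w s)) has_derivative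
           (\<lambda>k. (\<beta> ?y (k *\<^sub>R ?W) + frechet_derivative (\<lambda>z. \<beta> z (w s)) (at ?y) (k *\<^sub>R ?Xs)) +
             ((t0 + s) * (\<gamma> ?y (k *\<^sub>R ?W) + frechet_derivative (\<lambda>z. \<gamma> z (w s)) (at ?y) (k *\<^sub>R ?Xs)) + (0 + k) * \<gamma> ?y (w s)))) (at s)"
          by (intro has_derivative_add has_derivative_mult along \<beta> \<gamma> has_derivative_const has_derivative_ident)
        also have "(\<lambda>k. (\<beta> ?y (k *\<^sub>R ?W) + frechet_derivative (\<lambda>z. \<beta> z (w s)) (at ?y) (k *\<^sub>R ?Xs)) +
             ((t0 + s) * (\<gamma> ?y (k *\<^sub>R ?W) + frechet_derivative (\<lambda>z. \<gamma> z (w s)) (at ?y) (k *\<^sub>R ?Xs)) + (0 + k) * \<gamma> ?y (w s)))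
           = (\<lambda>k. k * ((\<beta> ?y ?W + frechet_derivative (\<lambda>z. \<beta> z (w s)) (at ?y) ?Xs) +
             (t0 + s) * (\<gamma> ?y ?W + frechet_derivative (\<lambda>z. \<gamma> z (w s)) (at ?y) ?Xs) + \<gamma> ?y (w s)))"
          using linear_scale[OF lin_\<beta>[OF y0]] linear_scale[OF lin_\<gamma>[OF y0]]
            linear_scale[OF form_family_derivative(2)[OF \<beta> y0]] linear_scale[OF form_family_derivative(2)[OF \<gamma> y0]]
          by (intro ext) (simp add: algebra_simps)
        also have "(\<beta> ?y ?W + frechet_derivative (\<lambda>z. \<beta> z (w s)) (at ?y) ?Xs) +
             (t0 + s) * (\<gamma> ?y ?W + frechet_derivative (\<lambda>z. \<gamma> z (w s)) (at ?y) ?Xs) + \<gamma> ?y (w s) =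
           ext_deriv \<beta> ?y ?Xs (w s) + (t0 + s) * ext_deriv \<gamma> ?y ?Xs (w s) + \<gamma> ?y (w s)"
          using cross by (simp add: ext_deriv_def algebra_simps)
        also have "\<dots> = - \<mu> ?p * f s" using X2[OF pP, of "w s"] by (simp add: f_def)
        finally have "((\<lambda>s. \<beta> (\<phi> (s, x)) (w s) + (t0 + s) * \<gamma> (\<phi> (s, x)) (w s)) has_derivative (\<lambda>k. k * (- \<mu> ?p * f s))) (at s)" .
        moreover have "f = (\<lambda>s. \<beta> (\<phi> (s, x)) (w s) + (t0 + s) * \<gamma> (\<phi> (s, x)) (w s))"
          by (auto simp: f_def \<alpha>_def)
        moreover have "(\<lambda>k. k * (- \<mu> ?p * f s)) = (*) (- \<mu> ?p * f s)" by (simp add: fun_eq_iff mult.commute)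
        ultimately show ?thesis unfolding has_field_derivative_def by (simp only:)
      qed
      have I: "s \<in> ?J" if "s \<in> {0..h}" for s using that h by auto
      have "f h = 0 \<longleftrightarrow> f 0 = 0"
      proof (rule scalar_linear_ode_zero_iff)
        have "isCont (\<lambda>s. - \<mu> (t0 + s, \<phi> (s, x))) s" if s: "s \<in> ?J" for s
        proof -
          have "(t0 + s, \<phi> (s, x)) \<in> P" using shK[OF s \<phi>(2)[OF s x]] K by (auto simp: sh_def)
          then have "isCont \<mu> (t0 + s, \<phi> (s, x))"
            using smooth_continuous_on[OF sm\<mu>] unfolding continuous_on_eq_continuous_at[OF oP] by blast
          moreover have "isCont (\<lambda>s. (t0 + s, \<phi> (s, x))) s"
            using \<phi>(5)[OF s x] has_vector_derivative_continuous by (intro continuous_intros) blast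
          ultimately show ?thesis using isCont_o2 continuous_minus by blast
        qed
        then show "continuous_on {0..h} (\<lambda>s. - \<mu> (t0 + s, \<phi> (s, x)))"
          using I by (simp add: continuous_at_imp_continuous_on)
      qed (use fd I h in \<open>auto intro: has_field_derivative_at_within\<close>)
      then show ?thesis using \<phi>(3,7)[OF x] D\<psi>[OF x] by (simp add: f_def w_def \<psi>_def)
    qed
    moreover have "\<psi> 0 = 0" using \<phi>(4)[OF hJ] by (simp add: \<psi>_def)
    moreover have "\<psi> ` ?C \<subseteq> ball 0 r1" using \<phi>(2)[OF hJ] r1(1) by (fastforce simp: \<psi>_def)
    ultimately show ?thesis using sm\<psi> by blast
  qed
  \<comment> \<open>Composition of the first \<open>k\<close> steps. The radius may shrink at each
    of them; it stays positive because 0 is a fixed point.\<close>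
  have "\<exists>F r. 0 < r \<and> smooth (ball 0 r) F \<and> F 0 = 0 \<and> F ` ball 0 r \<subseteq> ball 0 r1 \<and> inj_on F (ball 0 r) \<and>
     (\<forall>x\<in>ball 0 r. \<forall>v. frechet_derivative F (at x) v = 0 \<longrightarrow> v = 0) \<and>
     (\<forall>x\<in>ball 0 r. \<forall>v. \<beta> x v = 0 \<longleftrightarrow> \<alpha> (real k * h) (F x) (frechet_derivative F (at x) v) = 0)" if "k \<le> N" for k
    using that
  proof (induction k)
    case 0
    show ?case
      by (rule exI[of _ "\<lambda>x. x"], rule exI[of _ r1])
        (use r1 in \<open>auto intro: smooth_bounded_linear bounded_linear_ident simp: \<alpha>_def\<close>)
  next
    case (Suc k)
    then obtain F r where F: "0 < r" "smooth (ball 0 r) F" "F 0 = 0" "F ` ball 0 r \<subseteq> ball 0 r1" "inj_on F (ball 0 r)"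
      "\<And>x v. x \<in> ball 0 r \<Longrightarrow> frechet_derivative F (at x) v = 0 \<Longrightarrow> v = 0"
      "\<And>x v. x \<in> ball 0 r \<Longrightarrow> \<beta> x v = 0 \<longleftrightarrow> \<alpha> (real k * h) (F x) (frechet_derivative F (at x) v) = 0"
      by (metis Suc_leD)
    have "real k * h \<in> {0..1}"
      using h(1,5) Suc.prems mult_right_mono[of "real k" "real N" h] by auto
    from step[OF this] obtain \<psi> where \<psi>: "smooth (ball 0 r2) \<psi>" "\<psi> 0 = 0" "\<psi> ` ball 0 r2 \<subseteq> ball 0 r1" "inj_on \<psi> (ball 0 r2)"
      "\<And>x v. x \<in> ball 0 r2 \<Longrightarrow> frechet_derivative \<psi> (at x) v = 0 \<Longrightarrow> v = 0"
      "\<And>x v. x \<in> ball 0 r2 \<Longrightarrow> \<alpha> (real k * h) x v = 0 \<longleftrightarrow> \<alpha> (real k * h + h) (\<psi> x) (frechet_derivative \<psi> (at x) v) = 0"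
      by blast
    have "open (ball 0 r \<inter> F -` ball 0 r2)"
      using smooth_continuous_on[OF F(2)] by (intro continuous_open_preimage) auto
    moreover have "0 \<in> ball 0 r \<inter> F -` ball 0 r2" using F(1,3) r1(1) by (simp add: r2_def)
    ultimately obtain r' where r': "0 < r'" "ball 0 r' \<subseteq> ball 0 r \<inter> F -` ball 0 r2" using open_contains_ball by blast
    have Fr: "x \<in> ball 0 r" "F x \<in> ball 0 r2" if "x \<in> ball 0 r'" for x using r'(2) that by auto
    have smF': "smooth (ball 0 r') F" using smooth_subset[OF F(2)] Fr by blast
    have D: "frechet_derivative (\<lambda>x. \<psi> (F x)) (at x) = (\<lambda>v. frechet_derivative \<psi> (at (F x)) (frechet_derivative F (at x) v))"
      if "x \<in> ball 0 r'" for x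
      by (rule frechet_derivative_at[symmetric],
          rule has_derivative_compose[OF smooth_has_derivative[OF smF' that] smooth_has_derivative[OF \<psi>(1) Fr(2)[OF that]]])
    have "smooth (ball 0 r') (\<lambda>x. \<psi> (F x))" by (rule smooth_compose[OF \<psi>(1) smF']) (use Fr in auto)
    moreover have "inj_on (\<lambda>x. \<psi> (F x)) (ball 0 r')"
      using F(5) \<psi>(4) Fr by (auto simp: inj_on_def)
    moreover have "(\<lambda>x. \<psi> (F x)) ` ball 0 r' \<subseteq> ball 0 r1" using Fr \<psi>(3) by blast
    moreover have "v = 0" if "x \<in> ball 0 r'" "frechet_derivative (\<lambda>x. \<psi> (F x)) (at x) v = 0" for x v
      by (rule F(6)[OF Fr(1)[OF that(1)] \<psi>(5)[OF Fr(2)[OF that(1)] that(2)[unfolded D[OF that(1)]]]])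
    moreover have "\<beta> x v = 0 \<longleftrightarrow> \<alpha> (real (Suc k) * h) (\<psi> (F x)) (frechet_derivative (\<lambda>x. \<psi> (F x)) (at x) v) = 0" if "x \<in> ball 0 r'" for x v
    proof -
      have "real (Suc k) * h = real k * h + h" by (simp add: algebra_simps)
      then show ?thesis
        unfolding D[OF that] F(7)[OF Fr(1)[OF that]] \<psi>(6)[OF Fr(2)[OF that]] by (simp only:)
    qed
    moreover have "\<psi> (F 0) = 0" using F(3) \<psi>(2) by simp
    ultimately show ?case using r'(1) by blast
  qed
  from this[OF order_refl] obtain F r where F: "0 < r" "smooth (ball 0 r) F" "F ` ball 0 r \<subseteq> ball 0 r1" "inj_on F (ball 0 r)"
      "\<And>x v. x \<in> ball 0 r \<Longrightarrow> frechet_derivative F (at x) v = 0 \<Longrightarrow> v = 0"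
      "\<And>x v. x \<in> ball 0 r \<Longrightarrow> \<beta> x v = 0 \<longleftrightarrow> \<alpha> (real N * h) (F x) (frechet_derivative F (at x) v) = 0"
    by blast
  show thesis
    by (rule that[OF F(1,2) _ F(4,5)]) (use F(3,6) r1(2) h(5) in \<open>auto simp: \<alpha>_def\<close>)
qed

section \<open>The Darboux theorem for contact forms\<close>

text \<open>Symplectic Gram-Schmidt inside the kernel of \<alpha>, which has dimension 2 m: while
  fewer than m pairs are chosen, some vector lies outside their span, its projection
  \<open>pr\<close> to the \<omega>-orthogonal complement is nonzero, and nondegeneracy supplies a
  partner. The value 2 is chosen because the exterior derivative of \<open>heis\<close> is twice the
  standard symplectic form.\<close>

lemma symplectic_frame:
  fixes \<alpha> :: "'e::euclidean_space \<Rightarrow> real" and \<omega> :: "'e \<Rightarrow> 'e \<Rightarrow> real"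
  assumes \<alpha>: "linear \<alpha>" "\<alpha> r \<noteq> 0"
    and \<omega>: "\<And>u. linear (\<omega> u)" "\<And>v. linear (\<lambda>u. \<omega> u v)" "\<And>u v. \<omega> u v = - \<omega> v u"
    and nd: "\<And>u. \<alpha> u = 0 \<Longrightarrow> (\<And>v. \<alpha> v = 0 \<Longrightarrow> \<omega> u v = 0) \<Longrightarrow> u = 0"
    and dim: "DIM('e) = 2 * m + 1" and "k \<le> m"
  shows "\<exists>e f :: nat \<Rightarrow> 'e. (\<forall>i<k. \<alpha> (e i) = 0 \<and> \<alpha> (f i) = 0) \<and>
     (\<forall>i<k. \<forall>j<k. \<omega> (e i) (e j) = 0 \<and> \<omega> (f i) (f j) = 0 \<and> \<omega> (e i) (f j) = (if i = j then 2 else 0))"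
  using \<open>k \<le> m\<close>
proof (induction k)
  case 0
  show ?case by simp
next
  case (Suc k)
  from Suc.IH[OF Suc_leD[OF Suc.prems]]
  obtain e f :: "nat \<Rightarrow> 'e" where "\<forall>i<k. \<alpha> (e i) = 0 \<and> \<alpha> (f i) = 0"
     "\<forall>i<k. \<forall>j<k. \<omega> (e i) (e j) = 0 \<and> \<omega> (f i) (f j) = 0 \<and> \<omega> (e i) (f j) = (if i = j then 2 else 0)"
    by (elim exE conjE) (rule that)
  note exef = this
  have efa: "\<alpha> (e i) = 0" "\<alpha> (f i) = 0" if "i < k" for i
    using exef(1) that by auto
  have efb: "\<omega> (e i) (e j) = 0" "\<omega> (f i) (f j) = 0" "\<omega> (e i) (f j) = (if i = j then 2 else 0)"
    if "i < k" "j < k" for i j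
    using exef(2) that by auto
  note ef = efa efb
  have fe: "\<omega> (f i) (e j) = (if i = j then -2 else 0)" if "i < k" "j < k" for i j
    using ef(5)[OF that(2,1)] \<omega>(3)[of "f i" "e j"] by auto
  \<comment> \<open>The halves undo the normalization \<omega>(e_i, f_i) = 2; the two signs differ
    since \<omega>(f_i, e_i) = -2.\<close>
  define pr where "pr u = u - (\<Sum>i<k. (\<omega> u (f i) / 2) *\<^sub>R e i) + (\<Sum>i<k. (\<omega> u (e i) / 2) *\<^sub>R f i)" for u
  have \<omega>pr: "\<omega> (pr u) v = \<omega> u v - (\<Sum>i<k. \<omega> u (f i) / 2 * \<omega> (e i) v) + (\<Sum>i<k. \<omega> u (e i) / 2 * \<omega> (f i) v)" for u v
    by (simp add: pr_def linear_add[OF \<omega>(2)] linear_diff[OF \<omega>(2)] linear_sum[OF \<omega>(2)] linear_scale[OF \<omega>(2)])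
  have pr_e: "\<omega> (pr u) (e j) = 0" and pr_f: "\<omega> (pr u) (f j) = 0" if j: "j < k" for u j
  proof -
    have "(\<Sum>i<k. \<omega> u (f i) / 2 * \<omega> (e i) (e j)) = 0" "(\<Sum>i<k. \<omega> u (e i) / 2 * \<omega> (f i) (f j)) = 0"
      using ef j by (auto intro!: sum.neutral)
    moreover have "(\<Sum>i<k. \<omega> u (e i) / 2 * \<omega> (f i) (e j)) = (\<Sum>i<k. if i = j then - \<omega> u (e i) else 0)"
      using j by (intro sum.cong) (auto simp: fe)
    moreover have "(\<Sum>i<k. \<omega> u (f i) / 2 * \<omega> (e i) (f j)) = (\<Sum>i<k. if i = j then \<omega> u (f i) else 0)"
      using j by (intro sum.cong) (auto simp: ef(5))
    ultimately show "\<omega> (pr u) (e j) = 0" "\<omega> (pr u) (f j) = 0" using j by (simp_all add: \<omega>pr sum.delta)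
  qed
  have \<alpha>pr: "\<alpha> (pr u) = \<alpha> u" for u
    using ef(1,2) by (simp add: pr_def linear_add[OF \<alpha>(1)] linear_diff[OF \<alpha>(1)] linear_sum[OF \<alpha>(1)] linear_scale[OF \<alpha>(1)])
  define S where "S = e ` {..<k} \<union> f ` {..<k}"
  have fS: "finite S" by (simp add: S_def)
  have "card S \<le> k + k" unfolding S_def
    by (metis card_Un_le card_image_le card_lessThan finite_lessThan add_mono order_trans)
  then have dS: "dim (span S) \<le> 2 * k" using dim_le_card'[OF fS] by (simp add: dim_span)
  define a where "a = (\<Sum>i\<in>Basis. \<alpha> i *\<^sub>R i)"
  have \<alpha>a: "\<alpha> u = a \<bullet> u" for u
    using linear_Basis_expand[OF \<alpha>(1), of u] by (simp add: a_def inner_sum_left inner_sum_right inner_commute mult.commute)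
  have "a \<noteq> 0" using \<alpha>(2) \<alpha>a by auto
  then have "dim {u. \<alpha> u = 0} = 2 * m" using dim_hyperplane[of a] dim by (simp add: \<alpha>a)
  then have "\<not> {u. \<alpha> u = 0} \<subseteq> span S" using dS Suc.prems dim_subset[of "{u. \<alpha> u = 0}" "span S"] by auto
  then obtain u where u: "\<alpha> u = 0" "u \<notin> span S" by auto
  have "pr u \<noteq> 0"
  proof
    assume "pr u = 0"
    then have "u = (\<Sum>i<k. (\<omega> u (f i) / 2) *\<^sub>R e i) - (\<Sum>i<k. (\<omega> u (e i) / 2) *\<^sub>R f i)" by (simp add: pr_def algebra_simps)
    also have "\<dots> \<in> span S" by (intro span_diff span_sum span_scale span_base) (auto simp: S_def)
    finally show False using u(2) by simp
  qed
  then obtain w where w: "\<alpha> w = 0" "\<omega> (pr u) w \<noteq> 0" using nd[of "pr u"] u(1) \<alpha>pr by metis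
  \<comment> \<open>Projecting the partner does not change its pairing with \<open>pr u\<close>,
    which is already orthogonal to the chosen pairs.\<close>
  have uw: "\<omega> (pr u) (pr w) = \<omega> (pr u) w"
  proof -
    have "\<omega> (pr u) (\<Sum>i<k. (\<omega> w (f i) / 2) *\<^sub>R e i) = 0" "\<omega> (pr u) (\<Sum>i<k. (\<omega> w (e i) / 2) *\<^sub>R f i) = 0"
      using pr_e pr_f by (auto simp: linear_sum[OF \<omega>(1)] linear_scale[OF \<omega>(1)])
    then show ?thesis by (subst (2) pr_def) (simp add: linear_add[OF \<omega>(1)] linear_diff[OF \<omega>(1)])
  qed
  define c where "c = 2 / \<omega> (pr u) w"
  define e' where "e' = e(k := pr u)"
  define f' where "f' = f(k := c *\<^sub>R pr w)"
  have self: "\<omega> v v = 0" for v using \<omega>(3)[of v v] by simp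
  have sw: "\<omega> (e j) (pr u) = 0" "\<omega> (f j) (pr u) = 0" if "j < k" for j u
    using pr_e[OF that, of u] pr_f[OF that, of u] \<omega>(3)[of "e j" "pr u"] \<omega>(3)[of "f j" "pr u"] by auto
  have "\<alpha> (e' i) = 0 \<and> \<alpha> (f' i) = 0" if "i < Suc k" for i
    using that ef(1,2) \<alpha>pr u(1) w(1) by (auto simp: e'_def f'_def less_Suc_eq linear_scale[OF \<alpha>(1)])
  moreover have "\<omega> (e' i) (e' j) = 0 \<and> \<omega> (f' i) (f' j) = 0 \<and> \<omega> (e' i) (f' j) = (if i = j then 2 else 0)"
    if "i < Suc k" "j < Suc k" for i j
    using that ef(3-5) w(2) uw pr_e pr_f sw self
    by (auto simp: e'_def f'_def less_Suc_eq c_def linear_scale[OF \<omega>(1)] linear_scale[OF \<omega>(2)])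
  ultimately show ?case by blast
qed

text \<open>The standard contact form \<open>ds + \<Sum> (x\<^sub>i dy\<^sub>i - y\<^sub>i dx\<^sub>i)\<close> of the Heisenberg group, with
  \<open>w\<^sub>i = x\<^sub>i + \<i> y\<^sub>i\<close>.\<close>

definition heis :: "real \<times> (complex ^ 'n::finite) \<Rightarrow> real \<times> (complex ^ 'n) \<Rightarrow> real" where
  "heis x v = fst v + (\<Sum>i\<in>UNIV. Im (cnj (snd x $ i) * (snd v $ i)))"

lemma heis_has_derivative:
  "((\<lambda>x. heis x v) has_derivative (\<lambda>u. \<Sum>i\<in>UNIV. Im (cnj (snd u $ i) * (snd v $ i)))) (at x)"
  unfolding heis_def
  by (auto intro!: derivative_eq_intros bounded_linear.has_derivative[OF bounded_linear_Im]
      bounded_linear.has_derivative[OF bounded_linear_cnj] bounded_linear.has_derivative[OF bounded_linear_vec_nth])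

lemma ext_deriv_heis: "ext_deriv heis x u v = 2 * (\<Sum>i\<in>UNIV. Im (cnj (snd u $ i) * (snd v $ i)))"
proof -
  have "(\<Sum>i\<in>UNIV. Im (cnj (snd v $ i) * (snd u $ i))) = - (\<Sum>i\<in>UNIV. Im (cnj (snd u $ i) * (snd v $ i)))"
    by (simp add: sum_negf[symmetric] algebra_simps)
  then show ?thesis
    unfolding ext_deriv_def frechet_derivative_at[OF heis_has_derivative, symmetric] by simp
qed

lemma heis_form_family: "open U \<Longrightarrow> form_family U heis"
  unfolding form_family_def heis_def
  by (intro conjI ballI allI smooth_add smooth_const smooth_sum smooth_linear_comp[OF bounded_linear_Im]
      smooth_mult smooth_linear_comp[OF bounded_linear_cnj] smooth_linear_comp[OF bounded_linear_vec_nth]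
      smooth_bounded_linear bounded_linear_snd)
    (auto simp: linear_iff algebra_simps sum.distrib sum_subtractf sum_distrib_left)

text \<open>The standard symplectic form pairs a vector with i times itself to its squared norm; its
  nondegeneracy is used in this form.\<close>

lemma symplectic_test:
  fixes w :: "complex ^ 'n::finite"
  assumes "(\<Sum>i\<in>UNIV. Im (cnj (w $ i) * (\<i> * (w $ i)))) = 0" shows "w = 0"
proof -
  have "Im (cnj z * (\<i> * z)) = (cmod z)\<^sup>2" for z unfolding cmod_power2 by (simp add: power2_eq_square)
  then have "(\<Sum>i\<in>UNIV. (cmod (w $ i))\<^sup>2) = 0" using assms by simp
  then show ?thesis by (simp add: sum_nonneg_eq_0_iff vec_eq_iff)
qed

text \<open>The frame of the kernel is completed by a Reeb vector \<open>r\<close>, with \<alpha> r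
  = 1 and \<omega> r = 0. Coordinates in the frame \<open>r\<close>, \<open>E i\<close>,
  \<open>F i\<close> turn the two forms into \<open>heis\<close> at 0 and its exterior
  derivative.\<close>

lemma contact_form_linear_normal_form:
  fixes \<alpha> :: "'e::euclidean_space \<Rightarrow> real" and \<omega> :: "'e \<Rightarrow> 'e \<Rightarrow> real"
  assumes \<alpha>: "linear \<alpha>" "\<alpha> r0 \<noteq> 0"
    and \<omega>: "\<And>u. linear (\<omega> u)" "\<And>v. linear (\<lambda>u. \<omega> u v)" "\<And>u v. \<omega> u v = - \<omega> v u"
    and nd: "\<And>u. \<alpha> u = 0 \<Longrightarrow> (\<And>v. \<alpha> v = 0 \<Longrightarrow> \<omega> u v = 0) \<Longrightarrow> u = 0"
    and dim: "DIM('e) = 2 * CARD('n::finite) + 1"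
  obtains A :: "real \<times> (complex ^ 'n) \<Rightarrow> 'e" where "linear A" "inj A" "\<And>v. \<alpha> (A v) = fst v"
    "\<And>u v. \<omega> (A u) (A v) = 2 * (\<Sum>i\<in>UNIV. Im (cnj (snd u $ i) * (snd v $ i)))"
proof -
  let ?m = "CARD('n)"
  have "\<exists>e f :: nat \<Rightarrow> 'e. (\<forall>i<?m. \<alpha> (e i) = 0 \<and> \<alpha> (f i) = 0) \<and>
     (\<forall>i<?m. \<forall>j<?m. \<omega> (e i) (e j) = 0 \<and> \<omega> (f i) (f j) = 0 \<and> \<omega> (e i) (f j) = (if i = j then 2 else 0))"
    by (rule symplectic_frame[OF \<alpha> \<omega> _ dim order_refl]) (rule nd)
  then obtain e f :: "nat \<Rightarrow> 'e" where "\<forall>i<?m. \<alpha> (e i) = 0 \<and> \<alpha> (f i) = 0"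
     "\<forall>i<?m. \<forall>j<?m. \<omega> (e i) (e j) = 0 \<and> \<omega> (f i) (f j) = 0 \<and> \<omega> (e i) (f j) = (if i = j then 2 else 0)"
    by blast
  note exef = this
  have efa: "\<alpha> (e i) = 0" "\<alpha> (f i) = 0" if "i < ?m" for i
    using exef(1) that by auto
  have efb: "\<omega> (e i) (e j) = 0" "\<omega> (f i) (f j) = 0" "\<omega> (e i) (f j) = (if i = j then 2 else 0)"
    if "i < ?m" "j < ?m" for i j
    using exef(2) that by auto
  note ef = efa efb
  obtain ix :: "'n \<Rightarrow> nat" where ix: "bij_betw ix UNIV {..<?m}"
    using ex_bij_betw_finite_nat[of "UNIV :: 'n set"] by (auto simp: atLeast0LessThan)
  have ixm: "ix i < ?m" and ixi: "ix i = ix j \<longleftrightarrow> i = j" for i j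
    using ix by (auto simp: bij_betw_def inj_on_def)
  define E where "E i = e (ix i)" for i
  define F where "F i = f (ix i)" for i
  have EF: "\<alpha> (E i) = 0" "\<alpha> (F i) = 0" "\<omega> (E i) (E j) = 0" "\<omega> (F i) (F j) = 0" "\<omega> (E i) (F j) = (if i = j then 2 else 0)"
    "\<omega> (F j) (E i) = (if i = j then -2 else 0)" for i j
    using ef ixm ixi \<omega>(3)[of "F j" "E i"] by (auto simp: E_def F_def)
  note la = linear_add[OF \<alpha>(1)] linear_diff[OF \<alpha>(1)] linear_sum[OF \<alpha>(1)] linear_scale[OF \<alpha>(1)]
  note l1 = linear_add[OF \<omega>(1)] linear_diff[OF \<omega>(1)] linear_sum[OF \<omega>(1)] linear_scale[OF \<omega>(1)]
  note l2 = linear_add[OF \<omega>(2)] linear_diff[OF \<omega>(2)] linear_sum[OF \<omega>(2)] linear_scale[OF \<omega>(2)]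
  define r1 where "r1 = (1 / \<alpha> r0) *\<^sub>R r0"
  \<comment> \<open>The projection of \<open>symplectic_frame\<close> makes \<open>r\<close>
    orthogonal to all pairs; it alters \<open>r1\<close> only by vectors in the kernel of \<alpha>,
    so \<alpha> r = 1 persists.\<close>
  define r where "r = r1 - (\<Sum>i\<in>UNIV. (\<omega> r1 (F i) / 2) *\<^sub>R E i) + (\<Sum>i\<in>UNIV. (\<omega> r1 (E i) / 2) *\<^sub>R F i)"
  have r\<alpha>: "\<alpha> r = 1" using \<alpha>(2) by (simp add: r_def r1_def la EF)
  have rE: "\<omega> r (E j) = 0" "\<omega> r (F j) = 0" for j
  proof -
    have "(\<Sum>i\<in>UNIV. \<omega> r1 (E i) * \<omega> (F i) (E j) / 2) = (\<Sum>i\<in>UNIV. if i = j then - \<omega> r1 (E i) else 0)"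
      by (intro sum.cong) (auto simp: EF)
    moreover have "(\<Sum>i\<in>UNIV. \<omega> r1 (F i) * \<omega> (E i) (F j) / 2) = (\<Sum>i\<in>UNIV. if i = j then \<omega> r1 (F i) else 0)"
      by (intro sum.cong) (auto simp: EF)
    ultimately show "\<omega> r (E j) = 0" "\<omega> r (F j) = 0" by (simp_all add: r_def l2 EF(3,4))
  qed
  have Er: "\<omega> (E j) r = 0" "\<omega> (F j) r = 0" "\<omega> r r = 0" for j
    using rE[of j] \<omega>(3)[of "E j" r] \<omega>(3)[of "F j" r] \<omega>(3)[of r r] by auto
  define A :: "real \<times> (complex ^ 'n) \<Rightarrow> 'e" where
    "A v = fst v *\<^sub>R r + (\<Sum>i\<in>UNIV. Re (snd v $ i) *\<^sub>R E i + Im (snd v $ i) *\<^sub>R F i)" for v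
  have linA: "linear A"
    by (rule linearI) (auto simp: A_def algebra_simps sum.distrib scaleR_sum_right)
  have \<alpha>A: "\<alpha> (A v) = fst v" for v by (simp add: A_def la r\<alpha> EF)
  have \<omega>AE: "\<omega> (A u) (E j) = - 2 * Im (snd u $ j)" "\<omega> (A u) (F j) = 2 * Re (snd u $ j)" "\<omega> (A u) r = 0" for u j
  proof -
    have "(\<Sum>i\<in>UNIV. Im (snd u $ i) * \<omega> (F i) (E j)) = (\<Sum>i\<in>UNIV. if i = j then - 2 * Im (snd u $ i) else 0)"
      by (intro sum.cong) (auto simp: EF)
    moreover have "(\<Sum>i\<in>UNIV. Re (snd u $ i) * \<omega> (E i) (F j)) = (\<Sum>i\<in>UNIV. if i = j then 2 * Re (snd u $ i) else 0)"
      by (intro sum.cong) (auto simp: EF)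
    ultimately show "\<omega> (A u) (E j) = - 2 * Im (snd u $ j)" "\<omega> (A u) (F j) = 2 * Re (snd u $ j)" "\<omega> (A u) r = 0"
      by (simp_all add: A_def l2 rE Er EF(3,4))
  qed
  have \<omega>A: "\<omega> (A u) (A v) = 2 * (\<Sum>i\<in>UNIV. Im (cnj (snd u $ i) * (snd v $ i)))" for u v
  proof -
    have "\<omega> (A u) (A v) = (\<Sum>i\<in>UNIV. Re (snd v $ i) * \<omega> (A u) (E i) + Im (snd v $ i) * \<omega> (A u) (F i))"
      by (subst (2) A_def) (simp add: l1 \<omega>AE(3))
    then show ?thesis by (simp add: \<omega>AE sum_distrib_left algebra_simps)
  qed
  have "inj A"
    unfolding linear_injective_0[OF linA]
  proof (intro allI impI)
    fix v assume v: "A v = 0"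
    have "fst v = 0" using \<alpha>A[of v] v linear_0[OF \<alpha>(1)] by simp
    moreover have "\<omega> (A v) (A (0, \<chi> i. \<i> * snd v $ i)) = 0" using v linear_0[OF \<omega>(2)] by simp
    then have "snd v = 0" unfolding \<omega>A by (intro symplectic_test) simp
    ultimately show "v = 0" by (simp add: prod_eq_iff)
  qed
  then show thesis using that linA \<alpha>A \<omega>A by blast
qed

text \<open>An affine map \<open>T\<close> matches the form and its exterior derivative at
  \<open>y0\<close> with those of \<open>heis\<close> at 0. The difference \<gamma> then vanishes at
  0 together with d \<gamma>, as \<open>gray_stability\<close> requires; of the first derivatives
  only the antisymmetric part is matched.\<close>

theorem contact_darboux:
  fixes \<alpha> :: "'e::euclidean_space \<Rightarrow> 'e \<Rightarrow> real"
  assumes W: "open W" "y0 \<in> W" and \<alpha>: "contact_form_on W \<alpha>"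
    and dim: "DIM('e) = 2 * CARD('n::finite) + 1"
  obtains F :: "real \<times> (complex ^ 'n) \<Rightarrow> 'e" and r where "0 < r" "smooth (ball 0 r) F"
    "F ` ball 0 r \<subseteq> W" "inj_on F (ball 0 r)"
    "\<And>x v. x \<in> ball 0 r \<Longrightarrow> frechet_derivative F (at x) v = 0 \<Longrightarrow> v = 0"
    "\<And>x v. x \<in> ball 0 r \<Longrightarrow> heis x v = 0 \<longleftrightarrow> \<alpha> (F x) (frechet_derivative F (at x) v) = 0"
proof -
  note main = that
  have "smooth W (\<lambda>y. \<alpha> y v)" for v
    using \<alpha> by (intro smooth_on_smooth[OF W(1)]) (simp add: contact_form_on_def smooth_form_on_def)
  then have ff: "form_family W \<alpha>"
    using \<alpha> by (simp add: contact_form_on_def smooth_form_on_def form_family_def)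
  have lin\<alpha>: "linear (\<alpha> y)" if "y \<in> W" for y using ff that by (simp add: form_family_def)
  have sm\<alpha>: "smooth W (\<lambda>y. \<alpha> y v)" for v using ff by (simp add: form_family_def)
  obtain r0 where nz: "\<alpha> y0 r0 \<noteq> 0" using \<alpha> W(2) by (auto simp: contact_form_on_def)
  have nd: "u = 0" if "\<alpha> y0 u = 0" "\<And>v. \<alpha> y0 v = 0 \<Longrightarrow> ext_deriv \<alpha> y0 u v = 0" for u
    using \<alpha> W(2) that by (auto simp: contact_form_on_def)
  have anti: "ext_deriv \<alpha> y0 u v = - ext_deriv \<alpha> y0 v u" for u v by (simp add: ext_deriv_def)
  have "\<exists>A :: real \<times> (complex ^ 'n) \<Rightarrow> 'e. linear A \<and> inj A \<and> (\<forall>v. \<alpha> y0 (A v) = fst v) \<and>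
    (\<forall>u v. ext_deriv \<alpha> y0 (A u) (A v) = 2 * (\<Sum>i\<in>UNIV. Im (cnj (snd u $ i) * (snd v $ i))))"
  proof (rule contact_form_linear_normal_form[OF lin\<alpha>[OF W(2)] nz form_family_ext_deriv_linear(2)[OF ff W(2)]
        form_family_ext_deriv_linear(1)[OF ff W(2)] anti _ dim])
    show "u = 0" if "\<alpha> y0 u = 0" "\<And>v. \<alpha> y0 v = 0 \<Longrightarrow> ext_deriv \<alpha> y0 u v = 0" for u
      using that by (rule nd)
  qed blast
  then obtain A :: "real \<times> (complex ^ 'n) \<Rightarrow> 'e" where A: "linear A" "inj A" "\<And>v. \<alpha> y0 (A v) = fst v"
    "\<And>u v. ext_deriv \<alpha> y0 (A u) (A v) = 2 * (\<Sum>i\<in>UNIV. Im (cnj (snd u $ i) * (snd v $ i)))"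
    by blast
  have bA: "bounded_linear A" using A(1) linear_conv_bounded_linear by blast
  define T where "T x = y0 + A x" for x
  have dT: "(T has_derivative A) (at x)" for x
    unfolding T_def using has_derivative_add[OF has_derivative_const bounded_linear_imp_has_derivative[OF bA]] by simp
  have smT: "smooth U T" if "open U" for U unfolding T_def
    by (intro smooth_add smooth_const smooth_bounded_linear bA that)
  have "open (T -` W)" using smooth_continuous_on[OF smT[OF open_UNIV]] W(1) open_vimage by blast
  moreover have "0 \<in> T -` W" using W(2) linear_0[OF A(1)] by (simp add: T_def)
  ultimately obtain r1 where r1: "0 < r1" "ball 0 r1 \<subseteq> T -` W" using open_contains_ball by blast
  have TW: "T x \<in> W" if "x \<in> ball 0 r1" for x using r1 that by blast
  define \<gamma> where "\<gamma> x v = \<alpha> (T x) (A v) - heis x v" for x v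
  have \<gamma>: "form_family (ball 0 r1) \<gamma>"
    unfolding form_family_def
  proof (intro conjI ballI allI)
    fix x :: "real \<times> (complex ^ 'n)" assume x: "x \<in> ball 0 r1"
    have "linear (\<lambda>v. \<alpha> (T x) (A v))" using linear_compose[OF A(1) lin\<alpha>[OF TW[OF x]]] by (simp add: o_def)
    moreover have "linear (heis x)" using heis_form_family[OF open_UNIV] unfolding form_family_def by blast
    ultimately show "linear (\<gamma> x)" unfolding \<gamma>_def[abs_def] by (rule linear_compose_sub)
  next
    fix v
    have "smooth (ball 0 r1) (\<lambda>x. \<alpha> (T x) (A v))" by (rule smooth_compose[OF sm\<alpha> smT]) (use TW in auto)
    moreover have "smooth (ball 0 r1) (\<lambda>x. heis x v)" using heis_form_family[OF open_ball] unfolding form_family_def by blast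
    ultimately show "smooth (ball 0 r1) (\<lambda>x. \<gamma> x v)" unfolding \<gamma>_def by (rule smooth_diff)
  qed
  have T0: "T 0 = y0" using linear_0[OF A(1)] by (simp add: T_def)
  have \<gamma>0: "\<gamma> 0 v = 0" for v by (simp add: \<gamma>_def T0 A(3) heis_def)
  have d\<gamma>: "frechet_derivative (\<lambda>x. \<gamma> x v) (at 0) u = frechet_derivative (\<lambda>y. \<alpha> y (A v)) (at y0) (A u) - (\<Sum>i\<in>UNIV. Im (cnj (snd u $ i) * (snd v $ i)))" for u v
  proof -
    have "((\<lambda>y. \<alpha> y (A v)) has_derivative frechet_derivative (\<lambda>y. \<alpha> y (A v)) (at y0)) (at (T 0))"
      using form_family_derivative(1)[OF ff W(2)] by (simp add: T0)
    from has_derivative_diff[OF has_derivative_compose[OF dT this] heis_has_derivative[of v 0]]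
    have "((\<lambda>x. \<gamma> x v) has_derivative (\<lambda>u. frechet_derivative (\<lambda>y. \<alpha> y (A v)) (at y0) (A u) - (\<Sum>i\<in>UNIV. Im (cnj (snd u $ i) * (snd v $ i))))) (at 0)"
      by (simp add: \<gamma>_def)
    from frechet_derivative_at[OF this, symmetric] show ?thesis by simp
  qed
  have ext\<gamma>: "ext_deriv \<gamma> 0 u v = 0" for u v
  proof -
    have "ext_deriv \<gamma> 0 u v = ext_deriv \<alpha> y0 (A u) (A v) - ext_deriv heis 0 u v"
      unfolding ext_deriv_def d\<gamma> frechet_derivative_at[OF heis_has_derivative, symmetric] by simp
    then show ?thesis by (simp add: A(4) ext_deriv_heis)
  qed
  have hnz: "\<exists>v. heis 0 v \<noteq> 0" by (rule exI[of _ "(1, 0)"]) (simp add: heis_def)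
  have hnd: "u = 0" if "heis 0 u = 0" "\<And>v. heis 0 v = 0 \<Longrightarrow> ext_deriv heis 0 u v = 0" for u :: "real \<times> (complex ^ 'n)"
  proof -
    have "fst u = 0" using that(1) by (simp add: heis_def)
    moreover have "snd u = 0"
      using that(2)[of "(0, \<chi> i. \<i> * snd u $ i)"] by (intro symplectic_test) (simp add: heis_def ext_deriv_heis)
    ultimately show ?thesis by (simp add: prod_eq_iff)
  qed
  show thesis
  proof (rule gray_stability[OF r1(1) heis_form_family[OF open_ball] \<gamma> hnz _ \<gamma>0 ext\<gamma>])
    show "u = 0" if "heis 0 u = 0" "\<And>v. heis 0 v = 0 \<Longrightarrow> ext_deriv heis 0 u v = 0" for u :: "real \<times> (complex ^ 'n)"
      using that by (rule hnd)
  next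
    fix G :: "real \<times> (complex ^ 'n) \<Rightarrow> real \<times> (complex ^ 'n)" and r
    assume G: "0 < r" "smooth (ball 0 r) G" "G ` ball 0 r \<subseteq> ball 0 r1" "inj_on G (ball 0 r)"
    "\<And>x v. x \<in> ball 0 r \<Longrightarrow> frechet_derivative G (at x) v = 0 \<Longrightarrow> v = 0"
    "\<And>x v. x \<in> ball 0 r \<Longrightarrow> heis x v = 0 \<longleftrightarrow>
       heis (G x) (frechet_derivative G (at x) v) + \<gamma> (G x) (frechet_derivative G (at x) v) = 0"
  have D: "frechet_derivative (\<lambda>x. T (G x)) (at x) = (\<lambda>v. A (frechet_derivative G (at x) v))" if "x \<in> ball 0 r" for x
    by (rule frechet_derivative_at[symmetric]) (rule has_derivative_compose[OF smooth_has_derivative[OF G(2) that] dT])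
  have injT: "inj T" using A(2) by (simp add: T_def inj_def)
  show thesis
  proof (rule main[OF G(1)])
    show "smooth (ball 0 r) (\<lambda>x. T (G x))" by (rule smooth_compose[OF smT[OF open_UNIV] G(2)]) simp
    show "(\<lambda>x. T (G x)) ` ball 0 r \<subseteq> W" using G(3) TW by blast
    show "inj_on (\<lambda>x. T (G x)) (ball 0 r)" using G(4) injT by (meson inj_onD inj_onI injD)
    show "v = 0" if "x \<in> ball 0 r" "frechet_derivative (\<lambda>x. T (G x)) (at x) v = 0" for x v
    proof -
      have "A (frechet_derivative G (at x) v) = 0" using that(2) unfolding D[OF that(1)] .
      then have "frechet_derivative G (at x) v = 0" using linear_injective_0[OF A(1)] A(2) by blast
      then show ?thesis by (rule G(5)[OF that(1)])
    qed
    show "heis x v = 0 \<longleftrightarrow> \<alpha> (T (G x)) (frechet_derivative (\<lambda>x. T (G x)) (at x) v) = 0" if "x \<in> ball 0 r" for x v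
      unfolding D[OF that] G(6)[OF that] by (simp add: \<gamma>_def)
  qed
qed
qed

section \<open>The toric embedding into the Heisenberg group\<close>

lemma Qcover_eq_iff:
  fixes x y :: "'n::finite qcoord"
  shows "Qcover x = Qcover y \<longleftrightarrow> fst x - fst y \<in> \<int> \<and>
     (\<forall>i. fst (snd x) $ i - fst (snd y) $ i \<in> \<int>) \<and> snd (snd x) = snd (snd y)"
  by (auto simp: Qcover_def case_prod_unfold circle.abs_eq_iff vec_eq_iff)

text \<open>Reduces estimates for periodic functions to a compact range of \<open>t\<close> and
  \<open>q\<close>.\<close>

lemma Qcover_fundamental_domain:
  fixes x :: "'n::finite qcoord"
  obtains y where "Qcover y = Qcover x" "fst y \<in> {0..1}" "fst (snd y) \<in> cbox 0 1" "snd (snd y) = snd (snd x)"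
proof -
  let ?y = "(frac (fst x), (\<chi> i. frac (fst (snd x) $ i)), snd (snd x))"
  have "Qcover ?y = Qcover x" by (auto simp: Qcover_eq_iff frac_def)
  moreover have "fst ?y \<in> {0..1}" using frac_ge_0[of "fst x"] frac_lt_1[of "fst x"] by auto
  moreover have "fst (snd ?y) \<in> cbox 0 1" by (auto simp: mem_box_cart intro: less_imp_le[OF frac_lt_1])
  ultimately show thesis using that[of ?y] by simp
qed

lemma cis_eq_iff: "cis (2 * pi * a) = cis (2 * pi * b) \<longleftrightarrow> a - b \<in> \<int>"
proof -
  have "cis (2 * pi * a) = cis (2 * pi * b) \<longleftrightarrow> cis (2 * pi * (a - b)) = 1"
    using cis_divide[of "2 * pi * a" "2 * pi * b"] by (auto simp: right_diff_distrib)
  moreover have "a - b \<in> \<int>" if "cis (2 * pi * (a - b)) = 1"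
  proof -
    have "cos (2 * pi * (a - b)) = 1" using that by (metis cis.sel(1) one_complex.sel(1))
    then obtain n :: int where "2 * pi * (a - b) = real_of_int n * 2 * pi" using cos_one_2pi_int by blast
    then have "(2 * pi) * (a - b) = (2 * pi) * real_of_int n" by (simp only: mult.commute mult.left_commute)
    then have "a - b = real_of_int n" by (rule mult_left_cancel[THEN iffD1, rotated]) simp
    then show ?thesis by simp
  qed
  ultimately show ?thesis using cis_multiple_2pi by blast
qed

text \<open>In the angles \<open>t - C \<Sum> q\<^sub>i\<close> and \<open>q\<^sub>i\<close> the form \<open>dt - \<lambda>\<close> has the coefficients \<open>1\<close> and \<open>C - p\<^sub>i\<close>,
  which are positive where \<open>p\<^sub>i < C\<close>; they are the squared moduli of the coordinates of a point of the
  cone over the sphere \<open>S\<^sup>2\<^sup>n\<^sup>+\<^sup>1\<close>, which the Cayley transform maps to the Heisenberg group.\<close>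

definition ang :: "real \<Rightarrow> 'n::finite qcoord \<Rightarrow> real" where
  "ang C x = 2 * pi * (fst x - C * (\<Sum>i\<in>UNIV. fst (snd x) $ i))"
definition rad :: "real \<Rightarrow> 'n::finite qcoord \<Rightarrow> real" where
  "rad C x = sqrt (1 + (\<Sum>i\<in>UNIV. C - snd (snd x) $ i))"
definition zco :: "real \<Rightarrow> 'n::finite \<Rightarrow> 'n qcoord \<Rightarrow> complex" where
  "zco C i x = complex_of_real (sqrt (C - snd (snd x) $ i)) * cis (2 * pi * fst (snd x) $ i)"
definition den :: "real \<Rightarrow> 'n::finite qcoord \<Rightarrow> complex" where
  "den C x = complex_of_real (rad C x) + cis (ang C x)"
text \<open>With z_0 = \<open>cis (ang C x)\<close> and N = |z|, the Cayley transform sends z/N to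
  w_i = z_i / (N + z_0). The coordinate s is minus half the imaginary part of (N - z_0) / (N + z_0),
  whose real part is |w|^2; this is the Heisenberg group as the boundary of the Siegel
  domain.\<close>

definition toric :: "real \<Rightarrow> 'n::finite qcoord \<Rightarrow> real \<times> (complex ^ 'n)" where
  "toric C x = (rad C x * sin (ang C x) / (cmod (den C x))\<^sup>2, \<chi> i. zco C i x / den C x)"

text \<open>For C > 0 the momentum 0 is allowed, so the map extends over the zero section, which
  \<open>Qset\<close> omits.\<close>

definition tdom :: "real \<Rightarrow> 'n::finite qcoord set" where
  "tdom C = {x. \<forall>i. snd (snd x) $ i < C}"

lemma bounded_linear_qcoord:
  "bounded_linear (\<lambda>x::'n::finite qcoord. fst (snd x) $ i)" "bounded_linear (\<lambda>x::'n::finite qcoord. snd (snd x) $ i)"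
  by (intro bounded_linear_compose[OF bounded_linear_vec_nth]
      bounded_linear_compose[OF bounded_linear_fst bounded_linear_snd] bounded_linear_compose[OF bounded_linear_snd bounded_linear_snd])+

lemma open_tdom: "open (tdom C :: 'n::finite qcoord set)"
proof -
  have "(tdom C :: 'n qcoord set) = (\<Inter>i\<in>UNIV. {x. snd (snd x) $ i < C})" by (auto simp: tdom_def)
  moreover have "open {x::'n qcoord. snd (snd x) $ i < C}" for i
    by (intro open_Collect_less continuous_intros)
  ultimately show ?thesis by auto
qed

lemma rad_facts:
  assumes "x \<in> tdom C" shows "1 < rad C x" "(rad C x)\<^sup>2 = 1 + (\<Sum>i\<in>UNIV. C - snd (snd x) $ i)"
proof -
  have "(\<Sum>i\<in>UNIV. C - snd (snd x) $ i) > 0" using assms by (intro sum_pos) (auto simp: tdom_def)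
  then show "1 < rad C x" "(rad C x)\<^sup>2 = 1 + (\<Sum>i\<in>UNIV. C - snd (snd x) $ i)" by (simp_all add: rad_def)
qed

lemma cmod_den: "(cmod (den C x))\<^sup>2 = (rad C x)\<^sup>2 + 2 * rad C x * cos (ang C x) + 1"
  using sin_cos_squared_add[of "ang C x"] unfolding den_def cmod_power2 by (simp add: power2_eq_square algebra_simps)

text \<open>The pole z_0 = - N is avoided because |z_0| = 1 < N.\<close>

lemma den_nonzero: assumes "x \<in> tdom C" shows "den C x \<noteq> 0"
proof
  assume "den C x = 0"
  then have "complex_of_real (rad C x) = - cis (ang C x)" by (simp add: den_def add_eq_0_iff2)
  then have "\<bar>rad C x\<bar> = 1" by (metis norm_cis norm_minus_cancel norm_of_real)
  then show False using rad_facts(1)[OF assms] by simp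
qed

lemma sum_zco:
  assumes "x \<in> tdom C" shows "(\<Sum>i\<in>UNIV. (cmod (zco C i x))\<^sup>2) = (rad C x)\<^sup>2 - 1"
    and "(cmod (zco C i x))\<^sup>2 = C - snd (snd x) $ i"
proof -
  have *: "(cmod (zco C i x))\<^sup>2 = C - snd (snd x) $ i" for i
    using assms by (simp add: zco_def norm_mult tdom_def less_imp_le)
  then show "(cmod (zco C i x))\<^sup>2 = C - snd (snd x) $ i" .
  show "(\<Sum>i\<in>UNIV. (cmod (zco C i x))\<^sup>2) = (rad C x)\<^sup>2 - 1" by (simp add: * rad_facts(2)[OF assms])
qed

subsection \<open>Periodicity and injectivity\<close>

text \<open>An integer shift of \<open>q\<close> changes the first angle by 2 pi C times an integer,
  which is invisible because C is an integer.\<close>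

lemma toric_periodic:
  assumes "Qcover x = Qcover y" "C \<in> \<int>" shows "toric C x = toric C y"
proof -
  from assms(1) have q: "fst x - fst y \<in> \<int>" "\<And>i. fst (snd x) $ i - fst (snd y) $ i \<in> \<int>" "snd (snd x) = snd (snd y)"
    by (auto simp: Qcover_eq_iff)
  have "C * (\<Sum>i\<in>UNIV. fst (snd x) $ i) - C * (\<Sum>i\<in>UNIV. fst (snd y) $ i) = C * (\<Sum>i\<in>UNIV. fst (snd x) $ i - fst (snd y) $ i)"
    by (simp add: sum_subtractf right_diff_distrib)
  also have "\<dots> \<in> \<int>" using q(2) assms(2) by (intro Ints_mult Ints_sum) auto
  finally have "(fst x - fst y) - (C * (\<Sum>i\<in>UNIV. fst (snd x) $ i) - C * (\<Sum>i\<in>UNIV. fst (snd y) $ i)) \<in> \<int>"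
    by (rule Ints_diff[OF q(1)])
  then have a: "cis (ang C x) = cis (ang C y)" unfolding ang_def cis_eq_iff by (simp add: algebra_simps)
  then have "sin (ang C x) = sin (ang C y)" by (metis cis.sel(2))
  moreover have "rad C x = rad C y" using q(3) by (simp add: rad_def)
  moreover have "zco C i x = zco C i y" for i
  proof -
    have "cis (2 * pi * fst (snd x) $ i) = cis (2 * pi * fst (snd y) $ i)" using q(2) by (simp only: cis_eq_iff)
    then show ?thesis using q(3) by (simp add: zco_def)
  qed
  ultimately show ?thesis using a by (simp add: toric_def den_def)
qed

text \<open>The number \<zeta> assembled from the Heisenberg coordinates is (N - z_0) / (N + z_0) =
  2 N / (N + z_0) - 1. Hence N / (N + z_0) can be read off from the image point.\<close>

lemma cayley_inverse:
  assumes "x \<in> tdom C"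
  defines "\<zeta> \<equiv> complex_of_real (\<Sum>i\<in>UNIV. (cmod (snd (toric C x) $ i))\<^sup>2) - 2 * \<i> * complex_of_real (fst (toric C x))"
  shows "1 + \<zeta> = 2 * complex_of_real (rad C x) / den C x"
proof -
  let ?N = "rad C x" and ?a = "den C x" and ?D = "(cmod (den C x))\<^sup>2"
  have D: "?D \<noteq> 0" using den_nonzero[OF assms(1)] by simp
  have "(\<Sum>i\<in>UNIV. (cmod (snd (toric C x) $ i))\<^sup>2) = (\<Sum>i\<in>UNIV. (cmod (zco C i x))\<^sup>2) / ?D"
    by (simp add: toric_def norm_divide power_divide sum_divide_distrib)
  then have "(\<Sum>i\<in>UNIV. (cmod (snd (toric C x) $ i))\<^sup>2) = (?N\<^sup>2 - 1) / ?D" by (simp only: sum_zco(1)[OF assms(1)])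
  then have "\<zeta> = Complex ((?N\<^sup>2 - 1) / ?D) (- 2 * (?N * sin (ang C x) / ?D))"
    by (simp add: \<zeta>_def toric_def complex_eq_iff)
  then have "1 + \<zeta> = Complex ((?D + ?N\<^sup>2 - 1) / ?D) (- 2 * ?N * sin (ang C x) / ?D)"
    using D by (simp add: complex_eq_iff add_divide_distrib diff_divide_distrib)
  also have "?D + ?N\<^sup>2 - 1 = 2 * ?N * (?N + cos (ang C x))"
    unfolding cmod_den by (simp add: power2_eq_square algebra_simps)
  also have "Complex (2 * ?N * (?N + cos (ang C x)) / ?D) (- 2 * ?N * sin (ang C x) / ?D) = 2 * complex_of_real ?N * cnj ?a / complex_of_real ?D"
    by (simp add: complex_eq_iff den_def)
  also have "\<dots> = 2 * complex_of_real ?N / ?a"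
    using den_nonzero[OF assms(1)] unfolding complex_norm_square by (simp add: field_simps)
  finally show ?thesis .
qed

text \<open>The image determines N / (N + z_0), hence also z_0 / (N + z_0), as the two add up to 1.
  Since |z_0| = 1, the second quotient gives |N + z_0|, the first then N, after that N + z_0 and all
  z_i, and finally the momenta and the angles modulo integers.\<close>

lemma toric_injective:
  assumes x: "x \<in> tdom C" and y: "y \<in> tdom C" and C: "C \<in> \<int>" and eq: "toric C x = toric C y"
  shows "Qcover x = Qcover y"
proof -
  let ?a = "den C x" and ?b = "den C y" and ?N = "rad C x" and ?M = "rad C y"
  have nz: "?a \<noteq> 0" "?b \<noteq> 0" using den_nonzero[OF x] den_nonzero[OF y] by auto
  have 1: "2 * complex_of_real ?N / ?a = 2 * complex_of_real ?M / ?b"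
    using cayley_inverse[OF x] cayley_inverse[OF y] eq by simp
  have "2 * cis (ang C x) / ?a = 2 - 2 * complex_of_real ?N / ?a" "2 * cis (ang C y) / ?b = 2 - 2 * complex_of_real ?M / ?b"
    using nz by (simp_all add: field_simps den_def)
  then have "2 * cis (ang C x) / ?a = 2 * cis (ang C y) / ?b" using 1 by simp
  then have "cmod (2 * cis (ang C x) / ?a) = cmod (2 * cis (ang C y) / ?b)" by simp
  then have cm: "cmod ?a = cmod ?b" using nz by (simp add: norm_divide norm_mult field_simps)
  have "cmod (2 * complex_of_real ?N / ?a) = cmod (2 * complex_of_real ?M / ?b)" using 1 by simp
  then have NM: "?N = ?M" using cm nz rad_facts(1)[OF x] rad_facts(1)[OF y] by (simp add: norm_divide norm_mult)
  then have ab: "?a = ?b" using 1 nz rad_facts(1)[OF y] by (simp add: field_simps)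
  have Z: "zco C i x = zco C i y" for i
    using arg_cong[OF eq, of "\<lambda>z. snd z $ i"] ab nz by (simp add: toric_def)
  then have p: "snd (snd x) $ i = snd (snd y) $ i" for i
    using sum_zco(2)[OF x, of i] sum_zco(2)[OF y, of i] by simp
  have q: "fst (snd x) $ i - fst (snd y) $ i \<in> \<int>" for i
  proof -
    have "C - snd (snd y) $ i > 0" using y by (simp add: tdom_def)
    then have "cis (2 * pi * fst (snd x) $ i) = cis (2 * pi * fst (snd y) $ i)" using Z[of i] p[of i] by (simp add: zco_def)
    then show ?thesis by (simp only: cis_eq_iff)
  qed
  have "cis (ang C x) = cis (ang C y)" using ab NM by (simp add: den_def)
  then have "(fst x - C * (\<Sum>i\<in>UNIV. fst (snd x) $ i)) - (fst y - C * (\<Sum>i\<in>UNIV. fst (snd y) $ i)) \<in> \<int>"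
    unfolding ang_def cis_eq_iff .
  moreover have "C * (\<Sum>i\<in>UNIV. fst (snd x) $ i - fst (snd y) $ i) \<in> \<int>" using q C by (intro Ints_mult Ints_sum) auto
  ultimately have "((fst x - C * (\<Sum>i\<in>UNIV. fst (snd x) $ i)) - (fst y - C * (\<Sum>i\<in>UNIV. fst (snd y) $ i)))
      + C * (\<Sum>i\<in>UNIV. fst (snd x) $ i - fst (snd y) $ i) \<in> \<int>" by (rule Ints_add)
  then have "fst x - fst y \<in> \<int>" by (simp add: sum_subtractf right_diff_distrib)
  then show ?thesis using q p by (simp add: Qcover_eq_iff vec_eq_iff)
qed

subsection \<open>Smoothness and the differential\<close>

lemma smooth_cis: "smooth U f \<Longrightarrow> smooth U (\<lambda>x. cis (f x))"
proof -
  assume f: "smooth U f"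
  have "smooth U (\<lambda>x. cos (f x) *\<^sub>R 1 + sin (f x) *\<^sub>R \<i>)"
    by (intro smooth_add smooth_scaleR smooth_sin smooth_cos smooth_const f smooth_open[OF f])
  moreover have "cos t *\<^sub>R 1 + sin t *\<^sub>R \<i> = cis t" for t by (simp add: complex_eq_iff)
  ultimately show ?thesis by simp
qed

lemma smooth_toric: "smooth (tdom C) (toric C :: 'n::finite qcoord \<Rightarrow> _)"
proof -
  let ?U = "tdom C :: 'n qcoord set"
  note U = open_tdom
  have sp: "smooth ?U (\<lambda>x. C - snd (snd x) $ i)" and sq: "smooth ?U (\<lambda>x. fst (snd x) $ i)" for i
    by (intro smooth_diff smooth_const smooth_bounded_linear bounded_linear_qcoord U)+
  have sf: "smooth ?U fst" by (intro smooth_bounded_linear bounded_linear_fst U)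
  have pos: "1 + (\<Sum>i\<in>UNIV. C - snd (snd x) $ i) > 0" if "x \<in> ?U" for x
    using that by (intro add_pos_nonneg sum_nonneg) (auto simp: tdom_def less_imp_le)
  have sang: "smooth ?U (ang C)" unfolding ang_def
    by (intro smooth_mult smooth_diff smooth_const smooth_sum U sf sq)
  have srad: "smooth ?U (rad C)" unfolding rad_def
    by (intro smooth_sqrt smooth_add smooth_sum smooth_const U sp pos)
  have szco: "smooth ?U (zco C i)" for i unfolding zco_def
    by (intro smooth_mult smooth_cis smooth_const smooth_linear_comp[OF bounded_linear_of_real] smooth_sqrt sp sq U) (auto simp: tdom_def)
  have sden: "smooth ?U (den C)" unfolding den_def
    by (intro smooth_add smooth_cis sang smooth_linear_comp[OF bounded_linear_of_real] srad)
  have sD: "smooth ?U (\<lambda>x. (cmod (den C x))\<^sup>2)" unfolding cmod_den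
    unfolding power2_eq_square by (intro smooth_add smooth_mult smooth_const srad smooth_cos sang U)
  have iD: "smooth ?U (\<lambda>x. inverse ((cmod (den C x))\<^sup>2))"
    by (rule smooth_inverse[OF sD]) (use den_nonzero in auto)
  \<comment> \<open>Complex division by \<open>den\<close> is written as multiplication by its
    conjugate and by a real reciprocal, to which \<open>smooth_inverse\<close> applies.\<close>
  have "smooth ?U (\<lambda>x. (rad C x * sin (ang C x) * inverse ((cmod (den C x))\<^sup>2),
      \<chi> i. inverse ((cmod (den C x))\<^sup>2) *\<^sub>R (zco C i x * cnj (den C x))))"
    by (intro smooth_Pair smooth_mult srad smooth_sin sang iD smooth_vec_lambda U smooth_scaleR szco smooth_linear_comp[OF bounded_linear_cnj] sden)
  moreover have "inverse ((cmod d)\<^sup>2) *\<^sub>R (z * cnj d) = z / d" for z d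
    unfolding complex_div_cnj[of z d] by (simp add: scaleR_conv_of_real divide_inverse mult.commute)
  ultimately show ?thesis by (simp add: toric_def[abs_def] divide_inverse)
qed

lemma has_derivative_vec_lambda:
  fixes f :: "'n::finite \<Rightarrow> 'a::real_normed_vector \<Rightarrow> 'b::euclidean_space"
  assumes "\<And>i. (f i has_derivative f' i) (at x)"
  shows "((\<lambda>x. \<chi> i. f i x) has_derivative (\<lambda>v. \<chi> i. f' i v)) (at x)"
proof -
  have "bounded_linear (axis i :: 'b \<Rightarrow> 'b ^ 'n)" for i
    by (auto intro!: linear_conv_bounded_linear[THEN iffD1] linearI simp: axis_def vec_eq_iff)
  then have "((\<lambda>x. \<Sum>i\<in>UNIV. axis i (f i x)) has_derivative (\<lambda>v. \<Sum>i\<in>UNIV. axis i (f' i v))) (at x)"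
    by (intro has_derivative_sum bounded_linear.has_derivative[of "axis _"] assms)
  moreover have "(\<Sum>i\<in>UNIV. axis i (g i)) = (\<chi> i. g i)" for g :: "'n \<Rightarrow> 'b"
    by (simp add: vec_eq_iff axis_def)
  ultimately show ?thesis by simp
qed

lemma cis_has_derivative:
  assumes "(f has_derivative f') (at x)"
  shows "((\<lambda>x. cis (f x)) has_derivative (\<lambda>v. \<i> * cis (f x) * complex_of_real (f' v))) (at x)"
proof -
  have "((\<lambda>x. exp (\<i> * complex_of_real (f x))) has_derivative (\<lambda>v. exp (\<i> * complex_of_real (f x)) * (\<i> * complex_of_real (f' v)))) (at x)"
    by (rule has_derivative_compose[OF _ DERIV_exp[unfolded has_field_derivative_def]])
      (intro has_derivative_mult_right has_derivative_of_real assms)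
  then show ?thesis by (simp add: cis_conv_exp ac_simps)
qed

text \<open>\<open>dZ\<close> is kept as a logarithmic derivative times z_i, with the contribution
  of the radius as real part and that of the angle as imaginary part. This form makes both the
  evaluation of \<open>heis\<close> and the proof of immersivity short.\<close>

lemma toric_has_derivative:
  fixes x :: "'n::finite qcoord"
  assumes x: "x \<in> tdom C"
  defines "N \<equiv> rad C x" and "a \<equiv> den C x" and "\<rho> \<equiv> \<lambda>i. sqrt (C - snd (snd x) $ i)"
  defines "dN \<equiv> \<lambda>v::'n qcoord. - (\<Sum>i\<in>UNIV. snd (snd v) $ i) / (2 * N)"
    and "dZ \<equiv> \<lambda>i (v::'n qcoord). Complex (- (snd (snd v) $ i) / (2 * (\<rho> i)\<^sup>2)) (2 * pi * fst (snd v) $ i) * zco C i x"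
  defines "da \<equiv> \<lambda>v::'n qcoord. complex_of_real (dN v) + \<i> * cis (ang C x) * complex_of_real (ang C v)"
  defines "D \<equiv> (cmod a)\<^sup>2"
  defines "ds \<equiv> \<lambda>v. ((dN v * sin (ang C x) + N * cos (ang C x) * ang C v) * D
      - N * sin (ang C x) * (2 * N * dN v + 2 * dN v * cos (ang C x) - 2 * N * sin (ang C x) * ang C v)) / (D * D)"
  shows "(toric C has_derivative (\<lambda>v. (ds v, \<chi> i. (dZ i v * a - zco C i x * da v) / (a * a)))) (at x)"
proof -
  have N: "N > 1" using rad_facts[OF x] by (simp add: N_def)
  have anz: "a \<noteq> 0" using den_nonzero[OF x] by (simp add: a_def)
  then have Dnz: "D \<noteq> 0" by (simp add: D_def)
  note lq = bounded_linear_imp_has_derivative[OF bounded_linear_qcoord(1)] and lp = bounded_linear_imp_has_derivative[OF bounded_linear_qcoord(2)]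
    and lt = bounded_linear_imp_has_derivative[OF bounded_linear_fst]
  have dang: "(ang C has_derivative ang C) (at x)" unfolding ang_def
    by (intro has_derivative_mult_right has_derivative_diff has_derivative_sum lt lq)
  have pos: "1 + (\<Sum>i\<in>UNIV. C - snd (snd x) $ i) > 0"
    using x by (intro add_pos_nonneg sum_nonneg) (auto simp: tdom_def less_imp_le)
  have "((\<lambda>x::'n qcoord. 1 + (\<Sum>i\<in>UNIV. C - snd (snd x) $ i)) has_derivative (\<lambda>v. 0 + (\<Sum>i\<in>UNIV. 0 - snd (snd v) $ i))) (at x)"
    by (intro has_derivative_add has_derivative_diff has_derivative_sum has_derivative_const lp)
  note drad0 = has_derivative_real_sqrt[OF pos this]
  have "(\<lambda>v::'n qcoord. (0 + (\<Sum>i\<in>UNIV. 0 - snd (snd v) $ i)) * (inverse (sqrt (1 + (\<Sum>i\<in>UNIV. C - snd (snd x) $ i))) / 2)) = dN"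
    unfolding dN_def N_def rad_def by (rule ext) (simp only: add_0 diff_0 sum_negf divide_inverse inverse_mult_distrib mult.commute mult.left_commute mult_minus_left)
  with drad0 have drad: "(rad C has_derivative dN) (at x)"
    unfolding rad_def[abs_def] by (simp only:)
  have \<rho>: "\<rho> i > 0" for i using x by (simp add: \<rho>_def tdom_def)
  have dzco: "(zco C i has_derivative dZ i) (at x)" for i
  proof -
    have pos': "C - snd (snd x) $ i > 0" using x by (simp add: tdom_def)
    have "((\<lambda>x::'n qcoord. C - snd (snd x) $ i) has_derivative (\<lambda>v. 0 - snd (snd v) $ i)) (at x)"
      by (intro has_derivative_diff has_derivative_const lp)
    from has_derivative_mult[OF has_derivative_of_real[OF has_derivative_real_sqrt[OF pos' this]] cis_has_derivative[OF has_derivative_mult_right[OF lq[of i], of "2 * pi"]]]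
    have "(zco C i has_derivative (\<lambda>v. complex_of_real (\<rho> i) * (\<i> * cis (2 * pi * fst (snd x) $ i) * complex_of_real (2 * pi * fst (snd v) $ i)) +
       complex_of_real ((0 - snd (snd v) $ i) * (inverse (\<rho> i) / 2)) * cis (2 * pi * fst (snd x) $ i))) (at x)"
      unfolding zco_def[abs_def] \<rho>_def by (simp add: ac_simps)
    note dz = this
    have zc: "zco C i x = complex_of_real (\<rho> i) * cis (2 * pi * fst (snd x) $ i)" by (simp add: zco_def \<rho>_def)
    note dz
    also have "(\<lambda>v. complex_of_real (\<rho> i) * (\<i> * cis (2 * pi * fst (snd x) $ i) * complex_of_real (2 * pi * fst (snd v) $ i)) +
       complex_of_real ((0 - snd (snd v) $ i) * (inverse (\<rho> i) / 2)) * cis (2 * pi * fst (snd x) $ i)) = dZ i"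
    proof
      fix v :: "'n qcoord"
      have *: "complex_of_real ((0 - snd (snd v) $ i) * (inverse (\<rho> i) / 2)) = complex_of_real (- (snd (snd v) $ i) / (2 * (\<rho> i)\<^sup>2)) * complex_of_real (\<rho> i)"
        using \<rho>[of i] by (simp add: power2_eq_square field_simps)
      show "complex_of_real (\<rho> i) * (\<i> * cis (2 * pi * fst (snd x) $ i) * complex_of_real (2 * pi * fst (snd v) $ i)) +
       complex_of_real ((0 - snd (snd v) $ i) * (inverse (\<rho> i) / 2)) * cis (2 * pi * fst (snd x) $ i) = dZ i v"
        unfolding * dZ_def zc Complex_eq by (simp add: algebra_simps)
    qed
    finally show ?thesis .
  qed
  have dden: "(den C has_derivative da) (at x)" unfolding den_def[abs_def] da_def
    by (intro has_derivative_add has_derivative_of_real drad cis_has_derivative dang)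
  have w: "((\<lambda>x. \<chi> i. zco C i x / den C x) has_derivative (\<lambda>v. \<chi> i. (dZ i v * a - zco C i x * da v) / (a * a))) (at x)"
    unfolding a_def by (intro has_derivative_vec_lambda has_derivative_divide' dzco dden den_nonzero[OF x])
  have dsin: "((\<lambda>x. sin (ang C x)) has_derivative (\<lambda>v. ang C v * cos (ang C x))) (at x)"
    and dcos: "((\<lambda>x. cos (ang C x)) has_derivative (\<lambda>v. ang C v * - sin (ang C x))) (at x)"
    by (rule has_derivative_sin[OF dang], rule has_derivative_cos[OF dang])
  have dnum: "((\<lambda>x. rad C x * sin (ang C x)) has_derivative (\<lambda>v. N * (ang C v * cos (ang C x)) + dN v * sin (ang C x))) (at x)"
    unfolding N_def by (intro has_derivative_mult drad dsin)
  have "((\<lambda>x. rad C x * rad C x + 2 * (rad C x * cos (ang C x)) + 1) has_derivative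
      (\<lambda>v. (N * dN v + dN v * N) + 2 * (N * (ang C v * - sin (ang C x)) + dN v * cos (ang C x)) + 0)) (at x)"
    unfolding N_def by (intro has_derivative_add has_derivative_mult has_derivative_mult_right drad dcos has_derivative_const)
  then have dD: "((\<lambda>x. (cmod (den C x))\<^sup>2) has_derivative (\<lambda>v. (N * dN v + dN v * N) + 2 * (N * (ang C v * - sin (ang C x)) + dN v * cos (ang C x)))) (at x)"
    unfolding cmod_den by (simp add: power2_eq_square mult.assoc)
  have "((\<lambda>x. rad C x * sin (ang C x) / (cmod (den C x))\<^sup>2) has_derivative
     (\<lambda>v. ((N * (ang C v * cos (ang C x)) + dN v * sin (ang C x)) * D - rad C x * sin (ang C x) *
        ((N * dN v + dN v * N) + 2 * (N * (ang C v * - sin (ang C x)) + dN v * cos (ang C x)))) / (D * D))) (at x)"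
    unfolding D_def a_def by (rule has_derivative_divide'[OF dnum dD]) (use Dnz in \<open>simp add: D_def a_def\<close>)
  then have "((\<lambda>x. rad C x * sin (ang C x) / (cmod (den C x))\<^sup>2) has_derivative ds) (at x)"
    unfolding ds_def N_def[symmetric] by (simp add: algebra_simps)
  from has_derivative_Pair[OF this w] show ?thesis unfolding toric_def[abs_def] .
qed

text \<open>Multiplication by conjugates makes the denominators real, so that the contribution of a
  coordinate w_i = z_i / a to \<open>heis\<close> separates into that of z_i and that of a.\<close>

lemma heis_toric_aux:
  fixes a z dz da :: complex
  assumes "a \<noteq> 0"
  shows "Im (cnj (z / a) * ((dz * a - z * da) / (a * a))) = (Im (cnj z * dz) - (cmod z)\<^sup>2 * Im (da * cnj a) / (cmod a)\<^sup>2) / (cmod a)\<^sup>2"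
proof -
  have "cnj (z / a) * ((dz * a - z * da) / (a * a)) = (cnj z * dz - (z * cnj z) * (da * cnj a) / (a * cnj a)) / (a * cnj a)"
    using assms by (simp add: field_simps)
  also have "\<dots> = (cnj z * dz - complex_of_real ((cmod z)\<^sup>2) * (da * cnj a) / complex_of_real ((cmod a)\<^sup>2)) / complex_of_real ((cmod a)\<^sup>2)"
    by (simp only: complex_norm_square)
  finally show ?thesis by (simp only: Im_divide_of_real minus_complex.sel times_complex.sel Re_complex_of_real Im_complex_of_real) simp
qed

text \<open>Once the sums over i are reduced to \<open>S\<close> and N^2 - 1, what remains is
  polynomial algebra in N, sin u and cos u. The positive factor in front is the conformal factor of
  the radial projection followed by the Cayley transform.\<close>

lemma toric_contact:
  fixes x :: "'n::finite qcoord"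
  assumes x: "x \<in> tdom C"
  shows "heis (toric C x) (frechet_derivative (toric C) (at x) v) = 2 * pi / (cmod (den C x))\<^sup>2 * Qform (snd (snd x)) v"
    and "frechet_derivative (toric C) (at x) v = 0 \<Longrightarrow> v = 0"
proof -
  define N where "N = rad C x"
  define a where "a = den C x"
  define \<rho> where "\<rho> i = sqrt (C - snd (snd x) $ i)" for i
  define dN where "dN = - (\<Sum>i\<in>UNIV. snd (snd v) $ i) / (2 * N)"
  define \<kappa> where "\<kappa> i = Complex (- (snd (snd v) $ i) / (2 * (\<rho> i)\<^sup>2)) (2 * pi * fst (snd v) $ i)" for i
  define u where "u = ang C x"
  define \<theta> where "\<theta> = ang C v"
  define da where "da = complex_of_real dN + \<i> * cis u * complex_of_real \<theta>"
  define D where "D = (cmod a)\<^sup>2"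
  define ds where "ds = ((dN * sin u + N * cos u * \<theta>) * D - N * sin u * (2 * N * dN + 2 * dN * cos u - 2 * N * sin u * \<theta>)) / (D * D)"
  have N: "N > 1" using rad_facts[OF x] by (simp add: N_def)
  have anz: "a \<noteq> 0" using den_nonzero[OF x] by (simp add: a_def)
  then have Dpos: "D > 0" by (simp add: D_def)
  have der: "frechet_derivative (toric C) (at x) v = (ds, \<chi> i. (\<kappa> i * zco C i x * a - zco C i x * da) / (a * a))"
    using fun_cong[OF frechet_derivative_at[OF toric_has_derivative[OF x]], of v]
    by (simp add: ds_def da_def \<kappa>_def dN_def N_def a_def \<rho>_def u_def \<theta>_def D_def)
  have tor: "toric C x = (N * sin u / D, \<chi> i. zco C i x / a)"
    by (simp add: toric_def N_def u_def D_def a_def)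
  have \<rho>: "\<rho> i > 0" "(\<rho> i)\<^sup>2 = C - snd (snd x) $ i" for i using x by (auto simp: \<rho>_def tdom_def less_imp_le)
  have D: "D = N\<^sup>2 + 2 * N * cos u + 1" by (simp add: D_def a_def cmod_den N_def u_def)
  have Imda: "Im (da * cnj a) = \<theta> * (N * cos u + 1) - sin u * dN"
  proof -
    have "\<theta> * (cos u * cos u) + \<theta> * (sin u * sin u) = \<theta>"
      using sin_cos_squared_add3[of u] by (metis distrib_left mult.right_neutral)
    then show ?thesis
      by (simp add: da_def a_def den_def N_def[symmetric] u_def[symmetric] algebra_simps)
  qed
  have Imz: "Im (cnj (zco C i x) * (\<kappa> i * zco C i x)) = (C - snd (snd x) $ i) * (2 * pi * fst (snd v) $ i)" for i
  proof -
    have "cnj (zco C i x) * (\<kappa> i * zco C i x) = \<kappa> i * complex_of_real ((cmod (zco C i x))\<^sup>2)"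
      by (simp only: complex_norm_square ac_simps)
    then have "Im (cnj (zco C i x) * (\<kappa> i * zco C i x)) = Im (\<kappa> i * complex_of_real (C - snd (snd x) $ i))"
      by (simp only: sum_zco(2)[OF x])
    also have "\<dots> = (C - snd (snd x) $ i) * (2 * pi * fst (snd v) $ i)" by (simp add: \<kappa>_def)
    finally show ?thesis .
  qed
  \<comment> \<open>The contribution 2 pi sum (C - p_i) dq_i of the coordinates z_i. That of z_0 is
    \<theta>, and the terms with C cancel in \<theta> + S, which leaves 2 pi (dt -
    \<lambda>).\<close>
  define S where "S = (\<Sum>i\<in>UNIV. (C - snd (snd x) $ i) * (2 * pi * fst (snd v) $ i))"
  have "heis (toric C x) (frechet_derivative (toric C) (at x) v) =
     ds + (\<Sum>i\<in>UNIV. ((C - snd (snd x) $ i) * (2 * pi * fst (snd v) $ i) - (cmod (zco C i x))\<^sup>2 * Im (da * cnj a) / D) / D)"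
    unfolding der tor heis_def
    by (simp only: fst_conv snd_conv vec_lambda_beta heis_toric_aux[OF anz] D_def[symmetric] Imz)
  also have "\<dots> = ds + (S - (N\<^sup>2 - 1) * Im (da * cnj a) / D) / D"
    using sum_zco(1)[OF x] by (simp add: S_def N_def sum_subtractf sum_divide_distrib[symmetric] sum_distrib_right[symmetric])
  also have "\<dots> = (ds * (D * D) + S * D - (N\<^sup>2 - 1) * Im (da * cnj a)) / (D * D)"
    using Dpos by (simp add: field_simps)
  also have "ds * (D * D) = (dN * sin u + N * cos u * \<theta>) * D - N * sin u * (2 * N * dN + 2 * dN * cos u - 2 * N * sin u * \<theta>)"
    using Dpos by (simp add: ds_def)
  also have "(dN * sin u + N * cos u * \<theta>) * D - N * sin u * (2 * N * dN + 2 * dN * cos u - 2 * N * sin u * \<theta>) + S * D - (N\<^sup>2 - 1) * Im (da * cnj a)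
     = (\<theta> + S) * D"
  proof -
    have "(sin u)\<^sup>2 + (cos u)\<^sup>2 = 1" by simp
    then show ?thesis unfolding Imda D by algebra
  qed
  also have "(\<theta> + S) * D / (D * D) = (\<theta> + S) / D" using Dpos by simp
  also have "\<theta> + S = 2 * pi * Qform (snd (snd x)) v"
  proof -
    have "S = (\<Sum>i\<in>UNIV. 2 * pi * (C * fst (snd v) $ i) - 2 * pi * (snd (snd x) $ i * fst (snd v) $ i))"
      by (simp add: S_def algebra_simps)
    then have "S = 2 * pi * (C * (\<Sum>i\<in>UNIV. fst (snd v) $ i)) - 2 * pi * (\<Sum>i\<in>UNIV. snd (snd x) $ i * fst (snd v) $ i)"
      by (simp only: sum_subtractf sum_distrib_left[symmetric])
    then show ?thesis by (simp add: \<theta>_def ang_def Qform_def case_prod_unfold algebra_simps)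
  qed
  finally show main: "heis (toric C x) (frechet_derivative (toric C) (at x) v) = 2 * pi / (cmod (den C x))\<^sup>2 * Qform (snd (snd x)) v"
    by (simp add: D_def a_def)
  text \<open>If the differential vanishes, the logarithmic derivatives of the \<open>z\<^sub>i\<close> all agree with that of
    the denominator, so they form one complex number \<open>k\<close>.\<close>
  show "v = 0" if v0: "frechet_derivative (toric C) (at x) v = 0"
  proof -
    define k where "k = da / a"
    have \<kappa>k: "\<kappa> i = k" for i
    proof -
      have "zco C i x \<noteq> 0" using sum_zco(2)[OF x, of i] \<rho>[of i] by auto
      moreover have "(\<kappa> i * zco C i x * a - zco C i x * da) / (a * a) = 0"
        using v0 unfolding der by (simp add: vec_eq_iff zero_prod_def)
      ultimately show ?thesis using anz by (simp add: k_def field_simps)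
    qed
    have \<xi>: "snd (snd v) $ i = - 2 * Re k * (C - snd (snd x) $ i)" "2 * pi * fst (snd v) $ i = Im k" for i
      using \<kappa>k[of i] \<rho>[of i] by (auto simp: \<kappa>_def complex_eq_iff field_simps)
    have NN: "(\<Sum>i\<in>UNIV. C - snd (snd x) $ i) = N\<^sup>2 - 1" using rad_facts(2)[OF x] by (simp add: N_def)
    have "(\<Sum>i\<in>UNIV. snd (snd v) $ i) = - 2 * Re k * (N\<^sup>2 - 1)"
      unfolding NN[symmetric] sum_distrib_left by (rule sum.cong) (simp_all add: \<xi>(1))
    then have dN: "dN * N = Re k * (N\<^sup>2 - 1)" using N by (simp add: dN_def)
    \<comment> \<open>The part already proved turns the vanishing of the differential into dt -
      \<lambda> = 0 on \<open>v\<close>, and this determines \<theta>.\<close>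
    have "heis (toric C x) (0::real \<times> (complex ^ 'n)) = 0" by (simp add: heis_def)
    then have "Qform (snd (snd x)) v = 0" using main v0 anz by (simp add: a_def)
    then have "\<theta> = - S" using \<open>\<theta> + S = 2 * pi * Qform (snd (snd x)) v\<close> by simp
    moreover have "S = Im k * (N\<^sup>2 - 1)"
      unfolding S_def NN[symmetric] sum_distrib_left by (rule sum.cong) (simp_all add: \<xi>(2))
    ultimately have \<theta>: "\<theta> = - Im k * (N\<^sup>2 - 1)" by simp
    have "da = k * a" using anz by (simp add: k_def)
    then have re: "dN - sin u * \<theta> = Re k * (N + cos u) - Im k * sin u" and im: "cos u * \<theta> = Re k * sin u + Im k * (N + cos u)"
      by (simp_all add: complex_eq_iff da_def a_def den_def N_def u_def mult.commute)
    have sc: "(sin u)\<^sup>2 + (cos u)\<^sup>2 = 1" by simp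
    \<comment> \<open>Real and imaginary parts of da = k a become a linear system for Re k and Im k.
      It forces both to vanish since (N cos u + 1)^2 + (N sin u)^2 = D > 0.\<close>
    have e1: "Re k * (N * cos u + 1) = sin u * N ^ 3 * Im k" using re dN unfolding \<theta> by algebra
    have e2: "Re k * sin u = - Im k * N * (N * cos u + 1)" using im unfolding \<theta> by algebra
    have "Re k * D = 0" using e1 e2 sc unfolding D by algebra
    then have k1: "Re k = 0" using Dpos by simp
    have "Im k * D = 0"
    proof -
      have "sin u * N ^ 3 * Im k = 0" "Im k * N * (N * cos u + 1) = 0" using e1 e2 k1 by auto
      then have "sin u * Im k = 0" "Im k * (N * cos u + 1) = 0" using N by auto
      then show ?thesis using sc unfolding D by algebra
    qed
    then have k2: "Im k = 0" using Dpos by simp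
    have q0: "fst (snd v) $ i = 0" "snd (snd v) $ i = 0" for i using \<xi>[of i] k1 k2 by auto
    moreover have "fst v = 0" using \<theta> k2 q0 by (simp add: \<theta>_def ang_def)
    ultimately show ?thesis by (simp add: prod_eq_iff vec_eq_iff)
  qed
qed

text \<open>By periodicity a bound on a compact fundamental domain is enough; the momenta there fill
  a closed ball, with 0 included.\<close>

lemma toric_bounded:
  assumes "R < C" "C \<in> \<int>"
  obtains B where "0 < B" "\<And>x :: 'n::finite qcoord. norm (snd (snd x)) \<le> R \<Longrightarrow> norm (toric C x) \<le> B"
proof -
  let ?K = "{0..1::real} \<times> cbox (0 :: real ^ 'n) 1 \<times> cball (0 :: real ^ 'n) R"
  have sub: "?K \<subseteq> tdom C"
  proof
    fix x assume "x \<in> ?K"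
    then have "norm (snd (snd x)) \<le> R" by auto
    then have "snd (snd x) $ i < C" for i using component_le_norm_cart[of "snd (snd x)" i] assms(1) by linarith
    then show "x \<in> tdom C" by (simp add: tdom_def)
  qed
  have "compact (toric C ` ?K)"
    by (intro compact_continuous_image continuous_on_subset[OF smooth_continuous_on[OF smooth_toric] sub] compact_Times) auto
  then obtain B where B: "B > 0" "\<And>x. x \<in> ?K \<Longrightarrow> norm (toric C x) \<le> B"
    using compact_imp_bounded bounded_pos by (metis imageI)
  have "norm (toric C x) \<le> B" if x: "norm (snd (snd x)) \<le> R" for x :: "'n qcoord"
  proof -
    obtain y where y: "Qcover y = Qcover x" "fst y \<in> {0..1}" "fst (snd y) \<in> cbox 0 1" "snd (snd y) = snd (snd x)"
      by (rule Qcover_fundamental_domain)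
    have "y \<in> ?K" using y(2-4) x by (metis (no_types, lifting) SigmaI dist_0_norm mem_cball prod.collapse)
    then show ?thesis using B(2)[of y] toric_periodic[OF y(1) assms(2)] by simp
  qed
  then show thesis using that B(1) by blast
qed

section \<open>The manifold \<open>\<real>/\<int> \<times> SY\<close> and its covering map\<close>

lemma continuous_abs_circle: "continuous_on UNIV abs_circle"
  by (simp add: continuous_on_open_vimage open_circle_def)

lemma continuous_Qcover: "continuous_on UNIV (Qcover :: 'n::finite qcoord \<Rightarrow> _)"
  unfolding Qcover_def case_prod_unfold
  by (intro continuous_on_Pair continuous_on_vec_lambda continuous_on_compose2[OF continuous_abs_circle] continuous_intros) auto

text \<open>The preimage of the image is the union of the integer translates of
  \<open>T\<close>.\<close>

lemma open_abs_circle: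
  assumes "open T" shows "open (abs_circle ` T)"
proof -
  have "abs_circle -` (abs_circle ` T) = (\<Union>k\<in>\<int>. (\<lambda>x. x + k) ` T)"
  proof (intro equalityI subsetI)
    fix x assume "x \<in> abs_circle -` (abs_circle ` T)"
    then obtain y where "y \<in> T" "x - y \<in> \<int>" by (auto simp: circle.abs_eq_iff)
    then show "x \<in> (\<Union>k\<in>\<int>. (\<lambda>x. x + k) ` T)" by (auto intro!: bexI[of _ "x - y"] image_eqI[of _ _ y])
  next
    fix x assume "x \<in> (\<Union>k\<in>\<int>. (\<lambda>x. x + k) ` T)"
    then obtain k y where "k \<in> \<int>" "y \<in> T" "x = y + k" by auto
    then have "abs_circle x = abs_circle y" by (simp add: circle.abs_eq_iff)
    then show "x \<in> abs_circle -` (abs_circle ` T)" using \<open>y \<in> T\<close> by simp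
  qed
  moreover have "open (\<Union>k\<in>\<int>. (\<lambda>x. x + k) ` T)"
    using open_translation[OF assms] by (auto simp: add.commute)
  ultimately show ?thesis by (simp add: open_circle_def)
qed

lemma open_Qcover:
  assumes "open (A :: 'n::finite qcoord set)" shows "open (Qcover ` A)"
proof (rule Topological_Spaces.openI)
  fix z assume "z \<in> Qcover ` A"
  then obtain t q p where z: "(t, q, p) \<in> A" "z = Qcover (t, q, p)" by auto
  obtain T B where T: "open T" "open B" "(t, q, p) \<in> T \<times> B" "T \<times> B \<subseteq> A" using assms z(1) by (rule open_prod_elim)
  then have "(q, p) \<in> B" by simp
  with \<open>open B\<close> obtain S P where S: "open S" "open P" "(q, p) \<in> S \<times> P" "S \<times> P \<subseteq> B" by (rule open_prod_elim)
  obtain I where I: "\<And>i. open (I i)" "\<And>i. q $ i \<in> I i" "\<And>q'. (\<And>i. q' $ i \<in> I i) \<Longrightarrow> q' \<in> S"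
    using S(1,3) unfolding open_vec_def by (metis SigmaE2)
  let ?N = "abs_circle ` T \<times> {q'. \<forall>i. q' $ i \<in> abs_circle ` I i} \<times> P"
  have "open ?N" by (intro open_Times open_vector_box allI open_abs_circle T I S)
  moreover have "z \<in> ?N" using z T S I by (auto simp: Qcover_def)
  moreover have "?N \<subseteq> Qcover ` A"
  proof
    fix y assume "y \<in> ?N"
    then obtain t' q' p' where y: "y = (abs_circle t', q', p')" "t' \<in> T" "p' \<in> P" "\<forall>i. q' $ i \<in> abs_circle ` I i" by auto
    from y(4) have "\<forall>i. \<exists>r. r \<in> I i \<and> q' $ i = abs_circle r" by blast
    from choice[OF this] obtain r where r: "\<forall>i. r i \<in> I i \<and> q' $ i = abs_circle (r i)" by blast
    have "(\<chi> i. r i) \<in> S" by (rule I(3)) (simp add: r)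
    then have "((\<chi> i. r i), p') \<in> B" using S(4) y(3) by blast
    then have "(t', (\<chi> i. r i), p') \<in> A" using T(4) y(2) by blast
    moreover have "y = Qcover (t', (\<chi> i. r i), p')" using y r by (simp add: Qcover_def vec_eq_iff)
    ultimately show "y \<in> Qcover ` A" by blast
  qed
  ultimately show "\<exists>T. open T \<and> z \<in> T \<and> T \<subseteq> Qcover ` A" by blast
qed

text \<open>Two points of the ball have coordinates less than 1 apart, so integer differences
  vanish.\<close>

lemma Qcover_inj_on_ball: "inj_on Qcover (ball (x :: 'n::finite qcoord) (1/2))"
proof (rule inj_onI)
  fix y z :: "'n qcoord" assume y: "y \<in> ball x (1/2)" and z: "z \<in> ball x (1/2)" and eq: "Qcover y = Qcover z"
  have d: "dist y z < 1" using y z dist_triangle[of y z x] by (simp add: dist_commute)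
  have int0: "k = 0" if "k \<in> \<int>" "\<bar>k\<bar> < 1" for k :: real
    using that by (metis Ints_nonzero_abs_less1)
  have "\<bar>fst y - fst z\<bar> < 1" using d dist_fst_le[of y z] by (simp add: dist_real_def)
  then have 1: "fst y = fst z" using int0[of "fst y - fst z"] eq by (simp add: Qcover_eq_iff)
  have "fst (snd y) $ i = fst (snd z) $ i" for i
  proof -
    have "dist (fst (snd y)) (fst (snd z)) < 1"
      using d dist_snd_le[of y z] dist_fst_le[of "snd y" "snd z"] by linarith
    then have "\<bar>fst (snd y) $ i - fst (snd z) $ i\<bar> < 1"
      using dist_vec_nth_le[of "fst (snd y)" i "fst (snd z)"] by (simp add: dist_real_def)
    then show ?thesis using int0[of "fst (snd y) $ i - fst (snd z) $ i"] eq by (simp add: Qcover_eq_iff)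
  qed
  moreover have "snd (snd y) = snd (snd z)" using eq by (simp add: Qcover_eq_iff)
  ultimately show "y = z" using 1 by (simp add: prod_eq_iff vec_eq_iff)
qed

lemma Qcover_in_Qset: "Qcover x \<in> Qset \<longleftrightarrow> snd (snd x) \<noteq> 0"
  by (simp add: Qcover_def Qset_def case_prod_unfold)

lemma Qcover_surj: obtains x where "Qcover x = z"
proof -
  obtain t q p where z: "z = (t, q, p)" by (cases z)
  have s: "\<exists>r. abs_circle r = c" for c by (metis Quotient_circle Quotient_def)
  obtain t' where "abs_circle t' = t" using s by blast
  moreover obtain f where "\<forall>i. abs_circle (f i) = q $ i"
    using s choice[of "\<lambda>i r. abs_circle r = q $ i"] by blast
  ultimately have "Qcover (t', (\<chi> i. f i), p) = z" by (simp add: z Qcover_def vec_eq_iff)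
  then show thesis using that by blast
qed

definition Qdom :: "'n::finite qcoord set" where "Qdom = {x. snd (snd x) \<noteq> 0}"

lemma open_Qdom: "open (Qdom :: 'n::finite qcoord set)"
  unfolding Qdom_def by (intro open_Collect_neq continuous_intros)

lemma Qchart_exists:
  assumes "x \<in> Qdom" obtains V where "open V" "inj_on Qcover V" "Qcover ` V \<subseteq> Qset" "x \<in> V"
proof -
  show thesis
  proof (rule that[of "ball x (1/2) \<inter> Qdom"])
    show "open (ball x (1/2) \<inter> Qdom)" by (intro open_Int open_ball open_Qdom)
    show "inj_on Qcover (ball x (1/2) \<inter> Qdom)" by (rule inj_on_subset[OF Qcover_inj_on_ball]) blast
  qed (use assms in \<open>auto simp: Qcover_in_Qset Qdom_def\<close>)
qed

text \<open>Describes a chart by its lift \<open>V\<close>: the inverse of the chart is the covering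
  map, and the chart image of any part of its domain is a preimage under the covering map.\<close>

lemma Qchart:
  assumes "c \<in> Qcharts"
  obtains V where "c = (Qcover ` V, inv_into V Qcover)" "open V" "inj_on Qcover V" "V \<subseteq> Qdom" "Qcover ` V \<subseteq> Qset"
    "\<And>y. y \<in> V \<Longrightarrow> chart_inv c y = Qcover y" "\<And>y. y \<in> V \<Longrightarrow> snd c (Qcover y) = y"
    "\<And>A. snd c ` {z \<in> fst c. z \<in> A} = {y \<in> V. Qcover y \<in> A}"
proof -
  obtain V where V: "c = (Qcover ` V, inv_into V Qcover)" "open V" "inj_on Qcover V" "Qcover ` V \<subseteq> Qset"
    using assms by (auto simp: Qcharts_def)
  have 1: "snd c (Qcover y) = y" if "y \<in> V" for y using that V by simp
  have "inj_on (snd c) (fst c)"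
    by (rule inj_on_inverseI[where g = Qcover]) (simp add: V(1) f_inv_into_f)
  then have 2: "chart_inv c y = Qcover y" if "y \<in> V" for y
  proof -
    have "inv_into (fst c) (snd c) (snd c (Qcover y)) = Qcover y"
      by (rule inv_into_f_f[OF \<open>inj_on (snd c) (fst c)\<close>]) (use that V(1) in simp)
    then show ?thesis unfolding chart_inv_def 1[OF that] .
  qed
  have 3: "snd c ` {z \<in> fst c. z \<in> A} = {y \<in> V. Qcover y \<in> A}" for A
  proof (intro equalityI subsetI)
    fix w assume "w \<in> snd c ` {z \<in> fst c. z \<in> A}"
    then obtain z where z: "z \<in> fst c" "z \<in> A" "w = snd c z" by blast
    then obtain y where "y \<in> V" "z = Qcover y" using V(1) by auto
    then show "w \<in> {y \<in> V. Qcover y \<in> A}" using 1 z by simp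
  next
    fix w assume "w \<in> {y \<in> V. Qcover y \<in> A}"
    then have w: "w \<in> V" "Qcover w \<in> A" by auto
    show "w \<in> snd c ` {z \<in> fst c. z \<in> A}"
      by (rule image_eqI[of _ _ "Qcover w"]) (use 1[OF w(1)] w V(1) in auto)
  qed
  show thesis by (rule that[OF V(1-3) _ V(4) 2 1 3]) (use V(4) in \<open>auto simp: Qdom_def Qcover_in_Qset[symmetric]\<close>)
qed

lemma chart_of_open:
  assumes "open V" "inj_on Qcover V" "Qcover ` V \<subseteq> Qset"
  shows "(Qcover ` V, inv_into V Qcover) \<in> Qcharts"
  using assms by (auto simp: Qcharts_def)

text \<open>Chart inverses are restrictions of the covering map, so smoothness in charts is
  smoothness of the periodic function upstairs.\<close>

lemma smooth_real_Qcover: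
  fixes E :: "'n::finite qpoint \<Rightarrow> real"
  assumes "smooth_real_on Qcontact Qset E"
  shows "smooth Qdom (\<lambda>x. E (Qcover x))"
  unfolding smooth_def
proof (intro conjI allI Ck_on_local open_Qdom)
  fix k and x :: "'n qcoord" assume "x \<in> Qdom"
  then obtain V0 where V0: "open V0" "inj_on Qcover V0" "Qcover ` V0 \<subseteq> Qset" "x \<in> V0" by (rule Qchart_exists)
  define c where "c = (Qcover ` V0, inv_into V0 Qcover)"
  have c: "c \<in> Qcharts" unfolding c_def by (rule chart_of_open[OF V0(1-3)])
  obtain V where V: "c = (Qcover ` V, inv_into V Qcover)" "open V" "inj_on Qcover V" "V \<subseteq> Qdom" "Qcover ` V \<subseteq> Qset"
    "\<And>y. y \<in> V \<Longrightarrow> chart_inv c y = Qcover y" "\<And>y. y \<in> V \<Longrightarrow> snd c (Qcover y) = y"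
    "\<And>A. snd c ` {z \<in> fst c. z \<in> A} = {y \<in> V. Qcover y \<in> A}"
    by (rule Qchart[OF c]) (rule that)
  have "x \<in> snd c ` {z \<in> fst c. z \<in> UNIV}"
    by (rule image_eqI[of _ _ "Qcover x"]) (use V0 in \<open>auto simp: c_def\<close>)
  then have xV: "x \<in> V" unfolding V(8) by simp
  have "smooth_on (snd c ` (Qset \<inter> fst c)) (E \<circ> chart_inv c)"
    using bspec[OF assms[unfolded smooth_real_on_def], of c] c by (simp add: Qcontact_def)
  moreover have "snd c ` (Qset \<inter> fst c) = V"
  proof -
    have "Qset \<inter> fst c = {z \<in> fst c. z \<in> Qset}" by blast
    then have "snd c ` (Qset \<inter> fst c) = {y \<in> V. Qcover y \<in> Qset}" using V(8) by simp
    then show ?thesis using V(4) by (auto simp: Qcover_in_Qset Qdom_def)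
  qed
  ultimately have "smooth V (E \<circ> chart_inv c)" using smooth_on_smooth[OF V(2)] by simp
  then have "smooth V (\<lambda>x. E (Qcover x))" by (rule smooth_cong) (simp add: V(6))
  then show "\<exists>V. open V \<and> x \<in> V \<and> Ck_on k V (\<lambda>x. E (Qcover x))"
    using V(2) xV unfolding smooth_def by blast
qed

section \<open>Starshaped domains\<close>

locale homogeneous =
  fixes E :: "'n::finite qpoint \<Rightarrow> real"
  assumes smooth_E: "smooth_real_on Qcontact Qset E" and pos_E: "\<And>z. z \<in> Qset \<Longrightarrow> 0 < E z"
    and hom_E: "\<And>s t q p. p \<noteq> 0 \<Longrightarrow> E (t, q, exp s *\<^sub>R p) = exp s * E (t, q, p)"
begin

definition e :: "'n qcoord \<Rightarrow> real" where "e x = E (Qcover x)"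

lemma smooth_e: "smooth Qdom e"
  using smooth_real_Qcover[OF smooth_E] by (simp add: e_def[abs_def])

lemma e_pos: "x \<in> Qdom \<Longrightarrow> 0 < e x"
  unfolding e_def by (rule pos_E) (simp add: Qcover_in_Qset Qdom_def)

lemma e_exp: "p \<noteq> 0 \<Longrightarrow> e (t, q, exp s *\<^sub>R p) = exp s * e (t, q, p)"
  by (simp add: e_def Qcover_def hom_E)

text \<open>\<open>e\<close> attains a positive minimum m over unit momenta in a compact fundamental
  domain; homogeneity gives e >= m |p|, hence |p| <= 1/m on the domain.\<close>

lemma sublevel_bounded:
  obtains R where "\<And>x. x \<in> Qdom \<Longrightarrow> e x \<le> 1 \<Longrightarrow> norm (snd (snd x)) \<le> R"
proof -
  let ?K = "{0..1::real} \<times> cbox (0 :: real ^ 'n) 1 \<times> sphere (0 :: real ^ 'n) 1"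
  have K: "compact ?K" by (intro compact_Times) auto
  have sub: "?K \<subseteq> Qdom" by (auto simp: Qdom_def)
  \<comment> \<open>A unit momentum, so that \<open>?K\<close> is nonempty and the minimum
    exists.\<close>
  have "norm (axis (undefined::'n) (1::real)) = 1" by (simp add: norm_axis_1)
  then have "(0, 0, axis undefined 1) \<in> ?K" by (auto simp: mem_box_cart)
  then have "?K \<noteq> {}" by blast
  then obtain x0 where x0: "x0 \<in> ?K" "\<And>x. x \<in> ?K \<Longrightarrow> e x0 \<le> e x"
    using continuous_attains_inf[OF K _ continuous_on_subset[OF smooth_continuous_on[OF smooth_e] sub]] by blast
  define m where "m = e x0"
  have m: "m > 0" using e_pos[of x0] x0(1) sub unfolding m_def by blast
  have "norm (snd (snd x)) \<le> 1 / m" if x: "x \<in> Qdom" "e x \<le> 1" for x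
  proof -
    obtain y where y: "Qcover y = Qcover x" "fst y \<in> {0..1}" "fst (snd y) \<in> cbox 0 1" "snd (snd y) = snd (snd x)"
      by (rule Qcover_fundamental_domain)
    obtain t q p where y': "y = (t, q, p)" by (cases y)
    have p: "p \<noteq> 0" using x(1) y(4) y' by (simp add: Qdom_def)
    let ?p = "(1 / norm p) *\<^sub>R p"
    have "exp (ln (norm p)) *\<^sub>R ?p = p" using p by simp
    then have "e (t, q, p) = norm p * e (t, q, ?p)" using e_exp[of ?p t q "ln (norm p)"] p by simp
    moreover have "m \<le> e (t, q, ?p)" using x0(2)[of "(t, q, ?p)"] y p by (simp add: m_def y')
    then have "norm p * m \<le> norm p * e (t, q, ?p)" by (rule mult_left_mono) simp
    moreover have "e y = e x" using y(1) by (simp add: e_def)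
    ultimately have "norm p * m \<le> 1" using x(2) by (simp add: y')
    then show ?thesis using m y(4) by (simp add: field_simps y')
  qed
  then show thesis using that by blast
qed

text \<open>Euler's identity in degree one, from differentiating the homogeneity along exp(s) p at s
  = 0.\<close>

lemma euler:
  assumes x: "x \<in> Qdom"
  shows "frechet_derivative e (at x) (0, 0, snd (snd x)) = e x"
proof -
  obtain t q p where x': "x = (t, q, p)" by (cases x)
  have p: "p \<noteq> 0" using x by (simp add: Qdom_def x')
  have "((\<lambda>s. (t, q, exp s *\<^sub>R p)) has_derivative (\<lambda>h. (0, 0, (exp 0 * h) *\<^sub>R p))) (at (0::real))"
    by (auto intro!: derivative_eq_intros)
  moreover have "(e has_derivative frechet_derivative e (at x)) (at ((\<lambda>s. (t, q, exp s *\<^sub>R p)) 0))"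
    using smooth_has_derivative[OF smooth_e x] by (simp add: x')
  ultimately have 1: "((\<lambda>s. e (t, q, exp s *\<^sub>R p)) has_derivative (\<lambda>h. frechet_derivative e (at x) (0, 0, (exp 0 * h) *\<^sub>R p))) (at 0)"
    by (rule has_derivative_compose)
  have 2: "((\<lambda>s. e (t, q, exp s *\<^sub>R p)) has_derivative (\<lambda>h. (exp 0 * h) * e x)) (at 0)"
    unfolding e_exp[OF p] x' by (auto intro!: derivative_eq_intros)
  have "frechet_derivative e (at x) (0, 0, (exp 0 * 1) *\<^sub>R p) = (exp 0 * 1) * e x"
    by (rule fun_cong[OF has_derivative_unique[OF 1 2], of 1])
  then show ?thesis by (simp add: x')
qed

text \<open>Moving in the direction \<open>- p\<close> decreases \<open>e\<close> at a positive rate, so every direction points into the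
  domain after adding a multiple of this one. The tangent cone of the domain therefore spans.\<close>

lemma inward_direction:
  assumes x: "x \<in> Qdom" "e x \<le> 1" and U: "open U" "x \<in> U"
  obtains K d where "0 < K" "0 < d"
    "\<And>r. r \<in> {0..d} \<Longrightarrow> x + r *\<^sub>R (v - K *\<^sub>R (0, 0, snd (snd x))) \<in> U \<inter> {y \<in> Qdom. e y \<le> 1}"
proof -
  define P :: "'n qcoord" where "P = (0, 0, snd (snd x))"
  let ?D = "frechet_derivative e (at x)"
  \<comment> \<open>By Euler's identity the derivative along (0, 0, p) is \<open>e x\<close>; this
    choice makes the derivative along v - K (0, 0, p) at most -1.\<close>
  define K where "K = (\<bar>?D v\<bar> + 1) / e x"
  have K: "K > 0" using e_pos[OF x(1)] by (simp add: K_def)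
  define u where "u = v - K *\<^sub>R P"
  have De: "(e has_derivative ?D) (at x)" using smooth_has_derivative[OF smooth_e x(1)] .
  have "?D u = ?D v - K * e x"
    using linear_diff[OF has_derivative_linear[OF De]] linear_scale[OF has_derivative_linear[OF De]] euler[OF x(1), folded P_def]
    by (simp add: u_def)
  then have neg: "?D u < 0" using e_pos[OF x(1)] by (simp add: K_def)
  have lin: "((\<lambda>r. x + r *\<^sub>R u) has_derivative (\<lambda>r. r *\<^sub>R u)) (at 0)" by (auto intro!: derivative_eq_intros)
  have "((\<lambda>r. e (x + r *\<^sub>R u)) has_derivative (\<lambda>r. ?D (r *\<^sub>R u))) (at 0)"
    by (rule has_derivative_compose[OF lin]) (use De in simp)
  moreover have "(\<lambda>r. ?D (r *\<^sub>R u)) = (*) (?D u)"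
    using linear_scale[OF has_derivative_linear[OF De]] by (simp add: fun_eq_iff mult.commute)
  ultimately have "((\<lambda>r. e (x + r *\<^sub>R u)) has_real_derivative ?D u) (at 0)" by (simp add: has_field_derivative_def)
  from DERIV_neg_dec_right[OF this neg] obtain d1 where d1: "d1 > 0" "\<And>h. 0 < h \<Longrightarrow> h < d1 \<Longrightarrow> e (x + h *\<^sub>R u) < e x"
    by auto
  have "open ((\<lambda>r. x + r *\<^sub>R u) -` (U \<inter> Qdom))"
    by (intro open_vimage open_Int U open_Qdom continuous_intros)
  moreover have "0 \<in> (\<lambda>r. x + r *\<^sub>R u) -` (U \<inter> Qdom)" using U x by simp
  ultimately obtain d2 where d2: "d2 > 0" "ball 0 d2 \<subseteq> (\<lambda>r. x + r *\<^sub>R u) -` (U \<inter> Qdom)"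
    using open_contains_ball by blast
  have "x + r *\<^sub>R u \<in> U \<inter> {y \<in> Qdom. e y \<le> 1}" if r: "r \<in> {0..min d1 d2 / 2}" for r
  proof -
    have "r \<in> ball 0 d2" using r d2(1) by auto
    then have "x + r *\<^sub>R u \<in> U \<inter> Qdom" using d2(2) by blast
    moreover have "e (x + r *\<^sub>R u) \<le> 1" using d1(2)[of r] r d1(1) x(2) by (cases "r = 0") auto
    ultimately show ?thesis by simp
  qed
  then show thesis using that[of K "min d1 d2 / 2"] K d1(1) d2(1) by (simp add: u_def P_def)
qed

text \<open>Two derivatives agree on every direction whose initial segment stays in the domain.
  \<open>inward_direction\<close> supplies a negative multiple of \<open>P\<close> and, for every
  \<open>v\<close>, a vector v - K P; linearity then gives \<open>v\<close> itself. At boundary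
  points of the domain this determines \<open>frechet_derivative\<close> within it.\<close>

lemma derivative_within_unique:
  fixes f :: "'n qcoord \<Rightarrow> 'b::real_normed_vector"
  assumes x: "x \<in> Qdom" "e x \<le> 1" and U: "open U" "x \<in> U" and S: "U \<inter> {y \<in> Qdom. e y \<le> 1} \<subseteq> S"
    and D: "(f has_derivative D) (at x within S)" and D': "(f has_derivative D') (at x within S)"
  shows "D = D'"
proof
  define P :: "'n qcoord" where "P = (0, 0, snd (snd x))"
  have along: "D u = D' u" if d: "0 < d" "\<And>r. r \<in> {0..d} \<Longrightarrow> x + r *\<^sub>R u \<in> U \<inter> {y \<in> Qdom. e y \<le> 1}" for u d
  proof -
    have "((\<lambda>r. f (x + r *\<^sub>R u)) has_vector_derivative A u) (at 0 within {0..d})"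
      if A: "(f has_derivative A) (at x within S)" for A
    proof -
      have lin: "((\<lambda>r. x + r *\<^sub>R u) has_derivative (\<lambda>r. r *\<^sub>R u)) (at 0 within {0..d})" by (auto intro!: derivative_eq_intros)
      have "(\<lambda>r. x + r *\<^sub>R u) ` {0..d} \<subseteq> S" using d(2) S by blast
      then have "(f has_derivative A) (at (x + 0 *\<^sub>R u) within (\<lambda>r. x + r *\<^sub>R u) ` {0..d})"
        using has_derivative_subset[OF A] by simp
      from has_derivative_in_compose[OF lin this]
      show ?thesis
        using linear_scale[OF has_derivative_linear[OF A]] by (simp add: has_vector_derivative_def)
    qed
    from this[OF D] this[OF D'] show ?thesis
      by (rule vector_derivative_unique_within_closed_interval[where a = 0 and b = d, simplified, rotated 2]) (use d(1) in auto)
  qed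
  have lin: "linear D" "linear D'" using D D' has_derivative_linear by blast+
  fix v
  obtain K d where 1: "0 < K" "0 < d" "\<And>r. r \<in> {0..d} \<Longrightarrow> x + r *\<^sub>R (v - K *\<^sub>R P) \<in> U \<inter> {y \<in> Qdom. e y \<le> 1}"
    using inward_direction[OF x U, of v, folded P_def] by blast
  obtain K' d' where 2: "0 < K'" "0 < d'" "\<And>r. r \<in> {0..d'} \<Longrightarrow> x + r *\<^sub>R (0 - K' *\<^sub>R P) \<in> U \<inter> {y \<in> Qdom. e y \<le> 1}"
    using inward_direction[OF x U, of 0, folded P_def] by blast
  have "D (0 - K' *\<^sub>R P) = D' (0 - K' *\<^sub>R P)" using along[OF 2(2,3)] .
  then have P: "D P = D' P" using 2(1) by (simp add: linear_neg[OF lin(1)] linear_neg[OF lin(2)] linear_diff[OF lin(1)] linear_diff[OF lin(2)] linear_scale[OF lin(1)] linear_scale[OF lin(2)] linear_0[OF lin(1)] linear_0[OF lin(2)])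
  have "D (v - K *\<^sub>R P) = D' (v - K *\<^sub>R P)" using along[OF 1(2,3)] .
  then show "D v = D' v" using P by (simp add: linear_diff[OF lin(1)] linear_diff[OF lin(2)] linear_scale[OF lin(1)] linear_scale[OF lin(2)])
qed

end

section \<open>Embedding into a contact form\<close>

text \<open>The Heisenberg dilations: the weights 2 and 1 of the coordinates make
  \<open>heis\<close> homogeneous of degree two.\<close>

definition dil :: "real \<Rightarrow> real \<times> (complex ^ 'n::finite) \<Rightarrow> real \<times> (complex ^ 'n)" where
  "dil a x = (a\<^sup>2 * fst x, a *\<^sub>R snd x)"

lemma dil_linear: "bounded_linear (dil a)"
  unfolding dil_def
  by (intro bounded_linear_Pair bounded_linear_compose[OF bounded_linear_mult_right bounded_linear_fst]
      bounded_linear_compose[OF bounded_linear_scaleR_right bounded_linear_snd])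

lemma heis_dil: "heis (dil a x) (dil a v) = a\<^sup>2 * heis x v"
  by (simp add: heis_def dil_def distrib_left sum_distrib_left power2_eq_square algebra_simps)

lemma dil_inj: "a \<noteq> 0 \<Longrightarrow> dil a x = dil a y \<Longrightarrow> x = y"
  by (simp add: dil_def prod_eq_iff)

lemma dil_norm:
  assumes "0 \<le> a" "a \<le> 1" shows "norm (dil a x) \<le> a * norm x"
proof -
  have "\<bar>a\<^sup>2 * fst x\<bar> \<le> \<bar>a * fst x\<bar>"
    using assms by (auto simp: abs_mult power2_eq_square intro!: mult_right_mono mult_left_le)
  then have "(a\<^sup>2 * fst x)\<^sup>2 \<le> (a * fst x)\<^sup>2" by (simp only: abs_le_square_iff)
  then have "norm (dil a x) \<le> norm (a *\<^sub>R x)"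
    using assms by (simp add: dil_def norm_prod_def power_mult_distrib)
  then show ?thesis using assms by simp
qed

lemma smooth_on_subset:
  assumes "smooth_on W f" "V \<subseteq> W" shows "smooth_on V f"
proof (rule smooth_onI)
  fix x assume "x \<in> V"
  then obtain U g where "x \<in> U" "smooth U g" "\<And>y. y \<in> W \<inter> U \<Longrightarrow> g y = f y"
    using smooth_onE[OF assms(1), of x] assms(2) by blast
  then show "\<exists>U g. x \<in> U \<and> smooth U g \<and> (\<forall>y\<in>V \<inter> U. g y = f y)" using assms(2) by blast
qed

lemma contact_form_on_subset:
  assumes "contact_form_on W \<alpha>" "V \<subseteq> W" shows "contact_form_on V \<alpha>"
proof -
  have "smooth_on V (\<lambda>y. \<alpha> y v)" for v
  proof -
    have "smooth_on W (\<lambda>y. \<alpha> y v)" using assms(1) unfolding contact_form_on_def smooth_form_on_def by blast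
    then show ?thesis by (rule smooth_on_subset[OF _ assms(2)])
  qed
  then show ?thesis using assms by (auto simp: contact_form_on_def smooth_form_on_def)
qed

text \<open>The set \<open>O'\<close> is open and contains all points with momentum of norm at most
  R, including momentum 0. A compact set covering the domain therefore lies in it, which later
  yields the embedding property.\<close>

theorem contact_form_embedding:
  fixes \<alpha> :: "'e::euclidean_space \<Rightarrow> 'e \<Rightarrow> real"
  assumes W: "open W" "y0 \<in> W" and \<alpha>: "contact_form_on W \<alpha>" and dim: "DIM('e) = 2 * CARD('n::finite) + 1"
  obtains \<Psi> :: "'n::finite qcoord \<Rightarrow> 'e" and O' where "smooth O' \<Psi>" "{x. norm (snd (snd x)) \<le> R} \<subseteq> O'" "\<Psi> ` O' \<subseteq> W"
    "\<And>x y. Qcover x = Qcover y \<Longrightarrow> \<Psi> x = \<Psi> y"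
    "\<And>x y. x \<in> O' \<Longrightarrow> y \<in> O' \<Longrightarrow> \<Psi> x = \<Psi> y \<Longrightarrow> Qcover x = Qcover y"
    "\<And>x v. x \<in> O' \<Longrightarrow> frechet_derivative \<Psi> (at x) v = 0 \<Longrightarrow> v = 0"
    "\<And>x v. x \<in> O' \<Longrightarrow> Qform (snd (snd x)) v = 0 \<longleftrightarrow> \<alpha> (\<Psi> x) (frechet_derivative \<Psi> (at x) v) = 0"
proof -
  note main = that
  show thesis
  proof (rule contact_darboux[OF W \<alpha> dim])
    fix F :: "real \<times> (complex ^ 'n) \<Rightarrow> 'e" and r
    assume F: "0 < r" "smooth (ball 0 r) F" "F ` ball 0 r \<subseteq> W" "inj_on F (ball 0 r)"
      "\<And>x v. x \<in> ball 0 r \<Longrightarrow> frechet_derivative F (at x) v = 0 \<Longrightarrow> v = 0"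
      "\<And>x v. x \<in> ball 0 r \<Longrightarrow> heis x v = 0 \<longleftrightarrow> \<alpha> (F x) (frechet_derivative F (at x) v) = 0"
    \<comment> \<open>An integer above R, hence above each coordinate of a momentum of norm at most
      R.\<close>
    define C where "C = real_of_int (\<lfloor>R\<rfloor> + 1)"
    have C: "C \<in> \<int>" "R < C" by (auto simp: C_def)
    obtain B where B: "0 < B" "\<And>x :: 'n qcoord. norm (snd (snd x)) \<le> R \<Longrightarrow> norm (toric C x) \<le> B"
      using toric_bounded[OF C(2,1)] by metis
    \<comment> \<open>The bound 1 is for \<open>dil_norm\<close>; the bound r/(2 B) brings points of
      norm at most B strictly inside the Darboux ball.\<close>
    define a where "a = min 1 (r / (2 * B))"
    have a: "0 < a" "a \<le> 1" "a * B < r"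
    proof -
      show "0 < a" "a \<le> 1" using B(1) F(1) by (auto simp: a_def)
      have "a * B \<le> r / (2 * B) * B" using B(1) by (intro mult_right_mono) (auto simp: a_def)
      also have "\<dots> < r" using B(1) F(1) by simp
      finally show "a * B < r" .
    qed
    define g where "g x = dil a (toric C x)" for x :: "'n qcoord"
    have sg: "smooth (tdom C) g" unfolding g_def by (rule smooth_linear_comp[OF dil_linear smooth_toric])
    define O' where "O' = tdom C \<inter> g -` ball 0 r"
    have oO: "open O'" unfolding O'_def
      by (rule continuous_open_preimage[OF smooth_continuous_on[OF sg] open_tdom open_ball])
    have Ot: "x \<in> tdom C" "g x \<in> ball 0 r" if "x \<in> O'" for x using that by (auto simp: O'_def)
    have dg: "(g has_derivative (\<lambda>v. dil a (frechet_derivative (toric C) (at x) v))) (at x)" if "x \<in> O'" for x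
      unfolding g_def by (rule bounded_linear.has_derivative[OF dil_linear smooth_has_derivative[OF smooth_toric Ot(1)[OF that]]])
    have D: "frechet_derivative (\<lambda>x. F (g x)) (at x) = (\<lambda>v. frechet_derivative F (at (g x)) (dil a (frechet_derivative (toric C) (at x) v)))"
      if "x \<in> O'" for x
      by (rule frechet_derivative_at[symmetric])
        (rule has_derivative_compose[OF dg[OF that] smooth_has_derivative[OF F(2) Ot(2)[OF that]]])
    show thesis
    proof (rule main[of O' "\<lambda>x. F (g x)"])
      show "smooth O' (\<lambda>x. F (g x))"
        by (rule smooth_compose[OF F(2) smooth_subset[OF sg oO]]) (use Ot in auto)
      show "{x. norm (snd (snd x)) \<le> R} \<subseteq> O'"
      proof
        fix x :: "'n qcoord" assume "x \<in> {x. norm (snd (snd x)) \<le> R}"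
        then have x: "norm (snd (snd x)) \<le> R" by simp
        then have "snd (snd x) $ i < C" for i using component_le_norm_cart[of "snd (snd x)" i] C(2) by linarith
        moreover have "norm (g x) \<le> a * norm (toric C x)" unfolding g_def using a by (intro dil_norm) auto
        then have "norm (g x) < r" using mult_left_mono[OF B(2)[OF x], of a] a by linarith
        ultimately show "x \<in> O'" by (simp add: O'_def tdom_def)
      qed
      show "(\<lambda>x. F (g x)) ` O' \<subseteq> W" using F(3) Ot by blast
      show "F (g x) = F (g y)" if "Qcover x = Qcover y" for x y
        using toric_periodic[OF that C(1)] by (simp add: g_def)
      show "Qcover x = Qcover y" if "x \<in> O'" "y \<in> O'" "F (g x) = F (g y)" for x y
      proof -
        have "g x = g y" using F(4) that Ot by (meson inj_onD)
        then have "toric C x = toric C y" using dil_inj[of a "toric C x" "toric C y"] a(1) by (simp add: g_def)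
        from toric_injective[OF Ot(1)[OF that(1)] Ot(1)[OF that(2)] C(1) this] show ?thesis .
      qed
      show "v = 0" if x: "x \<in> O'" and "frechet_derivative (\<lambda>x. F (g x)) (at x) v = 0" for x v
      proof -
        have "dil a (frechet_derivative (toric C) (at x) v) = 0"
          by (rule F(5)[OF Ot(2)[OF x] that(2)[unfolded D[OF x]]])
        moreover have "dil a (0 :: real \<times> (complex ^ 'n)) = 0" by (simp add: dil_def zero_prod_def)
        ultimately have "frechet_derivative (toric C) (at x) v = 0"
          using a(1) dil_inj[of a "frechet_derivative (toric C) (at x) v" 0] by simp
        then show ?thesis by (rule toric_contact(2)[OF Ot(1)[OF x]])
      qed
      show "Qform (snd (snd x)) v = 0 \<longleftrightarrow> \<alpha> (F (g x)) (frechet_derivative (\<lambda>x. F (g x)) (at x) v) = 0" if x: "x \<in> O'" for x v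
        unfolding D[OF x] F(6)[OF Ot(2)[OF x], symmetric] unfolding g_def heis_dil toric_contact(1)[OF Ot(1)[OF x]]
        using a(1) den_nonzero[OF Ot(1)[OF x]] by simp
    qed
  qed
qed

section \<open>Charts and tangent vectors\<close>

text \<open>Chart images are open only relative to a half-space; the third fact yields genuinely
  open sets from an open set \<open>W\<close> inside the image.\<close>

lemma smooth_manifold_chart:
  assumes M: "smooth_manifold M" and c: "c \<in> charts M"
  shows "openin (mtop M) (fst c)" "inj_on (snd c) (fst c)"
    "\<And>G W. openin (mtop M) G \<Longrightarrow> open W \<Longrightarrow> W \<subseteq> snd c ` fst c \<Longrightarrow> open (W \<inter> snd c ` (fst c \<inter> G))"
    "\<exists>b. openin (top_of_set {y. 0 \<le> b \<bullet> y}) (snd c ` fst c)"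
proof -
  obtain U f where cc: "c = (U, f)" by (cases c)
  have *: "openin (mtop M) U" "homeomorphic_map (subtopology (mtop M) U) (top_of_set (f ` U)) f"
    "\<exists>b. openin (top_of_set {y. 0 \<le> b \<bullet> y}) (f ` U)"
    using M c unfolding smooth_manifold_def cc by auto
  show "openin (mtop M) (fst c)" "\<exists>b. openin (top_of_set {y. 0 \<le> b \<bullet> y}) (snd c ` fst c)"
    using * by (simp_all add: cc)
  have top: "topspace (subtopology (mtop M) U) = U"
    using openin_subset[OF *(1)] by (auto simp: topspace_subtopology)
  show "inj_on (snd c) (fst c)" using homeomorphic_imp_injective_map[OF *(2)] unfolding top cc by simp
  fix G W assume G: "openin (mtop M) G" and W: "open W" "W \<subseteq> snd c ` fst c"
  have "openin (subtopology (mtop M) U) (U \<inter> G)"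
    unfolding openin_subtopology using G by blast
  then have "openin (top_of_set (f ` U)) (f ` (U \<inter> G))"
    using homeomorphic_imp_open_map[OF *(2)] unfolding open_map_def by blast
  then obtain T where T: "open T" "f ` (U \<inter> G) = f ` U \<inter> T" by (auto simp: openin_open)
  have "W \<inter> snd c ` (fst c \<inter> G) = W \<inter> T" using T(2) W(2) by (auto simp: cc)
  then show "open (W \<inter> snd c ` (fst c \<inter> G))" using W(1) T(1) by auto
qed

text \<open>A chart image with a point on the boundary of the half-space also has points off it:
  moving along the inner normal \<open>b\<close> increases the product with
  \<open>b\<close>.\<close>

lemma interior_chart_point:
  assumes M: "smooth_manifold M"
  obtains c W where "c \<in> charts M" "open W" "W \<noteq> {}" "W \<subseteq> snd c ` fst c"
proof -
  have "topspace (mtop M) \<noteq> {}" using M unfolding smooth_manifold_def by blast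
  then obtain x where "x \<in> topspace (mtop M)" by blast
  moreover have "(\<Union>(U, f)\<in>charts M. U) = topspace (mtop M)" using M by (simp add: smooth_manifold_def)
  ultimately obtain U f where c: "(U, f) \<in> charts M" "x \<in> U" by blast
  obtain b where "openin (top_of_set {y. 0 \<le> b \<bullet> y}) (f ` U)"
    using smooth_manifold_chart(4)[OF M c(1)] by auto
  then obtain T where T: "open T" "f ` U = {y. 0 \<le> b \<bullet> y} \<inter> T" by (auto simp: openin_open)
  show thesis
  proof (cases "b = 0")
    case True
    then show thesis using that[OF c(1), of T] T c(2) by auto
  next
    case False
    have fx: "f x \<in> T" "0 \<le> b \<bullet> f x" using T(2) c(2) by auto
    obtain d where d: "d > 0" "ball (f x) d \<subseteq> T" using T(1) fx(1) open_contains_ball by blast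
    \<comment> \<open>A step of length d/2 along \<open>b\<close>, which stays in the ball of radius
      d.\<close>
    let ?y = "f x + (d / (2 * norm b)) *\<^sub>R b"
    have "?y \<in> T" using d False by (intro subsetD[OF d(2)]) (simp add: dist_norm)
    moreover have "0 < b \<bullet> ?y" using fx(2) d(1) False by (simp add: inner_add_right add_nonneg_pos)
    moreover have "open (T \<inter> {y. 0 < b \<bullet> y})"
      by (intro open_Int T(1) open_Collect_less continuous_intros)
    ultimately show thesis using that[OF c(1), of "T \<inter> {y. 0 < b \<bullet> y}"] T(2) by fastforce
  qed
qed

text \<open>Near a common point two charts differ by a constant translation, integral in
  \<open>t\<close> and \<open>q\<close> and zero in \<open>p\<close>: a deck transformation of the
  covering.\<close>

lemma Qtransition:
  fixes z :: "'n::finite qpoint"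
  assumes c: "c \<in> Qcharts" and d: "d \<in> Qcharts" and z: "z \<in> fst c" "z \<in> fst d"
  shows "frechet_derivative (snd d \<circ> chart_inv c) (at (snd c z) within snd c ` (fst c \<inter> fst d)) = (\<lambda>u. u)"
proof -
  obtain V where V: "c = (Qcover ` V, inv_into V Qcover)" "open V" "inj_on Qcover V" "V \<subseteq> Qdom" "Qcover ` V \<subseteq> Qset"
    "\<And>y. y \<in> V \<Longrightarrow> chart_inv c y = Qcover y" "\<And>y. y \<in> V \<Longrightarrow> snd c (Qcover y) = y"
    "\<And>A. snd c ` {z \<in> fst c. z \<in> A} = {y \<in> V. Qcover y \<in> A}"
    by (rule Qchart[OF c]) (rule that)
  obtain V' where V': "d = (Qcover ` V', inv_into V' Qcover)" "open V'" "inj_on Qcover V'" "V' \<subseteq> Qdom" "Qcover ` V' \<subseteq> Qset"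
    "\<And>y. y \<in> V' \<Longrightarrow> chart_inv d y = Qcover y" "\<And>y. y \<in> V' \<Longrightarrow> snd d (Qcover y) = y"
    "\<And>A. snd d ` {z \<in> fst d. z \<in> A} = {y \<in> V'. Qcover y \<in> A}"
    by (rule Qchart[OF d]) (rule that)
  let ?S = "snd c ` (fst c \<inter> fst d)"
  have "fst c \<inter> fst d = {z \<in> fst c. z \<in> Qcover ` V'}" using V'(1) by auto
  then have S: "?S = {y \<in> V. Qcover y \<in> Qcover ` V'}" using V(8) by simp
  have "?S = V \<inter> Qcover -` (Qcover ` V')" unfolding S by blast
  moreover have "open (Qcover -` (Qcover ` V'))"
    using continuous_Qcover open_Qcover[OF V'(2)] open_vimage by blast
  ultimately have oS: "open ?S" using V(2) by (simp add: open_Int)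
  obtain y where y: "y \<in> V" "z = Qcover y" using z(1) V(1) by auto
  obtain y' where y': "y' \<in> V'" "z = Qcover y'" using z(2) V'(1) by auto
  define k where "k = y' - y"
  have per: "Qcover (w + k) = Qcover w" for w
    using y(2) y'(2) by (simp add: Qcover_eq_iff k_def)
  have sz: "snd c z = y" using V(7) y by simp
  have yS: "y \<in> ?S" using sz z by blast
  define T where "T = ?S \<inter> (\<lambda>w. w + k) -` V'"
  have oT: "open T" unfolding T_def by (intro open_Int oS open_vimage V'(2) continuous_intros)
  have yT: "y \<in> T" using yS y'(1) by (simp add: T_def k_def)
  have "((\<lambda>w. w + k) has_derivative (\<lambda>u. u)) (at y)" by (auto intro!: derivative_eq_intros)
  then have "((snd d \<circ> chart_inv c) has_derivative (\<lambda>u. u)) (at y)"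
  proof (rule has_derivative_transform_within_open[OF _ oT yT])
    fix w assume "w \<in> T"
    then have w: "w \<in> V" "w + k \<in> V'" unfolding T_def S by auto
    show "w + k = (snd d \<circ> chart_inv c) w" using V(6)[OF w(1)] V'(7)[OF w(2)] per[of w] by simp
  qed
  then show ?thesis
    unfolding sz at_within_open[OF yS oS] by (rule frechet_derivative_at[symmetric])
qed

lemma Qcontact_simps:
  "charts Qcontact = Qcharts" "mtop Qcontact = top_of_set Qset" "charts Qmanifold = Qcharts"
  "charts_at Qcontact z = charts_at Qmanifold z" "tangent_space Qcontact z = tangent_space Qmanifold z"
  by (simp_all add: Qcontact_def Qmanifold_def charts_at_def tangent_space_def)

text \<open>All coordinate changes have the identity as derivative, so one vector \<open>u\<close>
  serves every chart around the point.\<close>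

lemma Qtangent_space:
  fixes z :: "'n::finite qpoint"
  shows "tangent_space Qmanifold z = {v. \<exists>u. v = (\<lambda>c. if c \<in> charts_at Qmanifold z then u else 0)}"
proof -
  have tr: "frechet_derivative (snd d \<circ> chart_inv c) (at (snd c z) within snd c ` (fst c \<inter> fst d)) = (\<lambda>u. u)"
    if "c \<in> charts_at Qmanifold z" "d \<in> charts_at Qmanifold z" for c d
    using that by (intro Qtransition) (auto simp: charts_at_def Qcontact_simps)
  show ?thesis
  proof (intro equalityI subsetI)
    fix v assume v: "v \<in> tangent_space Qmanifold z"
    have v1: "v d = v c" if "c \<in> charts_at Qmanifold z" "d \<in> charts_at Qmanifold z" for c d
    proof -
      have "v d = frechet_derivative (snd d \<circ> chart_inv c) (at (snd c z) within snd c ` (fst c \<inter> fst d)) (v c)"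
        using v that unfolding tangent_space_def by blast
      then show ?thesis unfolding tr[OF that] .
    qed
    have v2: "v c = 0" if "c \<notin> charts_at Qmanifold z" for c
      using v that unfolding tangent_space_def by blast
    show "v \<in> {v. \<exists>u. v = (\<lambda>c. if c \<in> charts_at Qmanifold z then u else 0)}"
    proof (cases "charts_at Qmanifold z = {}")
      case True
      then have "v = (\<lambda>c. if c \<in> charts_at Qmanifold z then 0 else 0)" using v2 by auto
      then show ?thesis by blast
    next
      case False
      then obtain c0 where "c0 \<in> charts_at Qmanifold z" by blast
      then have "v = (\<lambda>c. if c \<in> charts_at Qmanifold z then v c0 else 0)"
        by (intro ext) (metis v1 v2)
      then show ?thesis by blast
    qed
  next
    fix v :: "('n qpoint, 'n qcoord) chart \<Rightarrow> 'n qcoord"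
    assume "v \<in> {v. \<exists>u. v = (\<lambda>c. if c \<in> charts_at Qmanifold z then u else 0)}"
    then obtain u where u: "v = (\<lambda>c. if c \<in> charts_at Qmanifold z then u else 0)" by blast
    show "v \<in> tangent_space Qmanifold z"
      unfolding tangent_space_def mem_Collect_eq
    proof (intro conjI ballI allI impI)
      fix c d assume cd: "c \<in> charts_at Qmanifold z" "d \<in> charts_at Qmanifold z"
      show "v d = frechet_derivative (snd d \<circ> chart_inv c) (at (snd c z) within snd c ` (fst c \<inter> fst d)) (v c)"
        unfolding tr[OF cd] using cd u by simp
    qed (use u in simp)
  qed
qed

lemma embedding_map_restrict:
  assumes "embedding_map X Y f" shows "embedding_map (subtopology X S) Y f"
  unfolding embedding_map_def
proof -
  have h: "homeomorphic_map X (subtopology Y (f ` topspace X)) f" using assms by (simp add: embedding_map_def)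
  have "homeomorphic_map (subtopology X S) (subtopology (subtopology Y (f ` topspace X)) (f ` (topspace X \<inter> S))) f"
  proof (rule homeomorphic_map_subtopologies[OF h])
    show "f ` (topspace X \<inter> S) = topspace (subtopology Y (f ` topspace X)) \<inter> f ` (topspace X \<inter> S)"
      unfolding homeomorphic_imp_surjective_map[OF h, symmetric] by blast
  qed
  then show "homeomorphic_map (subtopology X S) (subtopology Y (f ` topspace (subtopology X S))) f"
    by (simp add: subtopology_subtopology image_mono inf.absorb2 Int_absorb1)
qed

section \<open>The contact embedding\<close>

theorem theorem2:
  fixes \<Omega> :: "'n::finite qpoint set"
    and M :: "('m, 'e::euclidean_space) contact_data"
  assumes "starshaped_domain \<Omega>"
    and "contact_manifold M"
    and "DIM('e) = 2 * CARD('n) + 1"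
  shows "\<exists>\<phi>. contact_embedding_on Qcontact \<Omega> M \<phi>"
proof -
  obtain E where E: "smooth_real_on Qcontact Qset E" "\<forall>z\<in>Qset. 0 < E z"
    "\<forall>s t q p. p \<noteq> 0 \<longrightarrow> E (t, q, exp s *\<^sub>R p) = exp s * E (t, q, p)" "\<Omega> = {z \<in> Qset. E z \<le> 1}"
    using assms(1) unfolding starshaped_domain_def by auto
  interpret homogeneous E by standard (use E in auto)
  have \<Omega>: "Qcover x \<in> \<Omega> \<longleftrightarrow> x \<in> Qdom \<and> e x \<le> 1" for x
    by (simp add: E(4) Qcover_in_Qset Qdom_def e_def)
  obtain R where R: "\<And>x. x \<in> Qdom \<Longrightarrow> e x \<le> 1 \<Longrightarrow> norm (snd (snd x)) \<le> R" using sublevel_bounded by blast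
  have sM: "smooth_manifold M" using assms(2) by (simp add: contact_manifold_def)
  obtain c0 W0 where c0: "c0 \<in> charts M" and W0: "open W0" "W0 \<noteq> {}" "W0 \<subseteq> snd c0 ` fst c0"
    using interior_chart_point[OF sM] by blast
  define U0 where "U0 = fst c0"
  define f0 where "f0 = snd c0"
  note chart0 = smooth_manifold_chart[OF sM c0, folded U0_def f0_def]
  note W0 = W0[folded U0_def f0_def]
  obtain y0 where y0: "y0 \<in> W0" using W0(2) by blast
  then obtain x0 where x0: "x0 \<in> U0" "f0 x0 = y0" using W0(3) by blast
  have "x0 \<in> topspace (mtop M)" using openin_subset[OF chart0(1)] x0(1) by blast
  moreover have "c0 \<in> charts_at M x0" using c0 x0(1) by (simp add: charts_at_def U0_def)
  ultimately obtain W \<alpha> where W: "open W" "y0 \<in> W" "contact_form_on W \<alpha>"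
    "\<And>y. y \<in> U0 \<Longrightarrow> f0 y \<in> W \<Longrightarrow> (\<lambda>v. v c0) ` hyperplane M y = {w. \<alpha> (f0 y) w = 0}"
    using assms(2) x0(2) unfolding contact_manifold_def U0_def f0_def by metis
  \<comment> \<open>Here the contact form and an open part of the chart image, away from the
    boundary of \<open>M\<close>, are available together.\<close>
  define W1 where "W1 = W \<inter> W0"
  have W1: "open W1" "y0 \<in> W1" "contact_form_on W1 \<alpha>" "W1 \<subseteq> f0 ` U0" "W1 \<subseteq> W"
    using W W0 y0 contact_form_on_subset[OF W(3)] by (auto simp: W1_def)
  obtain \<Psi> :: "'n qcoord \<Rightarrow> 'e" and O' where \<Psi>: "smooth O' \<Psi>" "{x. norm (snd (snd x)) \<le> R} \<subseteq> O'" "\<Psi> ` O' \<subseteq> W1"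
    "\<And>x y. Qcover x = Qcover y \<Longrightarrow> \<Psi> x = \<Psi> y"
    "\<And>x y. x \<in> O' \<Longrightarrow> y \<in> O' \<Longrightarrow> \<Psi> x = \<Psi> y \<Longrightarrow> Qcover x = Qcover y"
    "\<And>x v. x \<in> O' \<Longrightarrow> frechet_derivative \<Psi> (at x) v = 0 \<Longrightarrow> v = 0"
    "\<And>x v. x \<in> O' \<Longrightarrow> Qform (snd (snd x)) v = 0 \<longleftrightarrow> \<alpha> (\<Psi> x) (frechet_derivative \<Psi> (at x) v) = 0"
    by (rule contact_form_embedding[OF W1(1-3) assms(3)]) (rule that)
  have oO: "open O'" using \<Psi>(1) by (rule smooth_open)
  have \<Psi>W: "\<Psi> x \<in> W1" "\<Psi> x \<in> f0 ` U0" if "x \<in> O'" for x using \<Psi>(3) W1(4) that by blast+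
  have \<Omega>O: "x \<in> O'" if "Qcover x \<in> \<Omega>" for x using that R \<Psi>(2) unfolding \<Omega> by blast
  define g where "g = chart_inv c0"
  have g: "g y \<in> U0" "f0 (g y) = y" if "y \<in> f0 ` U0" for y
    using that unfolding g_def chart_inv_def U0_def[symmetric] f0_def[symmetric]
    by (auto intro: inv_into_into f_inv_into_f)
  have gf: "g (f0 m) = m" if "m \<in> U0" for m
    using inv_into_f_f[OF chart0(2) that] unfolding g_def chart_inv_def U0_def f0_def .
  \<comment> \<open>Any lift of \<open>z\<close> may be chosen, as \<Psi> takes the same value on
    all of them.\<close>
  define \<phi> where "\<phi> z = g (\<Psi> (SOME x. Qcover x = z))" for z
  have \<phi>: "\<phi> (Qcover x) = g (\<Psi> x)" for x
  proof -
    have "Qcover (SOME x'. Qcover x' = Qcover x) = Qcover x" by (rule someI) simp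
    then show ?thesis unfolding \<phi>_def using \<Psi>(4) by metis
  qed
  have f\<phi>: "\<phi> (Qcover x) \<in> U0" "f0 (\<phi> (Qcover x)) = \<Psi> x" if "x \<in> O'" for x
    using g[OF \<Psi>W(2)[OF that]] by (simp_all add: \<phi>)

  text \<open>The domain lies in the image of a compact set on which the embedding is still defined.\<close>
  define K where "K = {0..1::real} \<times> cbox (0 :: real ^ 'n) 1 \<times> cball (0 :: real ^ 'n) R"
  define T where "T = Qcover ` K"
  have KO: "K \<subseteq> O'" using \<Psi>(2) by (auto simp: K_def)
  have "compact T" unfolding T_def K_def
    by (intro compact_continuous_image continuous_on_subset[OF continuous_Qcover] compact_Times) auto
  then have cT: "compact_space (top_of_set T)" by (simp add: compact_space_subtopology)
  have \<Omega>T: "\<Omega> \<subseteq> T"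
  proof
    fix z assume z: "z \<in> \<Omega>"
    obtain x where x: "Qcover x = z" by (rule Qcover_surj)
    have n: "norm (snd (snd x)) \<le> R" using R z \<Omega>[of x] x by blast
    obtain y where y: "Qcover y = Qcover x" "fst y \<in> {0..1}" "fst (snd y) \<in> cbox 0 1" "snd (snd y) = snd (snd x)"
      by (rule Qcover_fundamental_domain)
    have "y \<in> K" unfolding K_def using y(2-4) n
      by (metis (no_types, lifting) SigmaI dist_0_norm mem_cball prod.collapse)
    moreover have "z = Qcover y" using x y(1) by simp
    ultimately show "z \<in> T" unfolding T_def by blast
  qed
  have cont: "continuous_map (top_of_set T) (mtop M) \<phi>"
    unfolding continuous_map_def
  proof (intro conjI allI impI)
    show "\<phi> \<in> topspace (top_of_set T) \<rightarrow> topspace (mtop M)"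
    proof
      fix z assume "z \<in> topspace (top_of_set T)"
      then obtain x where "x \<in> K" "z = Qcover x" by (auto simp: T_def)
      then show "\<phi> z \<in> topspace (mtop M)" using f\<phi>(1)[of x] KO openin_subset[OF chart0(1)] by blast
    qed
    fix G assume G: "openin (mtop M) G"
    \<comment> \<open>Only the part of \<open>G\<close> seen through \<open>W1\<close> is pulled
      back; its chart image is open even if \<open>M\<close> has boundary.\<close>
    define A where "A = O' \<inter> \<Psi> -` (W1 \<inter> f0 ` (U0 \<inter> G))"
    have "open A" unfolding A_def
      by (rule continuous_open_preimage[OF smooth_continuous_on[OF \<Psi>(1)] oO chart0(3)[OF G W1(1,4)]])
    then have oA: "open (Qcover ` A)" by (rule open_Qcover)
    have "{z \<in> topspace (top_of_set T). \<phi> z \<in> G} = T \<inter> Qcover ` A"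
    proof (intro equalityI subsetI)
      fix z assume "z \<in> {z \<in> topspace (top_of_set T). \<phi> z \<in> G}"
      then obtain x where x: "x \<in> K" "z = Qcover x" "\<phi> (Qcover x) \<in> G" "z \<in> T" by (auto simp: T_def)
      then have "x \<in> O'" using KO by blast
      then have "x \<in> A" unfolding A_def using f\<phi>[of x] x(3) \<Psi>W[of x] by (auto intro!: image_eqI[of _ _ "\<phi> (Qcover x)"])
      then show "z \<in> T \<inter> Qcover ` A" using x by blast
    next
      fix z assume z: "z \<in> T \<inter> Qcover ` A"
      then obtain x where x: "x \<in> A" "z = Qcover x" by blast
      then obtain m where "m \<in> U0" "m \<in> G" "\<Psi> x = f0 m" by (auto simp: A_def)
      then have "\<phi> z \<in> G" using gf by (simp add: x(2) \<phi>)
      then show "z \<in> {z \<in> topspace (top_of_set T). \<phi> z \<in> G}" using z by simp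
    qed
    then show "openin (top_of_set T) {z \<in> topspace (top_of_set T). \<phi> z \<in> G}"
      using oA by (simp add: openin_open_Int)
  qed
  have inj: "inj_on \<phi> T"
  proof (rule inj_onI)
    fix z z' assume "z \<in> T" "z' \<in> T" and eq: "\<phi> z = \<phi> z'"
    then obtain x x' where x: "x \<in> O'" "z = Qcover x" "x' \<in> O'" "z' = Qcover x'" using KO unfolding T_def by blast
    then have "\<Psi> x = \<Psi> x'" using f\<phi>(2)[OF x(1)] f\<phi>(2)[OF x(3)] eq by simp
    then show "z = z'" using \<Psi>(5)[OF x(1,3)] x by simp
  qed
  \<comment> \<open>A continuous injection of a compact space into a Hausdorff space is an
    embedding. It is applied to \<open>T\<close>, since the domain fails to be compact at the zero
    section, and then restricted.\<close>
  have "Hausdorff_space (mtop M)" using sM by (simp add: smooth_manifold_def)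
  then have embT: "embedding_map (top_of_set T) (mtop M) \<phi>"
    using continuous_imp_embedding_map[OF cont cT] inj by simp
  have sub: "subtopology (mtop Qcontact) \<Omega> = subtopology (top_of_set T) \<Omega>"
    using \<Omega>T E(4) by (simp add: Qcontact_simps subtopology_subtopology Int_absorb1 inf.absorb2)
  have emb: "embedding_map (subtopology (mtop Qcontact) \<Omega>) (mtop M) \<phi>"
    unfolding sub by (rule embedding_map_restrict[OF embT])

  have coords: "coord_dom \<Omega> \<phi> c d = {y \<in> V. Qcover y \<in> \<Omega> \<and> \<phi> (Qcover y) \<in> fst d}"
    if V: "\<And>A. snd c ` {z \<in> fst c. z \<in> A} = {y \<in> V. Qcover y \<in> A}" for c V and d :: "('m, 'e) chart"
  proof -
    have "{z \<in> \<Omega>. z \<in> fst c \<and> \<phi> z \<in> fst d} = {z \<in> fst c. z \<in> {z \<in> \<Omega>. \<phi> z \<in> fst d}}" by blast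
    then show ?thesis unfolding coord_dom_def using V[of "{z \<in> \<Omega>. \<phi> z \<in> fst d}"] by simp
  qed
  have trans: "smooth_on (f0 ` (U0 \<inter> fst d)) (snd d \<circ> g)" if "d \<in> charts M" for d
  proof -
    have "\<forall>c\<in>charts M. \<forall>d\<in>charts M. smooth_on (snd c ` (fst c \<inter> fst d)) (snd d \<circ> chart_inv c)"
      using sM by (simp add: smooth_manifold_def)
    then show ?thesis using c0 that unfolding U0_def f0_def g_def by blast
  qed
  have smooth: "smooth_map_on Qcontact \<Omega> M \<phi>"
    unfolding smooth_map_on_def
  proof (intro conjI ballI)
    show "continuous_map (subtopology (mtop Qcontact) \<Omega>) (mtop M) \<phi>"
      unfolding sub by (rule continuous_map_from_subtopology[OF cont])
    fix c :: "('n qpoint, 'n qcoord) chart" and d assume c: "c \<in> charts Qcontact" and d: "d \<in> charts M"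
    then have "c \<in> Qcharts" by (simp add: Qcontact_simps)
    then obtain V where V: "c = (Qcover ` V, inv_into V Qcover)" "open V" "inj_on Qcover V" "V \<subseteq> Qdom" "Qcover ` V \<subseteq> Qset"
      "\<And>y. y \<in> V \<Longrightarrow> chart_inv c y = Qcover y" "\<And>y. y \<in> V \<Longrightarrow> snd c (Qcover y) = y"
      "\<And>A. snd c ` {z \<in> fst c. z \<in> A} = {y \<in> V. Qcover y \<in> A}"
      by (rule Qchart) (rule that)
    let ?S = "coord_dom \<Omega> \<phi> c d"
    have SO: "y \<in> V" "y \<in> O'" "\<phi> (Qcover y) \<in> fst d" if "y \<in> ?S" for y
      using that \<Omega>O unfolding coords[OF V(8)] by auto
    have "smooth_on ?S \<Psi>"
      by (rule smooth_onI) (use \<Psi>(1) SO in blast)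
    moreover have "\<Psi> ` ?S \<subseteq> f0 ` (U0 \<inter> fst d)"
    proof
      fix w assume "w \<in> \<Psi> ` ?S"
      then obtain y where y: "y \<in> ?S" "w = \<Psi> y" by blast
      then have "w = f0 (\<phi> (Qcover y))" using f\<phi>(2) SO by simp
      then show "w \<in> f0 ` (U0 \<inter> fst d)" using f\<phi>(1)[OF SO(2)[OF y(1)]] SO(3)[OF y(1)] by blast
    qed
    ultimately have "smooth_on ?S (\<lambda>y. (snd d \<circ> g) (\<Psi> y))"
      by (rule smooth_on_compose[OF trans[OF d]])
    moreover have "(snd d \<circ> g) (\<Psi> y) = (snd d \<circ> \<phi> \<circ> chart_inv c) y" if "y \<in> ?S" for y
      using V(6)[OF SO(1)[OF that]] by (simp add: \<phi>)
    ultimately show "smooth_on ?S (snd d \<circ> \<phi> \<circ> chart_inv c)"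
      unfolding smooth_on_def by (metis Int_iff)
  qed

  text \<open>A tangent vector of \<open>M\<close> in the domain of \<open>c0\<close> is given by its coordinates \<open>w\<close> in \<open>c0\<close>.\<close>
  define tv where "tv m w = (\<lambda>d. if d \<in> charts_at M m
      then frechet_derivative (snd d \<circ> g) (at (f0 m) within f0 ` (U0 \<inter> fst d)) w else 0)" for m w
  have tangent_tv: "h = tv m (h c0)" if "h \<in> tangent_space M m" "m \<in> U0" for h m
  proof
    fix d
    have "c0 \<in> charts_at M m" using c0 that(2) by (simp add: charts_at_def U0_def)
    note c0m = this
    show "h d = tv m (h c0) d"
    proof (cases "d \<in> charts_at M m")
      case True
      have "h d = frechet_derivative (snd d \<circ> chart_inv c0) (at (snd c0 m) within snd c0 ` (fst c0 \<inter> fst d)) (h c0)"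
        using that(1) c0m True unfolding tangent_space_def by blast
      then show ?thesis unfolding tv_def U0_def f0_def g_def using True by simp
    next
      case False
      then have "h d = 0" using that(1) unfolding tangent_space_def by blast
      then show ?thesis unfolding tv_def using False by simp
    qed
  qed
  \<comment> \<open>Fixes a lift \<open>y\<close> and the chart that \<open>differential_on\<close>
    chooses; in these coordinates the differential is the derivative of \<Psi> followed by
    \<open>tv\<close>. At boundary points this rests on
    \<open>derivative_within_unique\<close>.\<close>
  have point: "\<exists>y c. y \<in> Qdom \<and> e y \<le> 1 \<and> y \<in> O' \<and> z = Qcover y \<and> c \<in> charts_at Qmanifold z \<and>
     (\<forall>v. differential_on Qcontact \<Omega> M \<phi> z v = tv (\<phi> z) (frechet_derivative \<Psi> (at y) (v c)))" if z: "z \<in> \<Omega>" for z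
  proof -
    define c where "c = (SOME c. c \<in> charts_at Qcontact z)"
    have ex: "\<exists>c. c \<in> charts_at Qcontact z"
    proof -
      obtain x where x: "Qcover x = z" by (rule Qcover_surj)
      then have "x \<in> Qdom" using z \<Omega> by blast
      then obtain V where "open V" "inj_on Qcover V" "Qcover ` V \<subseteq> Qset" "x \<in> V" by (rule Qchart_exists)
      then have "(Qcover ` V, inv_into V Qcover) \<in> charts_at Qcontact z"
        using chart_of_open x by (auto simp: charts_at_def Qcontact_simps)
      then show ?thesis by blast
    qed
    have c: "c \<in> charts_at Qcontact z" unfolding c_def by (rule someI_ex[OF ex])
    then have cQ: "c \<in> Qcharts" and zc: "z \<in> fst c" by (auto simp: charts_at_def Qcontact_simps)
    obtain V where V: "c = (Qcover ` V, inv_into V Qcover)" "open V" "inj_on Qcover V" "V \<subseteq> Qdom" "Qcover ` V \<subseteq> Qset"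
      "\<And>y. y \<in> V \<Longrightarrow> chart_inv c y = Qcover y" "\<And>y. y \<in> V \<Longrightarrow> snd c (Qcover y) = y"
      "\<And>A. snd c ` {z \<in> fst c. z \<in> A} = {y \<in> V. Qcover y \<in> A}"
      by (rule Qchart[OF cQ]) (rule that)
    obtain y where y: "y \<in> V" "z = Qcover y" using zc V(1) by auto
    have sz: "snd c z = y" using V(7) y by simp
    have yd: "y \<in> Qdom" "e y \<le> 1" "y \<in> O'" using z \<Omega>[of y] \<Omega>O[of y] y(2) by auto
    have fz: "f0 (\<phi> z) = \<Psi> y" "\<phi> z \<in> U0" using f\<phi>[OF yd(3)] y(2) by auto
    have "differential_on Qcontact \<Omega> M \<phi> z v = tv (\<phi> z) (frechet_derivative \<Psi> (at y) (v c))" for v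
    proof
      fix d
      show "differential_on Qcontact \<Omega> M \<phi> z v d = tv (\<phi> z) (frechet_derivative \<Psi> (at y) (v c)) d"
      proof (cases "d \<in> charts_at M (\<phi> z)")
        case False
        then show ?thesis by (simp add: differential_on_def tv_def)
      next
        case True
        then have d: "d \<in> charts M" "\<phi> z \<in> fst d" by (auto simp: charts_at_def)
        let ?S = "coord_dom \<Omega> \<phi> c d" and ?B = "f0 ` (U0 \<inter> fst d)"
        \<comment> \<open>An open set around \<Psi> y in the image of the overlap, so that
          derivatives within that image are ordinary ones, even if \<open>d\<close> is a boundary
          chart.\<close>
        define N where "N = W1 \<inter> ?B"
        have oN: "open N" unfolding N_def by (rule chart0(3)[OF smooth_manifold_chart(1)[OF sM d(1)] W1(1,4)])
        have "f0 (\<phi> z) \<in> ?B" using fz(2) d(2) by blast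
        then have "\<Psi> y \<in> N" unfolding N_def fz(1) using \<Psi>W(1)[OF yd(3)] by blast
        then have N: "open N" "N \<subseteq> ?B" "\<Psi> y \<in> N" using oN by (auto simp: N_def)
        have "smooth N (snd d \<circ> g)"
          by (rule smooth_on_smooth[OF N(1) smooth_on_subset[OF trans[OF d(1)] N(2)]])
        from smooth_has_derivative[OF this N(3)]
        have D\<tau>: "((snd d \<circ> g) has_derivative frechet_derivative (snd d \<circ> g) (at (\<Psi> y))) (at (\<Psi> y))" .
        have "\<Psi> y \<in> interior ?B" using N interior_maximal by blast
        then have at\<tau>: "at (\<Psi> y) within ?B = at (\<Psi> y)" by (rule at_within_interior)
        define U where "U = V \<inter> (O' \<inter> \<Psi> -` N)"
        have U: "open U" "y \<in> U" unfolding U_def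
          using continuous_open_preimage[OF smooth_continuous_on[OF \<Psi>(1)] oO N(1)] V(2) y(1) yd(3) N(3) by auto
        have US: "U \<inter> {w \<in> Qdom. e w \<le> 1} \<subseteq> ?S"
        proof
          fix w assume w: "w \<in> U \<inter> {w \<in> Qdom. e w \<le> 1}"
          then obtain m where m: "m \<in> U0" "m \<in> fst d" "\<Psi> w = f0 m" using N(2) unfolding U_def by blast
          then have "\<phi> (Qcover w) = m" using gf by (simp add: \<phi>)
          then show "w \<in> ?S" unfolding coords[OF V(8)] using w m \<Omega>[of w] by (auto simp: U_def)
        qed
        have D: "((snd d \<circ> \<phi> \<circ> chart_inv c) has_derivative
           (\<lambda>u. frechet_derivative (snd d \<circ> g) (at (\<Psi> y)) (frechet_derivative \<Psi> (at y) u))) (at y within ?S)"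
        proof -
          have "((\<lambda>w. (snd d \<circ> g) (\<Psi> w)) has_derivative
             (\<lambda>u. frechet_derivative (snd d \<circ> g) (at (\<Psi> y)) (frechet_derivative \<Psi> (at y) u))) (at y)"
            by (rule has_derivative_compose[OF smooth_has_derivative[OF \<Psi>(1) yd(3)] D\<tau>])
          then have "((snd d \<circ> \<phi> \<circ> chart_inv c) has_derivative
             (\<lambda>u. frechet_derivative (snd d \<circ> g) (at (\<Psi> y)) (frechet_derivative \<Psi> (at y) u))) (at y)"
            by (rule has_derivative_transform_within_open[OF _ V(2) y(1)]) (simp add: V(6) \<phi>)
          then show ?thesis by (rule has_derivative_at_withinI)
        qed
        have "frechet_derivative (snd d \<circ> \<phi> \<circ> chart_inv c) (at y within ?S) =
          (\<lambda>u. frechet_derivative (snd d \<circ> g) (at (\<Psi> y)) (frechet_derivative \<Psi> (at y) u))"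
        proof (rule derivative_within_unique[OF yd(1,2) U US _ D])
          show "((snd d \<circ> \<phi> \<circ> chart_inv c) has_derivative
            frechet_derivative (snd d \<circ> \<phi> \<circ> chart_inv c) (at y within ?S)) (at y within ?S)"
            using D frechet_derivative_works differentiable_def by blast
        qed
        then show ?thesis
          using True unfolding differential_on_def tv_def c_def[symmetric] Let_def sz fz at\<tau> by simp
      qed
    qed
    then show ?thesis using yd y(2) c Qcontact_simps(4)[of z] by blast
  qed
  \<comment> \<open>The coordinate change from \<open>c0\<close> to itself is the identity, so
    \<open>w\<close> can be recovered from the tangent vector.\<close>
  have tv_c0: "tv m w c0 = w" if m: "m \<in> U0" "f0 m \<in> W1" for m w
  proof -
    have c0m: "c0 \<in> charts_at M m" using c0 m(1) by (simp add: charts_at_def U0_def)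
    have "((\<lambda>y. y) has_derivative (\<lambda>u. u)) (at (f0 m))" by (rule has_derivative_ident)
    then have "((snd c0 \<circ> g) has_derivative (\<lambda>u. u)) (at (f0 m))"
      by (rule has_derivative_transform_within_open[OF _ W1(1) m(2)]) (use g(2) W1(4) in \<open>auto simp: f0_def\<close>)
    from frechet_derivative_at[OF this]
    have "frechet_derivative (snd c0 \<circ> g) (at (f0 m)) = (\<lambda>u. u)" by (rule sym)
    moreover have "at (f0 m) within f0 ` (U0 \<inter> fst c0) = at (f0 m)"
    proof (rule at_within_interior)
      have "W1 \<subseteq> f0 ` (U0 \<inter> fst c0)" using W1(4) by (simp add: U0_def)
      then show "f0 m \<in> interior (f0 ` (U0 \<inter> fst c0))" using W1(1) m(2) interior_maximal by blast
    qed
    ultimately show ?thesis using c0m by (simp add: tv_def)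
  qed
  have linD: "linear (frechet_derivative \<Psi> (at y))" if "y \<in> O'" for y
    using smooth_has_derivative[OF \<Psi>(1) that] has_derivative_linear by blast
  have inj_D: "inj (frechet_derivative \<Psi> (at y))" if "y \<in> O'" for y
    using \<Psi>(6)[OF that] linear_injective_0[OF linD[OF that]] by blast
  have dimeq: "DIM('n qcoord) = DIM('e)" using assms(3) by simp
  \<comment> \<open>Equality of dimensions turns the immersion into a local isomorphism of tangent
    spaces; this gives the inclusion of the hyperplane of \<open>M\<close> in the image.\<close>
  have surj_D: "surj (frechet_derivative \<Psi> (at y))" if "y \<in> O'" for y
    using linear_injective_imp_surjective[OF linD[OF that] inj_D[OF that]] dimeq by simp
  have immersion: "inj_on (differential_on Qcontact \<Omega> M \<phi> z) (tangent_space Qcontact z)" if z: "z \<in> \<Omega>" for z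
  proof (rule inj_onI)
    obtain y c where y: "y \<in> O'" "z = Qcover y" "c \<in> charts_at Qmanifold z"
      "\<And>v. differential_on Qcontact \<Omega> M \<phi> z v = tv (\<phi> z) (frechet_derivative \<Psi> (at y) (v c))"
      using point[OF z] by blast
    have m: "\<phi> z \<in> U0" "f0 (\<phi> z) \<in> W1" using f\<phi>[OF y(1)] \<Psi>W(1)[OF y(1)] y(2) by auto
    fix v v' assume v: "v \<in> tangent_space Qcontact z" "v' \<in> tangent_space Qcontact z"
      and "differential_on Qcontact \<Omega> M \<phi> z v = differential_on Qcontact \<Omega> M \<phi> z v'"
    then have "tv (\<phi> z) (frechet_derivative \<Psi> (at y) (v c)) c0 = tv (\<phi> z) (frechet_derivative \<Psi> (at y) (v' c)) c0"
      by (simp add: y(4))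
    then have "frechet_derivative \<Psi> (at y) (v c) = frechet_derivative \<Psi> (at y) (v' c)"
      unfolding tv_c0[OF m] .
    then have "v c = v' c" using inj_D[OF y(1)] by (simp add: inj_eq)
    then show "v = v'" using v y(3) unfolding Qcontact_simps(5) Qtangent_space by auto
  qed
  have contact: "differential_on Qcontact \<Omega> M \<phi> z ` hyperplane Qcontact z = hyperplane M (\<phi> z)" if z: "z \<in> \<Omega>" for z
  proof -
    obtain y c where y: "y \<in> O'" "z = Qcover y" "c \<in> charts_at Qmanifold z"
      "\<And>v. differential_on Qcontact \<Omega> M \<phi> z v = tv (\<phi> z) (frechet_derivative \<Psi> (at y) (v c))"
      using point[OF z] by blast
    have m: "\<phi> z \<in> U0" "f0 (\<phi> z) \<in> W1" "f0 (\<phi> z) = \<Psi> y" "\<phi> z \<in> topspace (mtop M)"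
      using f\<phi>[OF y(1)] \<Psi>W(1)[OF y(1)] y(2) openin_subset[OF chart0(1)] by auto
    have ker: "(\<lambda>v. v c0) ` hyperplane M (\<phi> z) = {w. \<alpha> (\<Psi> y) w = 0}"
      using W(4)[OF m(1)] m(2,3) W1(5) by auto
    have sub: "hyperplane M (\<phi> z) \<subseteq> tangent_space M (\<phi> z)"
      using assms(2) m(4) by (simp add: contact_manifold_def)
    have p: "snd (snd z) = snd (snd y)" using y(2) by (simp add: Qcover_def case_prod_unfold)
    have hN: "hyperplane Qcontact z = {v \<in> tangent_space Qmanifold z. \<forall>c\<in>charts_at Qmanifold z. Qform (snd (snd z)) (v c) = 0}"
      by (simp add: Qcontact_def)
    show ?thesis
    proof (intro equalityI subsetI)
      fix h assume "h \<in> differential_on Qcontact \<Omega> M \<phi> z ` hyperplane Qcontact z"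
      then obtain v where v: "v \<in> hyperplane Qcontact z" "h = tv (\<phi> z) (frechet_derivative \<Psi> (at y) (v c))"
        using y(4) by auto
      have "Qform (snd (snd y)) (v c) = 0" using v(1) y(3) unfolding hN p by blast
      then have "\<alpha> (\<Psi> y) (frechet_derivative \<Psi> (at y) (v c)) = 0" using \<Psi>(7)[OF y(1)] by blast
      then have "frechet_derivative \<Psi> (at y) (v c) \<in> (\<lambda>v. v c0) ` hyperplane M (\<phi> z)" unfolding ker by blast
      then obtain h' where h': "h' \<in> hyperplane M (\<phi> z)" "h' c0 = frechet_derivative \<Psi> (at y) (v c)" by auto
      \<comment> \<open>Both are tangent vectors of the form \<open>tv\<close> with the same
        coordinates in \<open>c0\<close>.\<close>
      then have "h' = h" using tangent_tv[of h' "\<phi> z"] sub m(1) v(2) by auto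
      then show "h \<in> hyperplane M (\<phi> z)" using h'(1) by simp
    next
      fix h assume h: "h \<in> hyperplane M (\<phi> z)"
      then have "\<alpha> (\<Psi> y) (h c0) = 0" using ker by blast
      moreover obtain u where u: "h c0 = frechet_derivative \<Psi> (at y) u" using surj_D[OF y(1)] by (rule surjE)
      ultimately have "Qform (snd (snd y)) u = 0" using \<Psi>(7)[OF y(1)] by simp
      define v where "v = (\<lambda>c. if c \<in> charts_at Qmanifold z then u else 0)"
      have "v \<in> tangent_space Qmanifold z" unfolding Qtangent_space v_def by blast
      moreover have "\<forall>c\<in>charts_at Qmanifold z. Qform (snd (snd z)) (v c) = 0"
        using \<open>Qform (snd (snd y)) u = 0\<close> p by (simp add: v_def)
      ultimately have "v \<in> hyperplane Qcontact z" unfolding hN by blast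
      moreover have "v c = u" using y(3) by (simp add: v_def)
      then have "differential_on Qcontact \<Omega> M \<phi> z v = h"
        using tangent_tv[of h "\<phi> z"] h sub m(1) u by (auto simp: y(4))
      ultimately show "h \<in> differential_on Qcontact \<Omega> M \<phi> z ` hyperplane Qcontact z" by blast
    qed
  qed
  have "contact_embedding_on Qcontact \<Omega> M \<phi>"
    unfolding contact_embedding_on_def smooth_embedding_on_def
    using dimeq smooth emb immersion contact by blast
  then show ?thesis by blast
qed

end
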